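(* Let $K$ be a field of characteristic $0$, let $1\le k\le m$ and $0\le q\le k$ be integers, and let $\lambda=(\lambda_1,\dots,\lambda_m)$ be an extended partition. (1) If $\lambda_1=\dots=\lambda_{m-k}=\infty$ and $\lambda_{m-k+1}<\infty$ (so that $C_\lambda$ lies in $D^k_\infty$ and has finite codimension), then the codimension of $C_\lambda$ in $D^k_\infty$ is $$(2(m-k+1)-1)\lambda_{m-k+1}+\cdots+(2m-1)\lambda_m .$$ (2) If $\lambda_1=\dots=\lambda_{m-k}=\infty$, $\lambda_{m-k+1}<\infty$, $\lambda_1,\dots,\lambda_{m-q}>0$ and $\lambda_{m-q+1}=\dots=\lambda_m=0$ (so that $C_\lambda\cap\operatorname{Cont}^{\ge1}(x_q)$ lies in $D^k_\infty$, is nonempty, and has finite codimension), then the codimension of $C_\lambda\cap\operatorname{Cont}^{\ge1}(x_q)$ in $D^k_\infty$ is $$q(2m-q)+(2(m-k+1)-1)\lambda_{m-k+1}+\cdots+(2m-1)\lambda_m .$$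
   Context: $D^k\subset\mathbb{A}^{m^2}$ is the variety of $m\times m$ matrices of rank $\le k$ over $K$, defined by the ideal $I_{k+1}$ of all $(k+1)\times(k+1)$ minors; it has dimension $k(2m-k)$. For a finite-type $K$-scheme $X$, $X_\ell$ denotes the $\ell$-th jet scheme (representing $T\mapsto\operatorname{Hom}_K(T\times_K\operatorname{Spec}K[t]/t^{\ell+1},X)$), $X_\infty=\varprojlim_\ell X_\ell$, with truncation maps $\psi_{\infty,\ell}:X_\infty\to X_\ell$. Points of $D^k_\infty$ are $m\times m$ matrices of power series in $t$ whose $(k+1)\times(k+1)$ minors vanish. An extended partition is a nonincreasing $m$-tuple $\lambda_1\ge\dots\ge\lambda_m$ of elements of $\mathbb{N}\cup\{\infty\}$ (here $0\in\mathbb N$). The group $G=\operatorname{GL}_m\times\operatorname{GL}_m$ acts on matrices by left and right multiplication, hence $G_\infty$ acts on $(\mathbb{A}^{m^2})_\infty$ and on $D^k_\infty$. $C_\lambda$ is the $G_\infty$-orbit of the diagonal matrix $\operatorname{diag}(t^{\lambda_1},\dots,t^{\lambda_m})$, with $t^\infty=0$. $x_q$ is the diagonal matrix $\operatorname{diag}(0,\dots,0,1,\dots,1)$ with $q$ ones in the last positions, and $\operatorname{Cont}^{\ge1}(x_q)\subset D^k_\infty$ is the set of jets $\gamma$ with $\psi_{\infty,0}(\gamma)=x_q$. Codimension: let $X$ have pure dimension $n$. A cylinder in $X_\infty$ is a set $\psi_{\infty,r}^{-1}(S)$ with $S\subset X_r$ constructible. $\operatorname{Jac}_X$ is the $n$-th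 Fitting ideal of $\Omega_{X/K}$, and $\operatorname{Cont}^e(\operatorname{Jac}_X)$ is the set of $\gamma\in X_\infty$ along which $\operatorname{Jac}_X$ has $t$-adic order exactly $e$. If a cylinder $C=\psi_{\infty,r}^{-1}(S)$ is contained in $\operatorname{Cont}^e(\operatorname{Jac}_X)$, then $\operatorname{codim}(C)=n(\ell+1)-\dim\psi_{\infty,\ell}(C)$ for any $\ell\ge\max(e,r)$ (independent of $\ell$). For an arbitrary cylinder $C$, $\operatorname{codim}(C)=\min_e\operatorname{codim}(C\cap\operatorname{Cont}^e(\operatorname{Jac}_X))$. *)

theory Defs
  imports
    "HOL-Library.Poly_Mapping"
    "HOL-Library.Extended_Real"
    "HOL-Computational_Algebra.Formal_Power_Series"
    "HOL-Algebra.Ideal"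
    "HOL-Analysis.Function_Topology"
    "Jordan_Normal_Form.Determinant"
    "Jordan_Normal_Form.DL_Submatrix"
begin

section \<open>Polynomial rings on a set of variables\<close>

type_synonym ('v, 'k) mpoly = "('v \<Rightarrow>\<^sub>0 nat) \<Rightarrow>\<^sub>0 'k"

definition mp_const :: "'k::comm_ring_1 \<Rightarrow> ('v, 'k) mpoly" where
  "mp_const c = Poly_Mapping.single 0 c"

definition mp_var :: "'v \<Rightarrow> ('v, 'k::comm_ring_1) mpoly" where
  "mp_var v = Poly_Mapping.single (Poly_Mapping.single v 1) 1"

definition mp_vars :: "('v, 'k::zero) mpoly \<Rightarrow> 'v set" where
  "mp_vars p = (\<Union>\<mu>\<in>Poly_Mapping.keys p. Poly_Mapping.keys \<mu>)"

text \<open>Value of a polynomial in a commutative ring, with coefficients mapped by \<open>h\<close> and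
  the variable \<open>v\<close> sent to \<open>x v\<close>.\<close>

definition mp_eval :: "('k::zero \<Rightarrow> 'b::comm_ring_1) \<Rightarrow> ('v \<Rightarrow> 'b) \<Rightarrow> ('v, 'k) mpoly \<Rightarrow> 'b" where
  "mp_eval h x p = (\<Sum>\<mu>\<in>Poly_Mapping.keys p.
     h (Poly_Mapping.lookup p \<mu>) * (\<Prod>v\<in>Poly_Mapping.keys \<mu>. x v ^ Poly_Mapping.lookup \<mu> v))"

definition mp_deriv :: "'v \<Rightarrow> ('v, 'k::comm_ring_1) mpoly \<Rightarrow> ('v, 'k) mpoly" where
  "mp_deriv v p = (\<Sum>\<mu>\<in>Poly_Mapping.keys p.
     Poly_Mapping.single (\<mu> - Poly_Mapping.single v 1)
       (of_nat (Poly_Mapping.lookup \<mu> v) * Poly_Mapping.lookup p \<mu>))"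

text \<open>The ring \<open>K[x\<^sub>v : v \<in> W]\<close> for a set \<open>W\<close> of variables; \<open>K\<close> is the whole type \<open>'k\<close>.\<close>

definition mp_ring :: "'v set \<Rightarrow> ('v, 'k::comm_ring_1) mpoly ring" where
  "mp_ring W = \<lparr>carrier = {p. mp_vars p \<subseteq> W}, mult = (*), one = 1, zero = 0, add = (+)\<rparr>"

lemma mp_vars_iff: "mp_vars p \<subseteq> W \<longleftrightarrow> (\<forall>\<mu>. Poly_Mapping.lookup p \<mu> \<noteq> 0 \<longrightarrow> Poly_Mapping.keys \<mu> \<subseteq> W)"
  unfolding mp_vars_def in_keys_iff[symmetric] by blast

lemma mp_vars_add: "mp_vars p \<subseteq> W \<Longrightarrow> mp_vars q \<subseteq> W \<Longrightarrow> mp_vars (p + q) \<subseteq> W"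
  unfolding mp_vars_def using Poly_Mapping.keys_add[of p q] by blast

lemma mp_vars_mult: "mp_vars p \<subseteq> W \<Longrightarrow> mp_vars q \<subseteq> W \<Longrightarrow> mp_vars (p * q) \<subseteq> W"
proof -
  assume *: "mp_vars p \<subseteq> W" "mp_vars q \<subseteq> W"
  have "Poly_Mapping.keys \<mu> \<subseteq> W" if mu: "\<mu> \<in> Poly_Mapping.keys (p * q)" for \<mu>
  proof -
    from mu keys_mult[of p q] obtain a b
      where "\<mu> = a + b" "a \<in> Poly_Mapping.keys p" "b \<in> Poly_Mapping.keys q" by blast
    then show ?thesis
      using * Poly_Mapping.keys_add[of a b] unfolding mp_vars_def by blast
  qed
  then show ?thesis unfolding mp_vars_def by blast
qed

lemma mp_ring_cring: "cring (mp_ring W :: ('v, 'k::comm_ring_1) mpoly ring)"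
proof (rule cringI)
  show "abelian_group (mp_ring W :: ('v, 'k) mpoly ring)"
  proof (rule abelian_groupI)
    fix x :: "('v, 'k) mpoly" assume "x \<in> carrier (mp_ring W)"
    then show "\<exists>y\<in>carrier (mp_ring W). y \<oplus>\<^bsub>mp_ring W\<^esub> x = \<zero>\<^bsub>mp_ring W\<^esub>"
      by (intro bexI[of _ "- x"]) (auto simp: mp_ring_def mp_vars_iff)
  qed (auto simp: mp_ring_def mp_vars_add ac_simps, simp add: mp_vars_def)
  show "comm_monoid (mp_ring W :: ('v, 'k) mpoly ring)"
    by (rule comm_monoidI) (auto simp: mp_ring_def mp_vars_mult ac_simps, simp add: mp_vars_def)
qed (simp add: mp_ring_def distrib_right)


section \<open>Zariski topology, dimension, constructible sets\<close>

definition Spec :: "('a, 'b) ring_scheme \<Rightarrow> 'a set set" where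
  "Spec R = {P. primeideal P R}"

definition zariski :: "('a, 'b) ring_scheme \<Rightarrow> 'a set topology" where
  "zariski R = topology_generated_by {{P \<in> Spec R. f \<notin> P} | f. f \<in> carrier R}"

lemma topspace_zariski: "cring R \<Longrightarrow> topspace (zariski R) = Spec R"
proof -
  assume "cring R"
  then interpret cring R .
  have "\<one>\<^bsub>R\<^esub> \<notin> P" if "P \<in> Spec R" for P
    using that primeideal.I_notcarr[of P R] ideal.one_imp_carrier[of P R]
    by (auto simp: Spec_def primeideal_def)
  then show ?thesis
    unfolding zariski_def topology_generated_by_topspace using one_closed by blast
qed

definition irreducible_in :: "'a topology \<Rightarrow> 'a set \<Rightarrow> bool" where
  "irreducible_in T Z \<longleftrightarrow> Z \<subseteq> topspace T \<and> Z \<noteq> {} \<and>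
     (\<forall>A B. closedin T A \<and> closedin T B \<and> Z \<subseteq> A \<union> B \<longrightarrow> Z \<subseteq> A \<or> Z \<subseteq> B)"

text \<open>Supremum of the lengths of chains of irreducible closed subsets. The empty space has
  dimension \<open>-\<infinity>\<close>.\<close>

definition krull_dim :: "'a topology \<Rightarrow> ereal" where
  "krull_dim T = Sup {ereal (real n) | n. \<exists>Z :: nat \<Rightarrow> 'a set.
     (\<forall>i\<le>n. closedin T (Z i) \<and> irreducible_in T (Z i)) \<and> (\<forall>i<n. Z i \<subset> Z (Suc i))}"

text \<open>All spaces \<open>X\<^sub>l\<close> (\<open>l < \<infinity>\<close>) to which this is applied are Noetherian, so the constructible
  sets are the Boolean combinations of open sets.\<close>

inductive constructible_in :: "'a topology \<Rightarrow> 'a set \<Rightarrow> bool" for T where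
  "openin T U \<Longrightarrow> constructible_in T U"
| "constructible_in T A \<Longrightarrow> constructible_in T (topspace T - A)"
| "constructible_in T A \<Longrightarrow> constructible_in T B \<Longrightarrow> constructible_in T (A \<inter> B)"


section \<open>Jet schemes of affine schemes\<close>

text \<open>An affine scheme \<open>X = Spec K[x\<^sub>v : v \<in> V]/I\<close> of finite type is given by a finite set \<open>V\<close> and
  an ideal \<open>I\<close>. The variable \<open>(v, s)\<close> of a jet scheme is the coefficient of \<open>t\<^sup>s\<close> in the
  coordinate \<open>x\<^sub>v\<close>; the level \<open>l = \<infinity>\<close> gives the arc scheme.\<close>

definition jet_ring :: "'v set \<Rightarrow> enat \<Rightarrow> ('v \<times> nat, 'k::comm_ring_1) mpoly ring" where
  "jet_ring V l = mp_ring (V \<times> {s. enat s \<le> l})"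

definition generic_arc :: "'v \<Rightarrow> ('v \<times> nat, 'k::comm_ring_1) mpoly fps" where
  "generic_arc v = Abs_fps (\<lambda>s. mp_var (v, s))"

text \<open>The coefficient of \<open>t\<^sup>s\<close> in \<open>f(x(t))\<close>, where \<open>x(t)\<close> is the generic arc. It only involves
  variables \<open>(v, r)\<close> with \<open>r \<le> s\<close>, so it also computes the coefficients of \<open>f(x(t))\<close> modulo
  \<open>t\<^bsup>l+1\<^esup>\<close> for \<open>s \<le> l\<close>.\<close>

definition jet_coeff :: "nat \<Rightarrow> ('v, 'k::comm_ring_1) mpoly \<Rightarrow> ('v \<times> nat, 'k) mpoly" where
  "jet_coeff s f = fps_nth (mp_eval (\<lambda>c. fps_const (mp_const c)) generic_arc f) s"

text \<open>A map \<open>T \<times> Spec K[t]/t\<^bsup>l+1\<^esup> \<rightarrow> X\<close>, for \<open>T = Spec B\<close>, is a family of truncated power series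
  \<open>x\<^sub>v(t)\<close> over \<open>B\<close> such that all \<open>f(x(t))\<close>, \<open>f \<in> I\<close>, vanish modulo \<open>t\<^bsup>l+1\<^esup>\<close>. Hence \<open>X\<^sub>l\<close> is the
  closed subscheme of \<open>Spec K[x\<^sub>v\<^sub>,\<^sub>s : v \<in> V, s \<le> l]\<close> cut out by the coefficients
  \<open>jet_coeff s f\<close>. Its points are scheme points (prime ideals): \<open>K\<close> need not be
  algebraically closed.\<close>

definition jets :: "'v set \<Rightarrow> ('v, 'k::comm_ring_1) mpoly set \<Rightarrow> enat \<Rightarrow> ('v \<times> nat, 'k) mpoly set set"
  where
  "jets V I l = {P \<in> Spec (jet_ring V l). \<forall>f\<in>I. \<forall>s. enat s \<le> l \<longrightarrow> jet_coeff s f \<in> P}"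

definition jet_space ::
  "'v set \<Rightarrow> ('v, 'k::comm_ring_1) mpoly set \<Rightarrow> enat \<Rightarrow> ('v \<times> nat, 'k) mpoly set topology" where
  "jet_space V I l = subtopology (zariski (jet_ring V l)) (jets V I l)"

text \<open>\<open>\<psi>\<^sub>\<infinity>\<^sub>,\<^sub>l\<close>: contraction of primes along \<open>K[x\<^sub>v\<^sub>,\<^sub>s : s \<le> l] \<subseteq> K[x\<^sub>v\<^sub>,\<^sub>s : s \<in> \<nat>]\<close>.\<close>

definition trunc :: "'v set \<Rightarrow> enat \<Rightarrow> ('v \<times> nat, 'k::comm_ring_1) mpoly set \<Rightarrow> ('v \<times> nat, 'k) mpoly set"
  where
  "trunc V l P = P \<inter> carrier (jet_ring V l)"

definition cylinder_at ::
  "'v set \<Rightarrow> ('v, 'k::comm_ring_1) mpoly set \<Rightarrow> nat \<Rightarrow> ('v \<times> nat, 'k) mpoly set set \<Rightarrow> bool" where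
  "cylinder_at V I r C \<longleftrightarrow> (\<exists>S. constructible_in (jet_space V I (enat r)) S \<and>
     C = {\<gamma> \<in> jets V I \<infinity>. trunc V (enat r) \<gamma> \<in> S})"

definition cylinder ::
  "'v set \<Rightarrow> ('v, 'k::comm_ring_1) mpoly set \<Rightarrow> ('v \<times> nat, 'k) mpoly set set \<Rightarrow> bool" where
  "cylinder V I C \<longleftrightarrow> (\<exists>r. cylinder_at V I r C)"


section \<open>The Jacobian ideal and codimension\<close>

text \<open>\<open>\<Omega>\<^bsub>X/K\<^esub>\<close> is presented by the generators \<open>dx\<^sub>v\<close> (\<open>v \<in> V\<close>) and the relations
  \<open>df = \<Sum>\<^sub>v (\<partial>f/\<partial>x\<^sub>v) dx\<^sub>v\<close> (\<open>f \<in> I\<close>). So its \<open>n\<close>-th Fitting ideal is generated in \<open>K[x]/I\<close> by the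
  minors of size \<open>|V| - n\<close> of the matrix of partial derivatives. Ideals of \<open>K[x]/I\<close> are
  represented by their inverse images in \<open>K[x]\<close>.\<close>

definition jac_minors :: "'v set \<Rightarrow> ('v, 'k::comm_ring_1) mpoly set \<Rightarrow> nat \<Rightarrow> ('v, 'k) mpoly set" where
  "jac_minors V I c = {Determinant.det (mat c c (\<lambda>(a, b). mp_deriv (w b) (f a))) | f w.
     (\<forall>a<c. f a \<in> I) \<and> (\<forall>b<c. w b \<in> V)}"

definition Jac :: "'v set \<Rightarrow> ('v, 'k::comm_ring_1) mpoly set \<Rightarrow> nat \<Rightarrow> ('v, 'k) mpoly set" where
  "Jac V I n = genideal (mp_ring V) (I \<union> jac_minors V I (card V - n))"

text \<open>The \<open>t\<close>-adic order of an ideal \<open>J\<close> along an arc: the least \<open>s\<close> such that the coefficient of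
  \<open>t\<^sup>s\<close> of \<open>f(\<gamma>(t))\<close> is nonzero in the residue field of \<open>\<gamma>\<close> for some \<open>f \<in> J\<close>, and \<open>\<infinity>\<close> if
  there is none.\<close>

definition arc_ord :: "('v, 'k::comm_ring_1) mpoly set \<Rightarrow> ('v \<times> nat, 'k) mpoly set \<Rightarrow> enat" where
  "arc_ord J \<gamma> = Inf {enat s | s. \<exists>f\<in>J. jet_coeff s f \<notin> \<gamma>}"

definition Cont ::
  "'v set \<Rightarrow> ('v, 'k::comm_ring_1) mpoly set \<Rightarrow> ('v, 'k) mpoly set \<Rightarrow> nat \<Rightarrow> ('v \<times> nat, 'k) mpoly set set"
  where
  "Cont V I J e = {\<gamma> \<in> jets V I \<infinity>. arc_ord J \<gamma> = enat e}"

text \<open>Codimension of a cylinder contained in \<open>Cont V I (Jac V I n) e\<close>, for \<open>X\<close> of pure dimension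
  \<open>n\<close>. The value does not depend on \<open>r\<close>, as two levels can be compared at a large \<open>l\<close>. The
  empty cylinder has codimension \<open>\<infinity>\<close>.\<close>

definition codim_contact ::
  "'v set \<Rightarrow> ('v, 'k::comm_ring_1) mpoly set \<Rightarrow> nat \<Rightarrow> nat \<Rightarrow> ('v \<times> nat, 'k) mpoly set set \<Rightarrow> ereal"
  where
  "codim_contact V I n e C = (THE c. \<exists>r. cylinder_at V I r C \<and>
     (\<forall>l\<ge>max e r. c = ereal (real (n * (l + 1))) -
        krull_dim (subtopology (jet_space V I (enat l)) (trunc V (enat l) ` C))))"

definition arc_codim ::
  "'v set \<Rightarrow> ('v, 'k::comm_ring_1) mpoly set \<Rightarrow> nat \<Rightarrow> ('v \<times> nat, 'k) mpoly set set \<Rightarrow> ereal" where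
  "arc_codim V I n C = (INF e. codim_contact V I n e (C \<inter> Cont V I (Jac V I n) e))"


section \<open>Determinantal varieties and orbits\<close>

text \<open>Matrix positions are numbered from 0, as in \<^typ>\<open>'a mat\<close>.\<close>

abbreviation mat_coords :: "nat \<Rightarrow> (nat \<times> nat) set" where
  "mat_coords m \<equiv> {..<m} \<times> {..<m}"

definition minors_ideal :: "nat \<Rightarrow> nat \<Rightarrow> (nat \<times> nat, 'k::comm_ring_1) mpoly set" where
  "minors_ideal m p = genideal (mp_ring (mat_coords m))
     {Determinant.det (submatrix (mat m m mp_var) A B) | A B.
        A \<subseteq> {..<m} \<and> B \<subseteq> {..<m} \<and> card A = p \<and> card B = p}"

type_synonym 'k mat_jet = "((nat \<times> nat) \<times> nat, 'k) mpoly set"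

text \<open>The arc space, cylinders and codimension for \<open>D\<^sup>k\<close>, which has pure dimension \<open>k(2m-k)\<close>.\<close>

definition D_arcs :: "nat \<Rightarrow> nat \<Rightarrow> 'k::field mat_jet set" where
  "D_arcs m k = jets (mat_coords m) (minors_ideal m (k + 1)) \<infinity>"

definition D_cylinder :: "nat \<Rightarrow> nat \<Rightarrow> 'k::field mat_jet set \<Rightarrow> bool" where
  "D_cylinder m k C \<longleftrightarrow> cylinder (mat_coords m) (minors_ideal m (k + 1)) C"

definition D_codim :: "nat \<Rightarrow> nat \<Rightarrow> 'k::field mat_jet set \<Rightarrow> ereal" where
  "D_codim m k C = arc_codim (mat_coords m) (minors_ideal m (k + 1)) (k * (2 * m - k)) C"

text \<open>The arc space of \<open>GL\<^sub>m \<times> GL\<^sub>m\<close> is the open part of the arc space of two \<open>m \<times> m\<close> matrices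
  \<open>g\<close> (variables \<open>Inl\<close>) and \<open>h\<close> (variables \<open>Inr\<close>) where \<open>det g(0)\<close> and \<open>det h(0)\<close> do not
  vanish.\<close>

type_synonym 'k GG_poly = "(((nat \<times> nat) + (nat \<times> nat)) \<times> nat, 'k) mpoly"

definition GG_arcs :: "nat \<Rightarrow> 'k::field GG_poly set set" where
  "GG_arcs m = {Q \<in> Spec (jet_ring (mat_coords m <+> mat_coords m) \<infinity>).
     Determinant.det (mat m m (\<lambda>ij. mp_var (Inl ij, 0))) \<notin> Q \<and>
     Determinant.det (mat m m (\<lambda>ij. mp_var (Inr ij, 0))) \<notin> Q}"

text \<open>The ring map of the orbit map \<open>(g, h) \<mapsto> g A h\<close> of a \<open>K\<close>-rational arc \<open>A\<close>. (Acting by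
  \<open>g A h\<^sup>-\<^sup>1\<close> gives the same orbits.)\<close>

definition orbit_arc :: "nat \<Rightarrow> 'k::field fps mat \<Rightarrow> 'k GG_poly fps mat" where
  "orbit_arc m A = mat m m (\<lambda>ij. generic_arc (Inl ij)) *
     map_mat (\<lambda>a. Abs_fps (\<lambda>s. mp_const (fps_nth a s))) A *
     mat m m (\<lambda>ij. generic_arc (Inr ij))"

definition orbit_comap ::
  "nat \<Rightarrow> 'k::field fps mat \<Rightarrow> ((nat \<times> nat) \<times> nat, 'k) mpoly \<Rightarrow> 'k GG_poly" where
  "orbit_comap m A = mp_eval mp_const (\<lambda>(ij, s). fps_nth (orbit_arc m A $$ ij) s)"

definition arc_orbit :: "nat \<Rightarrow> 'k::field fps mat \<Rightarrow> 'k mat_jet set" where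
  "arc_orbit m A =
     (\<lambda>Q. {p \<in> carrier (jet_ring (mat_coords m) \<infinity>). orbit_comap m A p \<in> Q}) ` GG_arcs m"

text \<open>Extended partitions are indexed by \<open>1, \<dots>, m\<close>; values outside this range are irrelevant.\<close>

definition extended_partition :: "nat \<Rightarrow> (nat \<Rightarrow> enat) \<Rightarrow> bool" where
  "extended_partition m lam \<longleftrightarrow> (\<forall>i j. 1 \<le> i \<and> i \<le> j \<and> j \<le> m \<longrightarrow> lam j \<le> lam i)"

definition t_power :: "enat \<Rightarrow> 'k::field fps" where
  "t_power a = (case a of enat n \<Rightarrow> fps_X ^ n | \<infinity> \<Rightarrow> 0)"

definition C_orbit :: "nat \<Rightarrow> (nat \<Rightarrow> enat) \<Rightarrow> 'k::field mat_jet set" where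
  "C_orbit m lam =
     arc_orbit m (mat m m (\<lambda>(i, j). if i = j then t_power (lam (Suc i)) else 0))"

definition x_mat :: "nat \<Rightarrow> nat \<Rightarrow> 'k::field mat" where
  "x_mat m q = mat m m (\<lambda>(i, j). if i = j \<and> m - q \<le> i then 1 else 0)"

text \<open>The \<open>K\<close>-point of \<open>Spec K[x\<^sub>i\<^sub>j\<^sub>,\<^sub>0]\<close> given by the matrix \<open>A\<close>.\<close>

definition mat_point :: "nat \<Rightarrow> 'k::field mat \<Rightarrow> 'k mat_jet" where
  "mat_point m A =
     {p \<in> carrier (jet_ring (mat_coords m) 0). mp_eval id (\<lambda>(ij, s). A $$ ij) p = 0}"

definition Cont_x :: "nat \<Rightarrow> nat \<Rightarrow> nat \<Rightarrow> 'k::field mat_jet set" where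
  "Cont_x m k q = {\<gamma> \<in> D_arcs m k. trunc (mat_coords m) 0 \<gamma> = mat_point m (x_mat m q)}"

end

theory Submission
  imports Defs
begin

text \<open>Row and column operations over the local ring of a point bring an arc into the form
  \<open>\<Sum>\<^sub>p t\<^bsup>\<lambda> p\<^esup> u\<^sub>p x\<^sub>p y\<^sub>p\<^sup>T\<close> up to permutations of rows and columns: the \<open>p\<close>-th pivot is a term of rank one
  with \<open>2p + 1\<close> free power series (with positions numbered from 0). Hence \<open>C\<^sub>\<lambda>\<close> is the set of arcs in
  \<open>D\<^sup>k\<close> for which the least order of the \<open>j\<close>-minors is the sum of the \<open>j\<close> last \<open>\<lambda>\<^sub>i\<close>, for each \<open>j \<le> k\<close>.
  This makes \<open>C\<^sub>\<lambda>\<close> a cylinder. The Jacobian ideal has constant order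
  \<open>(m - k)\<^sup>2 (\<lambda>\<^bsub>m-k+1\<^esub> + \<dots> + \<lambda>\<^sub>m)\<close> on it, because the derivatives of the \<open>(k+1)\<close>-minors lie in the ideal of
  the \<open>k\<close>-minors along an arc in \<open>D\<^sup>k\<close>, and \<open>(m - k)\<^sup>2\<close>-th powers of \<open>k\<close>-minors are Jacobian minors.

  Modulo \<open>t\<^bsup>l+1\<^esup>\<close> only \<open>l + 1 - \<lambda>\<close> coefficients of each power series of a pivot \<open>t\<^sup>\<lambda>\<close> matter, and finitely many
  such parametrizations cover the truncated orbit. Counting algebraic relations bounds its dimension from
  above by the number of parameters; freeing the parameters one at a time gives a chain of primes of this
  length. The codimension is what remains of
  \<open>k (2m - k) (l + 1) = \<Sum>\<^bsub>m-k \<le> p < m\<^esub> (2p + 1) (l + 1)\<close>. Fixing the constant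
  term \<open>x\<^sub>q\<close> removes one coefficient from each of the power series of the last \<open>q\<close> pivots, which are
  \<open>\<Sum>\<^bsub>m-q \<le> p < m\<^esub> (2p + 1) = q (2m - q)\<close> in number.\<close>

section \<open>Evaluation of polynomials\<close>

text \<open>Points are prime ideals over a field that need not be algebraically closed, so there is
  no common field over which all arcs live. Division by a pivot takes place in the local ring of the
  point, realized inside one fixed field of rational functions; equations over the residue field
  become congruences modulo the maximal ideal \<open>J\<close>. The orders of the minors are a
  complete invariant: the finite entries \<lambda> are differences of consecutive sums, and the
  infinite ones are forced by the vanishing of the (k+1)-minors. Apart from this vanishing, only
  finitely many coefficients are involved. The dimension bounds use chains of primes directly. Above
  the kernel of a polynomial map into N variables there is no chain of more than N strict
  inclusions, because N+1 polynomials in N variables are algebraically dependent. All permutations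
  enter the upper bound, only the identity the lower one. That the Jacobian order is constant leaves
  one nonempty term in the minimum that defines the codimension; the empty ones have codimension
  \<infinity>.\<close>

definition monom_eval :: "('v \<Rightarrow> 'b::comm_ring_1) \<Rightarrow> ('v \<Rightarrow>\<^sub>0 nat) \<Rightarrow> 'b" where
  "monom_eval x \<mu> = (\<Prod>v\<in>Poly_Mapping.keys \<mu>. x v ^ Poly_Mapping.lookup \<mu> v)"

lemma monom_eval_superset:
  "finite S \<Longrightarrow> Poly_Mapping.keys \<mu> \<subseteq> S \<Longrightarrow>
    monom_eval x \<mu> = (\<Prod>v\<in>S. x v ^ Poly_Mapping.lookup \<mu> v)"
  unfolding monom_eval_def by (rule prod.mono_neutral_left) (auto simp: in_keys_iff)

lemma monom_eval_0 [simp]: "monom_eval x 0 = 1"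
  by (simp add: monom_eval_def)

lemma monom_eval_add: "monom_eval x (\<mu> + \<nu>) = monom_eval x \<mu> * monom_eval x \<nu>"
proof -
  let ?S = "Poly_Mapping.keys \<mu> \<union> Poly_Mapping.keys \<nu>"
  have *: "monom_eval x \<rho> = (\<Prod>v\<in>?S. x v ^ Poly_Mapping.lookup \<rho> v)"
    if "Poly_Mapping.keys \<rho> \<subseteq> ?S" for \<rho>
    using that by (intro monom_eval_superset) auto
  show ?thesis
    using Poly_Mapping.keys_add[of \<mu> \<nu>]
    by (simp add: * lookup_add power_add prod.distrib)
qed

lemma monom_eval_single [simp]: "monom_eval x (Poly_Mapping.single v n) = x v ^ n"
  by (subst monom_eval_superset[of "{v}"]) auto

lemma mp_eval_monom:
  "mp_eval h x p = (\<Sum>\<mu>\<in>Poly_Mapping.keys p. h (Poly_Mapping.lookup p \<mu>) * monom_eval x \<mu>)"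
  by (simp add: mp_eval_def monom_eval_def)

lemma mp_sum_single:
  "p = (\<Sum>\<mu>\<in>Poly_Mapping.keys p. Poly_Mapping.single \<mu> (Poly_Mapping.lookup p \<mu>))"
  by (rule poly_mapping_eqI) (auto simp: lookup_sum lookup_single when_def in_keys_iff)

context
  fixes h :: "'k::comm_ring_1 \<Rightarrow> 'b::comm_ring_1"
  assumes h: "comm_ring_hom h"
begin

interpretation h: comm_ring_hom h by (fact h)

lemma mp_eval_superset:
  "finite S \<Longrightarrow> Poly_Mapping.keys p \<subseteq> S \<Longrightarrow>
    mp_eval h x p = (\<Sum>\<mu>\<in>S. h (Poly_Mapping.lookup p \<mu>) * monom_eval x \<mu>)"
  unfolding mp_eval_monom by (rule sum.mono_neutral_left) (auto simp: in_keys_iff)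

lemma mp_eval_add: "mp_eval h x (p + q) = mp_eval h x p + mp_eval h x q"
proof -
  let ?S = "Poly_Mapping.keys p \<union> Poly_Mapping.keys q"
  have *: "mp_eval h x r = (\<Sum>\<mu>\<in>?S. h (Poly_Mapping.lookup r \<mu>) * monom_eval x \<mu>)"
    if "Poly_Mapping.keys r \<subseteq> ?S" for r
    using that by (intro mp_eval_superset) auto
  show ?thesis
    using Poly_Mapping.keys_add[of p q]
    by (simp add: * lookup_add sum.distrib h.hom_add distrib_right)
qed

lemma mp_eval_0 [simp]: "mp_eval h x 0 = 0"
  by (simp add: mp_eval_def)

lemma mp_eval_sum: "mp_eval h x (\<Sum>a\<in>A. f a) = (\<Sum>a\<in>A. mp_eval h x (f a))"
  by (induction A rule: infinite_finite_induct) (auto simp: mp_eval_add)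

lemma mp_eval_single: "mp_eval h x (Poly_Mapping.single \<mu> c) = h c * monom_eval x \<mu>"
  by (subst mp_eval_superset[of "{\<mu>}"]) auto

lemma mp_eval_mult: "mp_eval h x (p * q) = mp_eval h x p * mp_eval h x q"
proof -
  let ?s = "\<lambda>p \<mu>. Poly_Mapping.single \<mu> (Poly_Mapping.lookup p \<mu>)"
  have "p * q = (\<Sum>\<mu>\<in>Poly_Mapping.keys p. ?s p \<mu>) * (\<Sum>\<nu>\<in>Poly_Mapping.keys q. ?s q \<nu>)"
    by (simp flip: mp_sum_single)
  then show ?thesis
    by (simp add: sum_product mult_single mp_eval_sum mp_eval_single monom_eval_add h.hom_mult
        mp_eval_monom[of h x p] mp_eval_monom[of h x q] ac_simps)
qed

lemma mp_eval_hom: "comm_ring_hom (mp_eval h x)"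
proof
  show "mp_eval h x 1 = 1"
    using mp_eval_single[of x 0 1] by simp
qed (auto simp: mp_eval_add mp_eval_mult)

lemma mp_eval_const [simp]: "mp_eval h x (mp_const c) = h c"
  by (simp add: mp_const_def mp_eval_single)

lemma mp_eval_var [simp]: "mp_eval h x (mp_var v) = x v"
  by (simp add: mp_var_def mp_eval_single)

end

lemma hom_mp_eval:
  assumes "comm_ring_hom f"
  shows "f (mp_eval h x p) = mp_eval (f \<circ> h) (f \<circ> x) p"
proof -
  interpret f: comm_ring_hom f by fact
  show ?thesis by (simp add: mp_eval_def f.hom_sum f.hom_mult f.hom_prod f.hom_power)
qed

lemma comm_ring_hom_comp: "comm_ring_hom f \<Longrightarrow> comm_ring_hom g \<Longrightarrow> comm_ring_hom (f \<circ> g)"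
  by (simp add: comm_ring_hom_def ring_hom_def semiring_hom_def comm_monoid_add_hom_def
      monoid_add_hom_def zero_hom_def semigroup_add_hom_def plus_hom_def monoid_mult_hom_def
      one_hom_def semigroup_mult_hom_def times_hom_def)

lemma comm_ring_hom_id: "comm_ring_hom (\<lambda>x. x)"
  by standard auto

lemma mp_const_hom: "comm_ring_hom (mp_const :: 'k::comm_ring_1 \<Rightarrow> ('v, 'k) mpoly)"
  by standard (auto simp: mp_const_def single_add mult_single)

lemma mp_eval_const_var [simp]:
  fixes p :: "('v, 'k::comm_ring_1) mpoly"
  shows "mp_eval mp_const mp_var p = p"
proof -
  have "mp_const c * monom_eval mp_var \<mu> = Poly_Mapping.single \<mu> c" for c :: 'k and \<mu> :: "'v \<Rightarrow>\<^sub>0 nat"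
  proof -
    have mon: "monom_eval mp_var \<mu> = (Poly_Mapping.single \<mu> 1 :: ('v, 'k) mpoly)"
    proof -
      have pow: "mp_var v ^ n = (Poly_Mapping.single (Poly_Mapping.single v n) 1 :: ('v, 'k) mpoly)" for v n
        by (induction n) (auto simp: mp_var_def mult_single simp flip: single_add)
      have prod: "(\<Prod>v\<in>S. Poly_Mapping.single (g v) 1) = (Poly_Mapping.single (\<Sum>v\<in>S. g v) 1 :: ('v, 'k) mpoly)"
        for S :: "'v set" and g
        by (induction S rule: infinite_finite_induct) (auto simp: mult_single)
      show ?thesis
        by (simp add: monom_eval_def pow prod flip: mp_sum_single)
    qed
    show ?thesis unfolding mon by (simp add: mp_const_def mult_single)
  qed
  then show ?thesis
    by (simp add: mp_eval_monom flip: mp_sum_single)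
qed

section \<open>Power series under ring homomorphisms, and arcs\<close>

definition fps_map :: "('a \<Rightarrow> 'b) \<Rightarrow> 'a fps \<Rightarrow> 'b fps" where
  "fps_map f F = Abs_fps (\<lambda>s. f (fps_nth F s))"

lemma fps_map_nth [simp]: "fps_nth (fps_map f F) s = f (fps_nth F s)"
  by (simp add: fps_map_def)

lemma fps_map_hom:
  assumes "comm_ring_hom f"
  shows "comm_ring_hom (fps_map f)"
proof -
  interpret f: comm_ring_hom f by fact
  show ?thesis
    by standard (auto simp: fps_eq_iff fps_mult_nth f.hom_add f.hom_mult f.hom_sum fps_one_nth)
qed

lemma fps_const_hom: "comm_ring_hom (fps_const :: 'a::comm_ring_1 \<Rightarrow> 'a fps)"
  by standard (auto simp: fps_eq_iff)

definition arc_of :: "('v \<times> nat \<Rightarrow> 'b) \<Rightarrow> 'v \<Rightarrow> 'b fps" where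
  "arc_of z v = Abs_fps (\<lambda>s. z (v, s))"

lemma arc_of_nth [simp]: "fps_nth (arc_of z v) s = z (v, s)"
  by (simp add: arc_of_def)

text \<open>Applying the ring map \<open>mp_eval h z\<close> to every coefficient commutes with
  substitution and sends the generic arc to the arc \<open>z\<close>. This turns the equations of
  jet schemes into statements about power series.\<close>

lemma mp_eval_jet_coeff:
  assumes h: "comm_ring_hom h"
  shows "mp_eval h z (jet_coeff s f) = fps_nth (mp_eval (fps_const \<circ> h) (arc_of z) f) s"
proof -
  let ?e = "mp_eval h z"
  have e: "comm_ring_hom ?e" using h by (rule mp_eval_hom)
  have "?e (jet_coeff s f) = fps_nth (fps_map ?e (mp_eval (\<lambda>c. fps_const (mp_const c)) generic_arc f)) s"
    by (simp add: jet_coeff_def)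
  also have "fps_map ?e (mp_eval (\<lambda>c. fps_const (mp_const c)) generic_arc f) =
      mp_eval (fps_map ?e \<circ> (\<lambda>c. fps_const (mp_const c))) (fps_map ?e \<circ> generic_arc) f"
    by (rule hom_mp_eval[OF fps_map_hom[OF e]])
  also have "fps_map ?e \<circ> (\<lambda>c. fps_const (mp_const c)) = fps_const \<circ> h"
    by (rule ext) (simp add: fps_eq_iff mp_eval_const[OF h] mp_eval_0[OF h])
  also have "fps_map ?e \<circ> generic_arc = arc_of z"
    by (rule ext) (simp add: fps_eq_iff generic_arc_def mp_eval_var[OF h])
  finally show ?thesis .
qed

lemma signof_cases: "signof p = (1 :: 'a::ring_1) \<or> signof p = (-1 :: 'a)"
  by (cases "evenperm p") (auto simp: sign_def)

section \<open>Congruences modulo an ideal of a subring\<close>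

text \<open>Quotients and localizations of coordinate rings are not types. Statements about \<open>S / J\<close>, for a
  subring \<open>S\<close> of a ring type and an ideal \<open>J\<close> of \<open>S\<close>, are therefore expressed as congruences.\<close>

locale subring_ideal =
  fixes S J :: "'a::comm_ring_1 set"
  assumes one_S: "1 \<in> S"
    and add_S: "a \<in> S \<Longrightarrow> b \<in> S \<Longrightarrow> a + b \<in> S"
    and uminus_S: "a \<in> S \<Longrightarrow> - a \<in> S"
    and mult_S: "a \<in> S \<Longrightarrow> b \<in> S \<Longrightarrow> a * b \<in> S"
    and J_S: "a \<in> J \<Longrightarrow> a \<in> S"
    and zero_J: "0 \<in> J"
    and add_J: "a \<in> J \<Longrightarrow> b \<in> J \<Longrightarrow> a + b \<in> J"
    and mult_J: "a \<in> S \<Longrightarrow> b \<in> J \<Longrightarrow> a * b \<in> J"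
begin

lemma zero_S: "0 \<in> S"
  using J_S zero_J by blast

lemma diff_S: "a \<in> S \<Longrightarrow> b \<in> S \<Longrightarrow> a - b \<in> S"
  using add_S[of a "- b"] uminus_S by simp

lemma uminus_J: "a \<in> J \<Longrightarrow> - a \<in> J"
  using mult_J[of "- 1" a] uminus_S[OF one_S] by simp

lemma diff_J: "a \<in> J \<Longrightarrow> b \<in> J \<Longrightarrow> a - b \<in> J"
  using add_J[of a "- b"] uminus_J by simp

lemma mult_J_right: "b \<in> J \<Longrightarrow> a \<in> S \<Longrightarrow> b * a \<in> J"
  using mult_J[of a b] by (simp add: mult.commute)

lemma sum_S: "(\<And>a. a \<in> A \<Longrightarrow> f a \<in> S) \<Longrightarrow> sum f A \<in> S"
  by (induction A rule: infinite_finite_induct) (auto intro: add_S zero_S)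

lemma sum_J: "(\<And>a. a \<in> A \<Longrightarrow> f a \<in> J) \<Longrightarrow> sum f A \<in> J"
  by (induction A rule: infinite_finite_induct) (auto intro: add_J zero_J)

lemma prod_S: "(\<And>a. a \<in> A \<Longrightarrow> f a \<in> S) \<Longrightarrow> prod f A \<in> S"
  by (induction A rule: infinite_finite_induct) (auto intro: mult_S one_S)

lemma power_S: "a \<in> S \<Longrightarrow> a ^ n \<in> S"
  by (induction n) (auto intro: mult_S one_S)

lemma cong_trans: "a - b \<in> J \<Longrightarrow> b - c \<in> J \<Longrightarrow> a - c \<in> J"
  using add_J[of "a - b" "b - c"] by simp

lemma cong_iff: "a - b \<in> J \<Longrightarrow> a \<in> J \<longleftrightarrow> b \<in> J"
  using add_J[of "a - b" b] diff_J[of a "a - b"] by auto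

lemma cong_mult:
  assumes "a - b \<in> J" "c - d \<in> J" "b \<in> S" "c \<in> S"
  shows "a * c - b * d \<in> J"
proof -
  have "a * c - b * d = (a - b) * c + b * (c - d)" by (simp add: algebra_simps)
  then show ?thesis using assms by (simp add: add_J mult_J mult_J_right)
qed

lemma cong_sum: "(\<And>a. a \<in> A \<Longrightarrow> f a - g a \<in> J) \<Longrightarrow> sum f A - sum g A \<in> J"
  by (simp add: sum_J flip: sum_subtractf)

lemma cong_prod:
  "(\<And>a. a \<in> A \<Longrightarrow> f a \<in> S) \<Longrightarrow> (\<And>a. a \<in> A \<Longrightarrow> g a \<in> S) \<Longrightarrow> (\<And>a. a \<in> A \<Longrightarrow> f a - g a \<in> J) \<Longrightarrow>
    prod f A - prod g A \<in> J"
  by (induction A rule: infinite_finite_induct) (auto simp: zero_J intro!: cong_mult prod_S)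

lemma cong_power: "a \<in> S \<Longrightarrow> b \<in> S \<Longrightarrow> a - b \<in> J \<Longrightarrow> a ^ n - b ^ n \<in> J"
  using cong_prod[of "{..<n}" "\<lambda>_. a" "\<lambda>_. b"] by simp

lemma signof_S: "signof p \<in> S"
  using signof_cases[of p, where 'a = 'a] one_S uminus_S by auto

lemma det_S:
  assumes "A \<in> carrier_mat n n" "\<And>i j. i < n \<Longrightarrow> j < n \<Longrightarrow> A $$ (i, j) \<in> S"
  shows "Determinant.det A \<in> S"
  unfolding det_def'[OF assms(1)]
proof (intro sum_S mult_S signof_S prod_S assms(2))
  fix p i assume "p \<in> {p. p permutes {0..<n}}" "i \<in> {0..<n}"
  then show "p i < n" using permutes_in_image[of p "{0..<n}" i] by auto
qed auto

lemma cong_det: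
  assumes "A \<in> carrier_mat n n" "\<And>i j. i < n \<Longrightarrow> j < n \<Longrightarrow> A $$ (i, j) \<in> S"
    and "B \<in> carrier_mat n n" "\<And>i j. i < n \<Longrightarrow> j < n \<Longrightarrow> B $$ (i, j) \<in> S"
    and AB: "\<And>i j. i < n \<Longrightarrow> j < n \<Longrightarrow> A $$ (i, j) - B $$ (i, j) \<in> J"
  shows "Determinant.det A - Determinant.det B \<in> J"
  unfolding det_def'[OF assms(1)] det_def'[OF assms(3)]
proof (rule cong_sum)
  fix p assume "p \<in> {p. p permutes {0..<n}}"
  then have "p i < n" if "i < n" for i using that permutes_in_image[of p "{0..<n}" i] by auto
  then show "signof p * (\<Prod>i = 0..<n. A $$ (i, p i)) - signof p * (\<Prod>i = 0..<n. B $$ (i, p i)) \<in> J"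
    by (intro cong_mult signof_S prod_S cong_prod assms(2,4) AB) (auto simp: zero_J)
qed

lemma mp_eval_S:
  assumes "\<And>c. h c \<in> S" "\<And>v. v \<in> mp_vars p \<Longrightarrow> x v \<in> S"
  shows "mp_eval h x p \<in> S"
  unfolding mp_eval_def using assms by (intro sum_S mult_S prod_S power_S) (auto simp: mp_vars_def)

lemma cong_mp_eval:
  assumes "\<And>c. h c \<in> S" "\<And>v. v \<in> mp_vars p \<Longrightarrow> x v \<in> S" "\<And>v. v \<in> mp_vars p \<Longrightarrow> y v \<in> S"
    and "\<And>v. v \<in> mp_vars p \<Longrightarrow> x v - y v \<in> J"
  shows "mp_eval h x p - mp_eval h y p \<in> J"
  unfolding mp_eval_def
  by (intro cong_sum cong_mult cong_prod prod_S cong_power power_S)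
    (use assms(1) in \<open>auto simp: zero_J mp_vars_def intro!: assms(2-4)\<close>)

end

locale subring_prime = subring_ideal +
  assumes one_notin_J: "1 \<notin> J"
    and prime_J: "a \<in> S \<Longrightarrow> b \<in> S \<Longrightarrow> a * b \<in> J \<Longrightarrow> a \<in> J \<or> b \<in> J"
begin

lemma power_notin_J: "a \<in> S \<Longrightarrow> a \<notin> J \<Longrightarrow> a ^ n \<notin> J"
proof (induction n)
  case (Suc n)
  then show ?case using prime_J[of a "a ^ n"] power_S by auto
qed (simp add: one_notin_J)

lemma prod_notin_J: "(\<And>a. a \<in> A \<Longrightarrow> f a \<in> S) \<Longrightarrow> (\<And>a. a \<in> A \<Longrightarrow> f a \<notin> J) \<Longrightarrow> prod f A \<notin> J"
proof (induction A rule: infinite_finite_induct)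
  case (insert a A)
  then have "f a \<in> S" "prod f A \<in> S" "f a \<notin> J" "prod f A \<notin> J" by (auto intro: prod_S)
  then show ?case using prime_J insert.hyps by auto
qed (auto simp: one_notin_J)

end

section \<open>Congruences of power series up to a given order\<close>

definition fps_over :: "'a set \<Rightarrow> 'a fps set" where
  "fps_over S = {F. \<forall>s. fps_nth F s \<in> S}"

text \<open>Series of order at least \<open>e\<close> over the residue ring;
  \<open>e = \<infinity>\<close> means vanishing there. Nothing is said about the later
  coefficients, so in general only the intersection with \<open>fps_over S\<close> is an ideal of
  \<open>fps_over S\<close>.\<close>

definition fps_below :: "'a set \<Rightarrow> enat \<Rightarrow> 'a fps set" where
  "fps_below J e = {F. \<forall>s. enat s < e \<longrightarrow> fps_nth F s \<in> J}"

lemma (in subring_ideal) fps_subring_ideal: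
  "subring_ideal (fps_over S) (fps_over S \<inter> fps_below J e)"
proof
  fix a b :: "'a fps"
  show "1 \<in> fps_over S" by (auto simp: fps_over_def fps_one_nth one_S zero_S)
  show "0 \<in> fps_over S \<inter> fps_below J e" by (auto simp: fps_over_def fps_below_def zero_J zero_S)
  show *: "a * b \<in> fps_over S" if "a \<in> fps_over S" "b \<in> fps_over S"
    using that by (auto simp: fps_over_def fps_mult_nth intro!: sum_S mult_S)
  show "a * b \<in> fps_over S \<inter> fps_below J e" if ab: "a \<in> fps_over S" "b \<in> fps_over S \<inter> fps_below J e"
  proof -
    have "fps_nth (a * b) s \<in> J" if "enat s < e" for s
      unfolding fps_mult_nth
    proof (intro sum_J mult_J)
      fix i assume "i \<in> {0..s}"
      then have "enat (s - i) < e" using that by (meson diff_le_self enat_ord_simps(1) order.strict_trans1)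
      then show "fps_nth b (s - i) \<in> J" using ab by (auto simp: fps_below_def)
    qed (use ab in \<open>auto simp: fps_over_def\<close>)
    with * ab show ?thesis by (auto simp: fps_below_def)
  qed
qed (auto simp: fps_over_def fps_below_def add_S uminus_S add_J)

section \<open>Minors\<close>

text \<open>Rows and columns are given by arbitrary maps rather than by subsets: a repetition gives
  0, a reordering a sign, and expansions of products run over all maps.
  \<open>minor m M id id\<close> is the determinant of the whole matrix, and a minor of size 0 is
  1.\<close>

definition minor :: "nat \<Rightarrow> (nat \<Rightarrow> nat \<Rightarrow> 'a::comm_ring_1) \<Rightarrow> (nat \<Rightarrow> nat) \<Rightarrow> (nat \<Rightarrow> nat) \<Rightarrow> 'a" where
  "minor j M \<alpha> \<beta> = Determinant.det (mat j j (\<lambda>(a, b). M (\<alpha> a) (\<beta> b)))"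

lemma minor_leibniz:
  "minor j M \<alpha> \<beta> = (\<Sum>\<pi> | \<pi> permutes {0..<j}. signof \<pi> * (\<Prod>a = 0..<j. M (\<alpha> a) (\<beta> (\<pi> a))))"
proof -
  have "mat j j (\<lambda>(a, b). M (\<alpha> a) (\<beta> b)) $$ (a, \<pi> a) = M (\<alpha> a) (\<beta> (\<pi> a))"
    if "\<pi> permutes {0..<j}" "a \<in> {0..<j}" for \<pi> a
    using that permutes_in_image[of \<pi> "{0..<j}" a] by auto
  then show ?thesis
    unfolding minor_def by (subst det_def'[of _ j]) (auto intro!: sum.cong prod.cong)
qed

lemma minor_cong:
  assumes "\<And>a. a < j \<Longrightarrow> \<alpha> a = \<alpha>' a" "\<And>b. b < j \<Longrightarrow> \<beta> b = \<beta>' b"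
    and "\<And>a b. a < j \<Longrightarrow> b < j \<Longrightarrow> M (\<alpha> a) (\<beta> b) = M' (\<alpha> a) (\<beta> b)"
  shows "minor j M \<alpha> \<beta> = minor j M' \<alpha>' \<beta>'"
  unfolding minor_def using assms by (intro arg_cong[where f = Determinant.det] cong_mat) auto

lemma hom_minor:
  assumes "comm_ring_hom f"
  shows "f (minor j M \<alpha> \<beta>) = minor j (\<lambda>a b. f (M a b)) \<alpha> \<beta>"
proof -
  interpret f: comm_ring_hom f by fact
  show ?thesis by (simp add: minor_leibniz f.hom_sum f.hom_mult f.hom_prod)
qed

lemma minor_transpose: "minor j (\<lambda>a b. M b a) \<alpha> \<beta> = minor j M \<beta> \<alpha>"
proof -
  have "mat j j (\<lambda>(a, b). M (\<beta> b) (\<alpha> a)) = transpose_mat (mat j j (\<lambda>(a, b). M (\<beta> a) (\<alpha> b)))"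
    by (intro eq_matI) auto
  then show ?thesis by (simp add: minor_def det_transpose[of _ j])
qed

lemma minor_eq_0_row: "a \<noteq> b \<Longrightarrow> a < j \<Longrightarrow> b < j \<Longrightarrow> \<alpha> a = \<alpha> b \<Longrightarrow> minor j M \<alpha> \<beta> = 0"
  unfolding minor_def by (rule det_identical_rows[of _ j a b]) (auto intro!: eq_vecI)

lemma minor_eq_0_col: "a \<noteq> b \<Longrightarrow> a < j \<Longrightarrow> b < j \<Longrightarrow> \<beta> a = \<beta> b \<Longrightarrow> minor j M \<alpha> \<beta> = 0"
  using minor_eq_0_row[of a b j \<beta> "\<lambda>a b. M b a" \<alpha>] unfolding minor_transpose[of j M] .

text \<open>Multilinearity in the rows. This is Cauchy-Binet before the terms are collected by
  subsets: the terms whose \<rho> have a common image would assemble a minor of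
  \<open>G\<close>.\<close>

lemma minor_mult:
  "minor j (\<lambda>i l. \<Sum>p = 0..<m. G i p * M p l) \<alpha> \<beta> =
    (\<Sum>\<rho>\<in>{0..<j} \<rightarrow>\<^sub>E {0..<m}. (\<Prod>a = 0..<j. G (\<alpha> a) (\<rho> a)) * minor j M \<rho> \<beta>)"
proof -
  have "minor j (\<lambda>i l. \<Sum>p = 0..<m. G i p * M p l) \<alpha> \<beta> =
    (\<Sum>\<pi> | \<pi> permutes {0..<j}. signof \<pi> *
      (\<Sum>\<rho>\<in>{0..<j} \<rightarrow>\<^sub>E {0..<m}. \<Prod>a = 0..<j. G (\<alpha> a) (\<rho> a) * M (\<rho> a) (\<beta> (\<pi> a))))"
    by (simp add: minor_leibniz prod_sum_PiE)
  also have "\<dots> = (\<Sum>\<rho>\<in>{0..<j} \<rightarrow>\<^sub>E {0..<m}. \<Sum>\<pi> | \<pi> permutes {0..<j}.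
      signof \<pi> * (\<Prod>a = 0..<j. G (\<alpha> a) (\<rho> a) * M (\<rho> a) (\<beta> (\<pi> a))))"
    by (subst sum.swap) (simp add: sum_distrib_left)
  also have "\<dots> = (\<Sum>\<rho>\<in>{0..<j} \<rightarrow>\<^sub>E {0..<m}. (\<Prod>a = 0..<j. G (\<alpha> a) (\<rho> a)) * minor j M \<rho> \<beta>)"
    by (simp add: minor_leibniz prod.distrib sum_distrib_left ac_simps)
  finally show ?thesis .
qed

lemma minor_scale_rows:
  "minor j (\<lambda>p l. c p * M p l) \<rho> \<beta> = (\<Prod>a = 0..<j. c (\<rho> a)) * minor j M \<rho> \<beta>"
  by (simp add: minor_leibniz prod.distrib sum_distrib_left ac_simps)

context subring_ideal
begin

lemma minor_S:
  "(\<And>a b. a < j \<Longrightarrow> b < j \<Longrightarrow> M (\<alpha> a) (\<beta> b) \<in> S) \<Longrightarrow> minor j M \<alpha> \<beta> \<in> S"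
  unfolding minor_def by (rule det_S[of _ j]) auto

text \<open>By \<open>minor_mult\<close> a minor of the product is an \<open>S\<close>-linear
  combination of minors of \<open>M\<close> of the same size.\<close>

lemma minor_mult_left_J:
  assumes "\<And>\<alpha> \<beta>. \<alpha> \<in> {0..<j} \<rightarrow> {0..<m} \<Longrightarrow> \<beta> \<in> {0..<j} \<rightarrow> {0..<m} \<Longrightarrow> minor j M \<alpha> \<beta> \<in> J"
    and "\<And>i p. i < m \<Longrightarrow> p < m \<Longrightarrow> G i p \<in> S"
    and "\<alpha> \<in> {0..<j} \<rightarrow> {0..<m}" "\<beta> \<in> {0..<j} \<rightarrow> {0..<m}"
  shows "minor j (\<lambda>i l. \<Sum>p = 0..<m. G i p * M p l) \<alpha> \<beta> \<in> J"
  unfolding minor_mult using assms by (intro sum_J mult_J prod_S) (auto simp: PiE_iff Pi_iff)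

lemma minor_mult_right_J:
  assumes "\<And>\<alpha> \<beta>. \<alpha> \<in> {0..<j} \<rightarrow> {0..<m} \<Longrightarrow> \<beta> \<in> {0..<j} \<rightarrow> {0..<m} \<Longrightarrow> minor j M \<alpha> \<beta> \<in> J"
    and "\<And>i p. i < m \<Longrightarrow> p < m \<Longrightarrow> H i p \<in> S"
    and "\<alpha> \<in> {0..<j} \<rightarrow> {0..<m}" "\<beta> \<in> {0..<j} \<rightarrow> {0..<m}"
  shows "minor j (\<lambda>i l. \<Sum>p = 0..<m. M i p * H p l) \<alpha> \<beta> \<in> J"
proof -
  have "minor j (\<lambda>i l. \<Sum>p = 0..<m. M i p * H p l) \<alpha> \<beta> =
      minor j (\<lambda>l i. \<Sum>p = 0..<m. H p l * M i p) \<beta> \<alpha>"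
    by (subst minor_transpose[symmetric]) (simp add: mult.commute)
  also have "\<dots> \<in> J"
    using assms minor_mult_left_J[of j m "\<lambda>a b. M b a" "\<lambda>i p. H p i" \<beta> \<alpha>]
    unfolding minor_transpose[of j M] by simp
  finally show ?thesis .
qed

end

lemma adjugate:
  fixes G :: "nat \<Rightarrow> nat \<Rightarrow> 'a::comm_ring_1" and m :: nat
  defines "A \<equiv> mat m m (\<lambda>(i, j). G i j)"
  assumes "i < m" "l < m"
  shows "(\<Sum>p = 0..<m. adj_mat A $$ (i, p) * G p l) = (if i = l then minor m G id id else 0)"
    and "(\<Sum>p = 0..<m. G i p * adj_mat A $$ (p, l)) = (if i = l then minor m G id id else 0)"
proof -
  have A: "A \<in> carrier_mat m m" by (simp add: A_def)
  have d: "Determinant.det A = minor m G id id" by (simp add: A_def minor_def)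
  have "(adj_mat A * A) $$ (i, l) = (\<Sum>p = 0..<m. adj_mat A $$ (i, p) * G p l)"
    using assms(2,3) adj_mat(1)[OF A] A
    by (auto simp: scalar_prod_def A_def intro!: sum.cong)
  then show "(\<Sum>p = 0..<m. adj_mat A $$ (i, p) * G p l) = (if i = l then minor m G id id else 0)"
    using assms(2,3) by (simp add: adj_mat(3)[OF A] d split: if_splits)
  have "(A * adj_mat A) $$ (i, l) = (\<Sum>p = 0..<m. G i p * adj_mat A $$ (p, l))"
    using assms(2,3) adj_mat(1)[OF A] A
    by (auto simp: scalar_prod_def A_def intro!: sum.cong)
  then show "(\<Sum>p = 0..<m. G i p * adj_mat A $$ (p, l)) = (if i = l then minor m G id id else 0)"
    using assms(2,3) by (simp add: adj_mat(2)[OF A] d split: if_splits)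
qed

lemma (in subring_ideal) adj_mat_S:
  fixes G :: "nat \<Rightarrow> nat \<Rightarrow> 'a"
  assumes "\<And>i j. i < m \<Longrightarrow> j < m \<Longrightarrow> G i j \<in> S" "i < m" "l < m"
  shows "adj_mat (mat m m (\<lambda>(i, j). G i j)) $$ (i, l) \<in> S"
proof -
  have "Determinant.det (mat_delete (mat m m (\<lambda>(i, j). G i j)) l i) \<in> S"
    by (rule det_S[of _ "m - 1"]) (use assms in \<open>auto simp: mat_delete_def\<close>)
  then show ?thesis
    using assms(2,3) by (auto simp: adj_mat_def cofactor_def intro!: mult_S power_S uminus_S one_S)
qed

section \<open>Minors of matrices equivalent to a diagonal matrix of powers of t\<close>

definition tpow :: "enat \<Rightarrow> 'b::comm_ring_1 fps" where
  "tpow a = (case a of enat n \<Rightarrow> fps_X ^ n | \<infinity> \<Rightarrow> 0)"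

lemma tpow_nth: "fps_nth (tpow a) s = (if a = enat s then 1 else 0)"
  by (cases a) (auto simp: tpow_def)

lemma tpow_0 [simp]: "tpow 0 = 1"
  by (simp add: tpow_def zero_enat_def)

lemma tpow_add: "tpow (a + b) = tpow a * tpow b"
  by (cases a; cases b) (auto simp: tpow_def power_add)

lemma tpow_sum: "tpow (\<Sum>a\<in>A. f a) = (\<Prod>a\<in>A. tpow (f a))"
  by (induction A rule: infinite_finite_induct) (auto simp: tpow_add)

lemma tpow_dvd: "a \<le> b \<Longrightarrow> tpow a dvd (tpow b :: 'b::comm_ring_1 fps)"
  by (auto simp: le_iff_add tpow_add)

lemma tpow_mult_nth:
  "fps_nth (tpow a * F) s = (case a of enat n \<Rightarrow> if s < n then 0 else fps_nth F (s - n) | \<infinity> \<Rightarrow> 0)"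
  by (cases a) (auto simp: tpow_def fps_X_power_mult_nth)

lemma tpow_dvd_nth: "tpow a dvd F \<Longrightarrow> enat s < a \<Longrightarrow> fps_nth F s = 0"
  by (auto simp: tpow_mult_nth dvd_def split: enat.split)

text \<open>For nonincreasing \<open>\<mu>\<close> and \<open>j \<le> m\<close> this is the least
  sum of \<open>j\<close> entries, hence the least order of a \<open>j\<close>-minor of the diagonal
  matrix of the powers \<open>t^(\<mu> p)\<close>.\<close>

definition tail_sum :: "nat \<Rightarrow> (nat \<Rightarrow> enat) \<Rightarrow> nat \<Rightarrow> enat" where
  "tail_sum m \<mu> j = (\<Sum>p = m - j..<m. \<mu> p)"

definition antitone :: "nat \<Rightarrow> (nat \<Rightarrow> enat) \<Rightarrow> bool" where
  "antitone m \<mu> \<longleftrightarrow> (\<forall>i j. i \<le> j \<longrightarrow> j < m \<longrightarrow> \<mu> j \<le> \<mu> i)"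

lemma tail_sum_Suc: "j < m \<Longrightarrow> tail_sum m \<mu> (Suc j) = \<mu> (m - Suc j) + tail_sum m \<mu> j"
proof -
  assume "j < m"
  then have "{m - Suc j..<m} = insert (m - Suc j) {m - j..<m}" by auto
  moreover have "m - Suc j \<notin> {m - j..<m}" using \<open>j < m\<close> by auto
  ultimately show ?thesis by (simp add: tail_sum_def)
qed

text \<open>Induction on \<open>m\<close>, according to whether the last index lies in
  \<open>X\<close>. If not, \<open>X\<close> is compared with the window of indices ending one
  earlier, and moving that window to the right does not increase its sum.\<close>

lemma tail_sum_le:
  "antitone m \<mu> \<Longrightarrow> X \<subseteq> {0..<m} \<Longrightarrow> tail_sum m \<mu> (card X) \<le> sum \<mu> X"
proof (induction m arbitrary: X)
  case (Suc m)
  have fin: "finite X" using Suc.prems finite_subset by blast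
  have anti: "antitone m \<mu>" using Suc.prems by (auto simp: antitone_def)
  show ?case
  proof (cases "m \<in> X")
    case True
    have "tail_sum m \<mu> (card (X - {m})) \<le> sum \<mu> (X - {m})"
      using Suc.prems by (intro Suc.IH anti) auto
    moreover have "card X = Suc (card (X - {m}))"
      using True fin by (metis card.remove)
    moreover have "tail_sum (Suc m) \<mu> (Suc j) = tail_sum m \<mu> j + \<mu> m" for j
      by (simp add: tail_sum_def)
    ultimately show ?thesis
      by (simp add: sum.remove[OF fin True] add.commute[of "\<mu> m"] add_right_mono)
  next
    case False
    have X: "X \<subseteq> {0..<m}"
    proof
      fix x assume "x \<in> X"
      then show "x \<in> {0..<m}" using Suc.prems(2) False by (cases "x = m") auto
    qed
    then have c: "card X \<le> m" using card_mono[of "{0..<m}" X] by simp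
    have "tail_sum (Suc m) \<mu> j \<le> tail_sum m \<mu> j" if "j \<le> m" for j
      using that
    proof (induction j)
      case (Suc j)
      have "\<mu> (m - j) \<le> \<mu> (m - Suc j)"
        using \<open>antitone (Suc m) \<mu>\<close> unfolding antitone_def by (simp add: le_diff_conv)
      moreover have "tail_sum (Suc m) \<mu> (Suc j) = \<mu> (m - j) + tail_sum (Suc m) \<mu> j"
        using tail_sum_Suc[of j "Suc m" \<mu>] Suc.prems by simp
      moreover have "tail_sum m \<mu> (Suc j) = \<mu> (m - Suc j) + tail_sum m \<mu> j"
        using tail_sum_Suc[of j m \<mu>] Suc.prems by simp
      moreover have "tail_sum (Suc m) \<mu> j \<le> tail_sum m \<mu> j"
        using Suc by simp
      ultimately show ?case by (simp add: add_mono)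
    qed (simp add: tail_sum_def)
    then show ?thesis using Suc.IH[OF anti X] c order_trans by blast
  qed
qed (simp add: tail_sum_def)

text \<open>The matrix product \<open>G D H\<close> with \<open>D\<close> the diagonal matrix of
  powers of t: the orbit map, for coefficients in any ring.\<close>

definition gdh :: "nat \<Rightarrow> (nat \<Rightarrow> nat \<Rightarrow> 'b::comm_ring_1 fps) \<Rightarrow> (nat \<Rightarrow> enat) \<Rightarrow>
    (nat \<Rightarrow> nat \<Rightarrow> 'b fps) \<Rightarrow> nat \<Rightarrow> nat \<Rightarrow> 'b fps" where
  "gdh m G \<mu> H i l = (\<Sum>p = 0..<m. G i p * (tpow (\<mu> p) * H p l))"

text \<open>Expanding along \<open>G\<close> leaves minors of \<open>D H\<close>. If \<rho> selects
  distinct rows, their powers of t factor out with total exponent at least the tail sum; if a row is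
  repeated, the minor is 0.\<close>

lemma tpow_dvd_minor_gdh:
  assumes "antitone m \<mu>"
  shows "tpow (tail_sum m \<mu> j) dvd minor j (gdh m G \<mu> H) \<alpha> \<beta>"
  unfolding gdh_def minor_mult
proof (intro dvd_sum dvd_mult)
  fix \<rho> assume \<rho>: "\<rho> \<in> {0..<j} \<rightarrow>\<^sub>E {0..<m}"
  show "tpow (tail_sum m \<mu> j) dvd minor j (\<lambda>p l. tpow (\<mu> p) * H p l) \<rho> \<beta>"
  proof (cases "inj_on \<rho> {0..<j}")
    case True
    have "tail_sum m \<mu> (card (\<rho> ` {0..<j})) \<le> sum \<mu> (\<rho> ` {0..<j})"
      using \<rho> assms by (intro tail_sum_le) auto
    then have "tail_sum m \<mu> j \<le> (\<Sum>a = 0..<j. \<mu> (\<rho> a))"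
      using True by (simp add: card_image sum.reindex)
    then show ?thesis
      unfolding minor_scale_rows by (intro dvd_mult2) (simp add: tpow_dvd flip: tpow_sum)
  next
    case False
    then obtain a b where "a \<noteq> b" "a < j" "b < j" "\<rho> a = \<rho> b" by (auto simp: inj_on_def)
    then show ?thesis by (simp add: minor_eq_0_row)
  qed
qed

definition minors_ge :: "'b set \<Rightarrow> nat \<Rightarrow> (nat \<Rightarrow> nat \<Rightarrow> 'b::comm_ring_1 fps) \<Rightarrow> nat \<Rightarrow> enat \<Rightarrow> bool" where
  "minors_ge J m A j e \<longleftrightarrow>
    (\<forall>\<alpha>\<in>{0..<j} \<rightarrow> {0..<m}. \<forall>\<beta>\<in>{0..<j} \<rightarrow> {0..<m}. minor j A \<alpha> \<beta> \<in> fps_below J e)"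

lemma minors_geD:
  "minors_ge J m A j e \<Longrightarrow> \<alpha> \<in> {0..<j} \<rightarrow> {0..<m} \<Longrightarrow> \<beta> \<in> {0..<j} \<rightarrow> {0..<m} \<Longrightarrow> enat s < e \<Longrightarrow>
    fps_nth (minor j A \<alpha> \<beta>) s \<in> J"
  by (auto simp: minors_ge_def fps_below_def)

definition unit_det :: "'b set \<Rightarrow> nat \<Rightarrow> (nat \<Rightarrow> nat \<Rightarrow> 'b::comm_ring_1 fps) \<Rightarrow> bool" where
  "unit_det J m G \<longleftrightarrow> fps_nth (minor m G id id) 0 \<notin> J"

lemma fps_nth_0_hom: "comm_ring_hom (\<lambda>F :: 'b::comm_ring_1 fps. fps_nth F 0)"
  by standard (auto simp: fps_mult_nth)

text \<open>Invertible factors do not change the least order of the \<open>j\<close>-minors.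
  Divisibility bounds it from below; undoing \<open>G\<close> and \<open>H\<close> exhibits the
  minor of the last \<open>j\<close> rows and columns, whose order is exactly the tail sum.\<close>

lemma (in subring_prime) minors_ge_gdh_iff:
  assumes anti: "antitone m \<mu>" and j: "j \<le> m"
    and G: "\<And>i p. i < m \<Longrightarrow> p < m \<Longrightarrow> G i p \<in> fps_over S" "unit_det J m G"
    and H: "\<And>i p. i < m \<Longrightarrow> p < m \<Longrightarrow> H i p \<in> fps_over S" "unit_det J m H"
    and A: "\<And>i l. i < m \<Longrightarrow> l < m \<Longrightarrow> A i l \<in> fps_over S"
      "\<And>i l. i < m \<Longrightarrow> l < m \<Longrightarrow> A i l - gdh m G \<mu> H i l \<in> fps_below J \<infinity>"
  shows "minors_ge J m A j e \<longleftrightarrow> e \<le> tail_sum m \<mu> j"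
proof
  assume e: "e \<le> tail_sum m \<mu> j"
  interpret F: subring_ideal "fps_over S" "fps_over S \<inter> fps_below J \<infinity>" by (rule fps_subring_ideal)
  have D: "gdh m G \<mu> H i l \<in> fps_over S" if "i < m" "l < m" for i l
    unfolding gdh_def
    by (intro F.sum_S F.mult_S G(1) H(1) that) (auto simp: fps_over_def tpow_nth one_S zero_S)
  show "minors_ge J m A j e" unfolding minors_ge_def
  proof (intro ballI)
    fix \<alpha> \<beta> assume \<alpha>: "\<alpha> \<in> {0..<j} \<rightarrow> {0..<m}" and \<beta>: "\<beta> \<in> {0..<j} \<rightarrow> {0..<m}"
    have "minor j A \<alpha> \<beta> - minor j (gdh m G \<mu> H) \<alpha> \<beta> \<in> fps_over S \<inter> fps_below J \<infinity>"
      unfolding minor_def by (rule F.cong_det[of _ j]) (use \<alpha> \<beta> A D F.diff_S in \<open>auto simp: Pi_iff\<close>)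
    then have "fps_nth (minor j A \<alpha> \<beta>) s - fps_nth (minor j (gdh m G \<mu> H) \<alpha> \<beta>) s \<in> J" for s
      by (auto simp: fps_below_def)
    moreover have "fps_nth (minor j (gdh m G \<mu> H) \<alpha> \<beta>) s = 0" if "enat s < e" for s
      by (rule tpow_dvd_nth[OF tpow_dvd_minor_gdh[OF anti]]) (use that e in \<open>rule order.strict_trans2\<close>)
    ultimately have "fps_nth (minor j A \<alpha> \<beta>) s \<in> J" if "enat s < e" for s
      using \<open>\<And>s. fps_nth (minor j A \<alpha> \<beta>) s - fps_nth (minor j (gdh m G \<mu> H) \<alpha> \<beta>) s \<in> J\<close>[of s]
        \<open>\<And>s. enat s < e \<Longrightarrow> fps_nth (minor j (gdh m G \<mu> H) \<alpha> \<beta>) s = 0\<close>[OF that] by simp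
    then show "minor j A \<alpha> \<beta> \<in> fps_below J e" by (simp add: fps_below_def)
  qed
next
  assume ge: "minors_ge J m A j e"
  show "e \<le> tail_sum m \<mu> j"
  proof (rule ccontr)
    assume "\<not> e \<le> tail_sum m \<mu> j"
    then obtain N where N: "tail_sum m \<mu> j = enat N" "enat N < e"
      by (cases "tail_sum m \<mu> j") auto
    let ?J = "fps_over S \<inter> fps_below J e"
    interpret F: subring_ideal "fps_over S" ?J by (rule fps_subring_ideal)
    have tp: "tpow a \<in> fps_over S" for a by (auto simp: fps_over_def tpow_nth one_S zero_S)
    \<comment> \<open>Adjugates serve as inverses, since \<open>S\<close> need not be local here;
      they leave the factors \<open>dG\<close> and \<open>dH\<close> behind.\<close>
    define G' where "G' i p = adj_mat (mat m m (\<lambda>(i, j). G i j)) $$ (i, p)" for i p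
    define H' where "H' i p = adj_mat (mat m m (\<lambda>(i, j). H i j)) $$ (i, p)" for i p
    define dG where "dG = minor m G id id"
    define dH where "dH = minor m H id id"
    have G'S: "G' i p \<in> fps_over S" "H' i p \<in> fps_over S" if "i < m" "p < m" for i p
      unfolding G'_def H'_def using that G H by (auto intro!: F.adj_mat_S)
    have "minor j A \<alpha> \<beta> \<in> ?J" if "\<alpha> \<in> {0..<j} \<rightarrow> {0..<m}" "\<beta> \<in> {0..<j} \<rightarrow> {0..<m}" for \<alpha> \<beta>
      using that ge A by (auto simp: minors_ge_def Pi_iff intro!: F.minor_S)
    then have 1: "minor j (\<lambda>i l. \<Sum>p = 0..<m. G' i p * (\<Sum>q = 0..<m. A p q * H' q l)) \<alpha> \<beta> \<in> ?J"
      if "\<alpha> \<in> {0..<j} \<rightarrow> {0..<m}" "\<beta> \<in> {0..<j} \<rightarrow> {0..<m}" for \<alpha> \<beta>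
      by (intro F.minor_mult_left_J[OF F.minor_mult_right_J] G'S that)
    \<comment> \<open>The last \<open>j\<close> indices, which carry the smallest exponents.\<close>
    define \<alpha> where "\<alpha> a = m - j + a" for a
    have \<alpha>: "\<alpha> a < m" if "a < j" for a using that j by (auto simp: \<alpha>_def)
    let ?D = "\<lambda>i l. if i = l then dG * tpow (\<mu> i) * dH else 0"
    have DS: "dG \<in> fps_over S" "dH \<in> fps_over S"
      using G H by (auto simp: dG_def dH_def intro!: F.minor_S)
    interpret F': subring_ideal "fps_over S" "fps_over S \<inter> fps_below J \<infinity>" by (rule fps_subring_ideal)
    have le: "fps_over S \<inter> fps_below J \<infinity> \<subseteq> ?J" by (auto simp: fps_below_def)
    have DD: "gdh m G \<mu> H i l \<in> fps_over S" if "i < m" "l < m" for i l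
      using that unfolding gdh_def by (intro F.sum_S F.mult_S G(1) H(1) tp) auto
    have AS: "A i l - gdh m G \<mu> H i l \<in> fps_over S \<inter> fps_below J \<infinity>" if "i < m" "l < m" for i l
      using A[OF that] F.diff_S DD[OF that] by auto
    have eq: "(\<Sum>p = 0..<m. G' i p * (\<Sum>q = 0..<m. gdh m G \<mu> H p q * H' q l)) = ?D i l"
      if "i < m" "l < m" for i l
    proof -
      have "(\<Sum>p = 0..<m. G' i p * (\<Sum>q = 0..<m. gdh m G \<mu> H p q * H' q l)) =
          (\<Sum>p = 0..<m. \<Sum>q = 0..<m. \<Sum>r = 0..<m. (G' i p * G p r) * tpow (\<mu> r) * (H r q * H' q l))"
        by (simp add: gdh_def sum_distrib_left sum_distrib_right mult_ac)
      also have "\<dots> = (\<Sum>p = 0..<m. \<Sum>r = 0..<m. \<Sum>q = 0..<m. (G' i p * G p r) * tpow (\<mu> r) * (H r q * H' q l))"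
        by (intro sum.cong refl sum.swap)
      also have "\<dots> = (\<Sum>r = 0..<m. \<Sum>p = 0..<m. \<Sum>q = 0..<m. (G' i p * G p r) * tpow (\<mu> r) * (H r q * H' q l))"
        by (rule sum.swap)
      also have "\<dots> = (\<Sum>r = 0..<m. (\<Sum>p = 0..<m. G' i p * G p r) * tpow (\<mu> r) * (\<Sum>q = 0..<m. H r q * H' q l))"
        by (simp only: sum_distrib_right[of _ _ "tpow (\<mu> _)"] sum_product)
      also have "\<dots> = (\<Sum>r = 0..<m. (if i = r then dG else 0) * tpow (\<mu> r) * (if r = l then dH else 0))"
        unfolding G'_def H'_def dG_def dH_def
        by (intro sum.cong refl) (simp add: adjugate that)
      also have "\<dots> = (\<Sum>r = 0..<m. if r = i then ?D i l else 0)"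
        by (intro sum.cong) auto
      also have "\<dots> = ?D i l" using that by simp
      finally show ?thesis .
    qed
    have cong: "(\<Sum>p = 0..<m. G' i p * (\<Sum>q = 0..<m. A p q * H' q l)) - ?D i l \<in> ?J" if "i < m" "l < m" for i l
    proof -
      have "(\<Sum>q = 0..<m. A p q * H' q l) - (\<Sum>q = 0..<m. gdh m G \<mu> H p q * H' q l)
          \<in> fps_over S \<inter> fps_below J \<infinity>" if "p < m" for p
      proof (intro F'.cong_sum F'.cong_mult)
        fix q assume "q \<in> {0..<m}"
        then show "A p q - gdh m G \<mu> H p q \<in> fps_over S \<inter> fps_below J \<infinity>"
          "gdh m G \<mu> H p q \<in> fps_over S" "H' q l \<in> fps_over S"
          "H' q l - H' q l \<in> fps_over S \<inter> fps_below J \<infinity>"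
          using AS[of p q] DD[of p q] G'S \<open>p < m\<close> \<open>l < m\<close> F'.zero_J by auto
      qed
      then have "G' i p * (\<Sum>q = 0..<m. A p q * H' q l) -
          G' i p * (\<Sum>q = 0..<m. gdh m G \<mu> H p q * H' q l) \<in> fps_over S \<inter> fps_below J \<infinity>" if "p < m" for p
        using that F'.mult_J[OF G'S(1)[OF \<open>i < m\<close> that]] by (simp flip: right_diff_distrib)
      then have "(\<Sum>p = 0..<m. G' i p * (\<Sum>q = 0..<m. A p q * H' q l)) -
          (\<Sum>p = 0..<m. G' i p * (\<Sum>q = 0..<m. gdh m G \<mu> H p q * H' q l))
          \<in> fps_over S \<inter> fps_below J \<infinity>"
        by (intro F'.cong_sum) auto
      then show ?thesis unfolding eq[OF that] using le by blast
    qed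
    have "minor j (\<lambda>i l. \<Sum>p = 0..<m. G' i p * (\<Sum>q = 0..<m. A p q * H' q l)) \<alpha> \<alpha> - minor j ?D \<alpha> \<alpha> \<in> ?J"
      unfolding minor_def
    proof (rule F.cong_det[of _ j])
      fix i l assume "i < j" "l < j"
      then show "mat j j (\<lambda>(a, b). ?D (\<alpha> a) (\<alpha> b)) $$ (i, l) \<in> fps_over S"
        using DS tp by (auto intro!: F.mult_S F.zero_S)
    next
      fix i l assume il: "i < j" "l < j"
      show "mat j j (\<lambda>(a, b). \<Sum>p = 0..<m. G' (\<alpha> a) p * (\<Sum>q = 0..<m. A p q * H' q (\<alpha> b))) $$ (i, l) \<in> fps_over S"
        using il by (simp, intro F.sum_S F.mult_S G'S A(1)) (auto simp: \<alpha>)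
      show "mat j j (\<lambda>(a, b). \<Sum>p = 0..<m. G' (\<alpha> a) p * (\<Sum>q = 0..<m. A p q * H' q (\<alpha> b))) $$ (i, l) -
          mat j j (\<lambda>(a, b). ?D (\<alpha> a) (\<alpha> b)) $$ (i, l) \<in> ?J"
        using il cong[OF \<alpha>[OF il(1)] \<alpha>[OF il(2)]] by simp
    qed simp_all
    from F.cong_iff[OF this] 1[of \<alpha> \<alpha>] \<alpha> have "minor j ?D \<alpha> \<alpha> \<in> ?J" by (simp add: Pi_iff)
    moreover have "minor j ?D \<alpha> \<alpha> = (dG * dH) ^ j * tpow (enat N)"
    proof -
      let ?M = "mat j j (\<lambda>(a, b). ?D (\<alpha> a) (\<alpha> b))"
      have "minor j ?D \<alpha> \<alpha> = prod_list (diag_mat ?M)"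
        unfolding minor_def
        by (rule det_upper_triangular[of _ j]) (auto simp: \<alpha>_def)
      also have "\<dots> = (\<Prod>a = 0..<j. dG * tpow (\<mu> (\<alpha> a)) * dH)"
        by (simp add: diag_mat_def prod.list_conv_set_nth)
      also have "\<dots> = (dG * dH) ^ j * tpow (\<Sum>a = 0..<j. \<mu> (\<alpha> a))"
        by (simp add: prod.distrib tpow_sum power_mult_distrib)
      also have "(\<Sum>a = 0..<j. \<mu> (\<alpha> a)) = tail_sum m \<mu> j"
        unfolding tail_sum_def
        by (rule sum.reindex_bij_witness[of _ "\<lambda>p. p - (m - j)" \<alpha>]) (use j in \<open>auto simp: \<alpha>_def\<close>)
      finally show ?thesis using N by simp
    qed
    \<comment> \<open>The coefficient of \<open>t^N\<close> in this product is a power of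
      \<open>dG(0) dH(0)\<close>, which avoids the prime \<open>J\<close>.\<close>
    ultimately have "fps_nth ((dG * dH) ^ j * tpow (enat N)) N \<in> J"
      using N by (auto simp: fps_below_def)
    then have "fps_nth ((dG * dH) ^ j) 0 \<in> J"
      by (simp add: mult.commute[of _ "tpow (enat N)"] tpow_mult_nth)
    moreover have "fps_nth ((dG * dH) ^ j) 0 = (fps_nth dG 0 * fps_nth dH 0) ^ j"
      by (simp add: fps_power_zeroth)
    moreover have "fps_nth dG 0 * fps_nth dH 0 \<notin> J"
      using G(2) H(2) DS prime_J by (auto simp: unit_det_def dG_def dH_def fps_over_def)
    ultimately show False
      using power_notin_J[of "fps_nth dG 0 * fps_nth dH 0" j] DS by (auto simp: fps_over_def mult_S)
  qed
qed

section \<open>Pivoting over a local ring\<close>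

text \<open>The entries of \<open>L D U\<close> with \<open>L\<close>, \<open>U\<close> unipotent. Pivot \<open>p\<close> contributes the rank one matrix
  \<open>t\<^bsup>\<mu> p\<^esup> u\<^sub>p x\<^sub>p y\<^sub>p\<^sup>T\<close>, supported on rows and columns \<open>\<le> p\<close>, and \<open>z (p, r, s)\<close> is the coefficient of
  \<open>t\<^sup>s\<close> in \<open>x\<^sub>p\<^sub>,\<^sub>r\<close> for \<open>r < p\<close>, in \<open>u\<^sub>p\<close> for \<open>r = p\<close>, in \<open>y\<^bsub>p,r-p-1\<^esub>\<close> for \<open>p < r\<close>.\<close>

definition zser :: "(nat \<times> nat \<times> nat \<Rightarrow> 'b) \<Rightarrow> nat \<Rightarrow> nat \<Rightarrow> 'b fps" where
  "zser z p r = Abs_fps (\<lambda>s. z (p, r, s))"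

lemma zser_nth [simp]: "fps_nth (zser z p r) s = z (p, r, s)"
  by (simp add: zser_def)

definition xser :: "(nat \<times> nat \<times> nat \<Rightarrow> 'b::comm_ring_1) \<Rightarrow> nat \<Rightarrow> nat \<Rightarrow> 'b fps" where
  "xser z p a = (if a = p then 1 else zser z p a)"

definition yser :: "(nat \<times> nat \<times> nat \<Rightarrow> 'b::comm_ring_1) \<Rightarrow> nat \<Rightarrow> nat \<Rightarrow> 'b fps" where
  "yser z p b = (if b = p then 1 else zser z p (Suc (p + b)))"

definition ldu_term where
  "ldu_term \<mu> z p a b = tpow (\<mu> p) * zser z p p * xser z p a * yser z p b"

definition ldu :: "nat \<Rightarrow> (nat \<Rightarrow> enat) \<Rightarrow> (nat \<times> nat \<times> nat \<Rightarrow> 'b::comm_ring_1) \<Rightarrow> nat \<Rightarrow> nat \<Rightarrow> 'b fps" where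
  "ldu m \<mu> z a b = (\<Sum>p = max a b..<m. ldu_term \<mu> z p a b)"

lemma ldu_cong:
  assumes "\<And>p. p < m \<Longrightarrow> \<mu> p = \<mu>' p" "\<And>p r s. p < m \<Longrightarrow> z (p, r, s) = z' (p, r, s)"
  shows "ldu m \<mu> z a b = ldu m \<mu>' z' a b"
  unfolding ldu_def
proof (rule sum.cong)
  fix p assume "p \<in> {max a b..<m}"
  then have "zser z p r = zser z' p r" for r using assms(2) by (simp add: zser_def)
  then show "ldu_term \<mu> z p a b = ldu_term \<mu>' z' p a b"
    using assms(1) \<open>p \<in> _\<close> by (simp add: ldu_term_def xser_def yser_def)
qed simp

text \<open>\<open>S\<close> is a local subring of a field and \<open>J\<close> its maximal ideal,
  the setting in which a pivot can be divided out.\<close>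

locale local_pair = subring_prime S J for S J :: "'e::field set" +
  assumes inverse_S: "a \<in> S \<Longrightarrow> a \<notin> J \<Longrightarrow> inverse a \<in> S"
begin

text \<open>The recursion for the coefficients of the inverse divides only by the constant
  coefficient, a unit of \<open>S\<close>.\<close>

lemma inverse_fps_over:
  assumes u: "u \<in> fps_over S" "fps_nth u 0 \<notin> J"
  shows "inverse u \<in> fps_over S"
proof -
  have u0: "fps_nth u 0 \<noteq> 0" using u zero_J by auto
  have "fps_nth (inverse u) n \<in> S" for n
  proof (induction n rule: less_induct)
    case (less n)
    have "fps_nth (1 :: 'e fps) n = (\<Sum>i = 0..n. fps_nth (inverse u) i * fps_nth u (n - i))"
      using inverse_mult_eq_1[OF u0] by (metis fps_mult_nth)
    also have "\<dots> = (\<Sum>i = 0..<n. fps_nth (inverse u) i * fps_nth u (n - i)) + fps_nth (inverse u) n * fps_nth u 0"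
      by (cases n) (auto simp: atLeastLessThanSuc_atLeastAtMost)
    finally have "fps_nth (inverse u) n =
        (fps_nth 1 n - (\<Sum>i = 0..<n. fps_nth (inverse u) i * fps_nth u (n - i))) * inverse (fps_nth u 0)"
      using u0 by (simp add: field_simps)
    also have "\<dots> \<in> S"
    proof (intro mult_S diff_S sum_S inverse_S)
      fix i assume "i \<in> {0..<n}"
      then show "fps_nth (inverse u) i \<in> S" using less by simp
    qed (use u in \<open>auto simp: fps_over_def fps_one_nth one_S zero_S\<close>)
    finally show ?case .
  qed
  then show ?thesis by (simp add: fps_over_def)
qed

text \<open>After the permutations, \<open>A\<close> agrees modulo \<open>J\<close> with a pivoted
  form whose scalars are units; the last \<open>q\<close> pivots have the constant terms of the
  identity matrix. The final clause serves the induction: it bounds the exponents of the smaller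
  matrix from below by the exponent just split off, which gives \<open>antitone\<close>.\<close>

definition is_ldu where
  "is_ldu m q A \<rho> \<kappa> z \<mu> \<longleftrightarrow> \<rho> permutes {0..<m} \<and> \<kappa> permutes {0..<m} \<and> (\<forall>v. z v \<in> S) \<and>
    (\<forall>p<m. z (p, p, 0) \<notin> J) \<and>
    (\<forall>p<m. m - q \<le> p \<longrightarrow> (\<forall>r. z (p, r, 0) - (if r = p then 1 else 0) \<in> J)) \<and>
    antitone m \<mu> \<and> (\<forall>a<m. \<forall>b<m. A (\<rho> a) (\<kappa> b) - ldu m \<mu> z a b \<in> fps_below J \<infinity>) \<and>
    (\<forall>e. (\<forall>i<m. \<forall>j<m. A i j \<in> fps_below J e) \<longrightarrow> (\<forall>p<m. e \<le> \<mu> p))"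

text \<open>Full pivoting, except that the last \<open>q\<close> pivots may be taken on the diagonal if the last
  \<open>q\<close> rows and columns of \<open>A(0)\<close> are those of the identity.\<close>

lemma ldu_exists:
  assumes "\<And>i j. i < m \<Longrightarrow> j < m \<Longrightarrow> A i j \<in> fps_over S" "q \<le> m"
    and "\<And>i j. i < m \<Longrightarrow> j < m \<Longrightarrow> m - q \<le> i \<or> m - q \<le> j \<Longrightarrow>
      fps_nth (A i j) 0 - (if i = j then 1 else 0) \<in> J"
  shows "\<exists>\<rho> \<kappa> z \<mu>. is_ldu m q A \<rho> \<kappa> z \<mu>"
  using assms
proof (induction m arbitrary: A q)
  case 0
  show ?case
    by (rule exI[of _ id], rule exI[of _ id], rule exI[of _ "\<lambda>_. 0"], rule exI)
      (auto simp: is_ldu_def permutes_id zero_S antitone_def)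
next
  case (Suc m)
  note AS = Suc.prems(1) and id = Suc.prems(3)
  show ?case
  proof (cases "\<forall>i<Suc m. \<forall>j<Suc m. A i j \<in> fps_below J \<infinity>")
    case True
    have q: "q = 0"
    proof (rule ccontr)
      assume "q \<noteq> 0"
      then have "fps_nth (A m m) 0 - 1 \<in> J" using id[of m m] by simp
      moreover have "fps_nth (A m m) 0 \<in> J" using True by (auto simp: fps_below_def)
      ultimately have "1 \<in> J" using diff_J[of "fps_nth (A m m) 0" "fps_nth (A m m) 0 - 1"] by simp
      then show False using one_notin_J by blast
    qed
    have z: "ldu (Suc m) (\<lambda>_. \<infinity>) z a b = 0" for z :: "nat \<times> nat \<times> nat \<Rightarrow> 'e" and a b
      by (simp add: ldu_def ldu_term_def tpow_def)
    \<comment> \<open>With all exponents \<infinity> the form is 0 for any parameters; the value 1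
      makes the scalars units.\<close>
    show ?thesis
      by (rule exI[of _ id], rule exI[of _ id], rule exI[of _ "\<lambda>_. 1"], rule exI[of _ "\<lambda>_. \<infinity>"])
        (use True q in \<open>auto simp: is_ldu_def permutes_id[unfolded id_def] one_S one_notin_J antitone_def z\<close>)
  next
    case False
    define P where "P s \<longleftrightarrow> (\<exists>i<Suc m. \<exists>j<Suc m. fps_nth (A i j) s \<notin> J)" for s
    define s where "s = (LEAST s. P s)"
    have "\<exists>s. P s" using False by (auto simp: fps_below_def P_def)
    then have Ps: "P s" unfolding s_def by (rule LeastI_ex)
    have min: "fps_nth (A i j) s' \<in> J" if "s' < s" "i < Suc m" "j < Suc m" for i j s'
      using not_less_Least[of s' P] that unfolding s_def P_def by blast
    \<comment> \<open>A pivot of least order. If \<open>q > 0\<close>, the corner is 1 modulo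
      \<open>J\<close> at \<open>t = 0\<close>, so it qualifies with \<open>s = 0\<close> and no
      rows or columns are exchanged.\<close>
    obtain i0 j0 where ij0: "i0 < Suc m" "j0 < Suc m" "fps_nth (A i0 j0) s \<notin> J"
      and q0: "q > 0 \<Longrightarrow> s = 0 \<and> i0 = m \<and> j0 = m"
    proof (cases "q = 0")
      case True
      with Ps that show ?thesis by (auto simp: P_def)
    next
      case False
      then have 1: "fps_nth (A m m) 0 - 1 \<in> J" using id[of m m] by simp
      have 2: "fps_nth (A m m) 0 \<notin> J"
        using diff_J[OF _ 1, of "fps_nth (A m m) 0"] one_notin_J by auto
      then have "P 0" by (auto simp: P_def)
      then have "s = 0" unfolding s_def by simp
      then show ?thesis using that[of m m] 2 by simp
    qed
    let ?r = "Transposition.transpose i0 m" and ?k = "Transposition.transpose j0 m"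
    define A' where "A' a b = A (?r a) (?k b)" for a b
    have tr: "?r a < Suc m" "?k a < Suc m" if "a < Suc m" for a
      using that ij0 by (auto simp: Transposition.transpose_def)
    have A'S: "A' a b \<in> fps_over S" if "a < Suc m" "b < Suc m" for a b
      using that tr AS by (simp add: A'_def)
    interpret F: subring_ideal "fps_over S" "fps_over S \<inter> fps_below J \<infinity>" by (rule fps_subring_ideal)
    \<comment> \<open>Division by \<open>t^s\<close>. The coefficients dropped lie in
      \<open>J\<close> but need not be 0, so \<open>A' = t^s F\<close> holds only as a
      congruence.\<close>
    define F where "F a b = fps_shift s (A' a b)" for a b
    have FS: "F a b \<in> fps_over S" if "a < Suc m" "b < Suc m" for a b
      using A'S[OF that] by (auto simp: F_def fps_over_def)
    have tp: "tpow e \<in> fps_over S" for e by (auto simp: fps_over_def tpow_nth one_S zero_S)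
    have A'F: "A' a b - tpow (enat s) * F a b \<in> fps_below J \<infinity>" if "a < Suc m" "b < Suc m" for a b
      using min[of _ "?r a" "?k b"] tr that by (auto simp: fps_below_def tpow_mult_nth F_def A'_def zero_J)
    define u where "u = F m m"
    have uS: "u \<in> fps_over S" using FS by (simp add: u_def)
    have u0: "fps_nth u 0 \<notin> J" using ij0 by (simp add: u_def F_def A'_def)
    then have unz: "fps_nth u 0 \<noteq> 0" using zero_J by auto
    have wS: "inverse u \<in> fps_over S" by (rule inverse_fps_over[OF uS u0])
    have uw: "u * inverse u = 1" using inverse_mult_eq_1[OF unz] by (simp add: mult.commute)
    define x where "x a = F a m * inverse u" for a
    define y where "y b = F m b * inverse u" for b
    have xS: "x a \<in> fps_over S" "y a \<in> fps_over S" if "a < Suc m" for a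
      using that FS wS F.mult_S by (auto simp: x_def y_def)
    have ux: "u * x a = F a m" "u * y a = F m a" for a
      using uw by (auto simp: x_def y_def mult.left_commute[of u])
    define R where "R a b = tpow (enat s) * u * x a * y b" for a b
    have RS: "R a b \<in> fps_over S" if "a < m" "b < m" for a b
      unfolding R_def using that by (intro F.mult_S tp uS xS) auto
    \<comment> \<open>\<open>R\<close> is the rank one term of the pivot, and \<open>B\<close> the
      Schur complement on the remaining rows and columns.\<close>
    define B where "B a b = A' a b - R a b" for a b
    have BS: "B a b \<in> fps_over S" if "a < m" "b < m" for a b
      unfolding B_def using that by (intro F.diff_S A'S RS) auto
    have x0: "fps_nth (x a) 0 \<in> J" "fps_nth (y a) 0 \<in> J" if "q > 0" "a < m" for a
    proof -
      have sm: "Suc m - q \<le> m" using that by simp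
      have "fps_nth (A a m) 0 \<in> J" "fps_nth (A m a) 0 \<in> J"
        using id[of a m] id[of m a] that sm by simp_all
      moreover have "F a m = A a m" "F m a = A m a" using q0 that by (auto simp: F_def A'_def)
      ultimately show "fps_nth (x a) 0 \<in> J" "fps_nth (y a) 0 \<in> J"
        using inverse_S[OF _ u0] uS by (auto simp: x_def y_def fps_over_def intro: mult_J_right)
    qed
    \<comment> \<open>For \<open>q > 0\<close> the border of the pivot vanishes at
      \<open>t = 0\<close> modulo \<open>J\<close>, so subtracting \<open>R\<close> preserves the
      remaining \<open>q - 1\<close> rows and columns of the identity.\<close>
    have idB: "fps_nth (B i j) 0 - (if i = j then 1 else 0) \<in> J"
      if ij: "i < m" "j < m" "m - (q - 1) \<le> i \<or> m - (q - 1) \<le> j" for i j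
    proof -
      have q: "q > 0" using ij by (cases q) auto
      have "R i j = (tpow (enat s) * u * y j) * x i" by (simp add: R_def)
      moreover have S0: "fps_nth (tpow (enat s) * u * y j) 0 \<in> S"
        using F.mult_S[OF F.mult_S[OF tp[of "enat s"] uS] xS(2)[OF less_SucI[OF ij(2)]]]
        unfolding fps_over_def mem_Collect_eq by (rule spec)
      ultimately have "fps_nth (R i j) 0 \<in> J"
        using mult_J[OF S0 x0(1)[OF q ij(1)]]
        by (simp only: fps_mult_nth_0 simp_thms)
      moreover have "fps_nth (A i j) 0 - (if i = j then 1 else 0) \<in> J"
        using id[of i j] ij q by auto
      moreover have "A' i j = A i j" using q0[OF q] by (simp add: A'_def)
      ultimately show ?thesis
        using diff_J[of "fps_nth (A i j) 0 - (if i = j then 1 else 0)" "fps_nth (R i j) 0"]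
        by (simp add: B_def algebra_simps)
    qed
    have "q - 1 \<le> m" using Suc.prems(2) by simp
    from Suc.IH[OF BS this idB] obtain \<rho>' \<kappa>' z' \<mu>' where ldu: "is_ldu m (q - 1) B \<rho>' \<kappa>' z' \<mu>'" by blast
    then have IH: "\<rho>' permutes {0..<m}" "\<kappa>' permutes {0..<m}" "\<And>v. z' v \<in> S"
      "\<And>p. p < m \<Longrightarrow> z' (p, p, 0) \<notin> J"
      "\<And>p r. p < m \<Longrightarrow> m - (q - 1) \<le> p \<Longrightarrow> z' (p, r, 0) - (if r = p then 1 else 0) \<in> J"
      "antitone m \<mu>'"
      "\<And>a b. a < m \<Longrightarrow> b < m \<Longrightarrow> B (\<rho>' a) (\<kappa>' b) - ldu m \<mu>' z' a b \<in> fps_below J \<infinity>"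
      "\<And>e p. \<forall>i<m. \<forall>j<m. B i j \<in> fps_below J e \<Longrightarrow> p < m \<Longrightarrow> e \<le> \<mu>' p"
      unfolding is_ldu_def by blast+
    \<comment> \<open>The parameters of the new pivot are stored in the row and column order chosen
      for \<open>B\<close>; their index \<open>r\<close> runs up to \<open>2 m\<close>, and 0 is the
      default beyond.\<close>
    define z where "z = (\<lambda>(p, r, s). if p = m then (if r < m then fps_nth (x (\<rho>' r)) s
      else if r = m then fps_nth u s
      else if r < Suc (m + m) then fps_nth (y (\<kappa>' (r - Suc m))) s else 0) else z' (p, r, s))"
    define \<mu> where "\<mu> = \<mu>'(m := enat s)"
    have \<rho>'m: "\<rho>' a < m" "\<kappa>' a < m" if "a < m" for a
      using permutes_in_image[OF IH(1), of a] permutes_in_image[OF IH(2), of a] that by auto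
    have \<rho>'_m: "\<rho>' m = m" "\<kappa>' m = m"
      using permutes_not_in[OF IH(1), of m] permutes_not_in[OF IH(2), of m] by auto
    have zx: "xser z m a = (if a = m then 1 else x (\<rho>' a))" "yser z m a = (if a = m then 1 else y (\<kappa>' a))"
      if "a \<le> m" for a
      using that by (auto simp: z_def xser_def yser_def fps_eq_iff)
    have zu: "zser z m m = u" by (simp add: z_def fps_eq_iff)
    have lduS: "ldu (Suc m) \<mu> z a b = ldu m \<mu>' z' a b + ldu_term \<mu> z m a b" if "a \<le> m" "b \<le> m" for a b
    proof -
      have "ldu (Suc m) \<mu> z a b = ldu m \<mu> z a b + ldu_term \<mu> z m a b" using that by (simp add: ldu_def)
      also have "ldu m \<mu> z a b = ldu m \<mu>' z' a b" by (rule ldu_cong) (auto simp: \<mu>_def z_def)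
      finally show ?thesis .
    qed
    have cong: "A (?r (\<rho>' a)) (?k (\<kappa>' b)) - ldu (Suc m) \<mu> z a b \<in> fps_below J \<infinity>"
      if ab: "a < Suc m" "b < Suc m" for a b
    proof (cases "a < m \<and> b < m")
      case True
      then have "ldu_term \<mu> z m a b = R (\<rho>' a) (\<kappa>' b)"
        by (simp add: ldu_term_def zx zu R_def \<mu>_def)
      then have "A (?r (\<rho>' a)) (?k (\<kappa>' b)) - ldu (Suc m) \<mu> z a b = B (\<rho>' a) (\<kappa>' b) - ldu m \<mu>' z' a b"
        using ab by (simp add: lduS B_def A'_def)
      then show ?thesis using IH(7) True by simp
    next
      case False
      \<comment> \<open>In row or column \<open>m\<close> the earlier pivots contribute nothing, and
        the new one reproduces \<open>t^s F\<close>.\<close>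
      have "ldu m \<mu>' z' a b = 0" using False ab by (auto simp: ldu_def)
      moreover have "ldu_term \<mu> z m a b = tpow (enat s) * F (\<rho>' a) (\<kappa>' b)"
        using False ab ux(1)[of "\<rho>' a"] ux(2)[of "\<kappa>' b"]
        by (cases "a = m"; cases "b = m") (simp_all add: ldu_term_def zx zu \<mu>_def \<rho>'_m mult.assoc, simp add: u_def)
      moreover have "\<rho>' a < Suc m" "\<kappa>' b < Suc m"
        using ab \<rho>'m[of a] \<rho>'m[of b] \<rho>'_m by (auto simp: less_Suc_eq)
      ultimately show ?thesis
        using A'F[of "\<rho>' a" "\<kappa>' b"] ab by (simp add: lduS A'_def)
    qed
    have le: "e \<le> \<mu> p" if e: "\<forall>i<Suc m. \<forall>j<Suc m. A i j \<in> fps_below J e" and p: "p < Suc m" for e p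
    proof -
      have es: "e \<le> enat s"
      proof (rule ccontr)
        assume "\<not> e \<le> enat s"
        then show False using e ij0 by (auto simp: fps_below_def not_le)
      qed
      interpret Fe: subring_ideal "fps_over S" "fps_over S \<inter> fps_below J e" by (rule fps_subring_ideal)
      have "tpow (enat s) \<in> fps_over S \<inter> fps_below J e"
        using es tp by (auto simp: fps_below_def tpow_nth zero_J)
      then have "R i j \<in> fps_over S \<inter> fps_below J e" if "i < m" "j < m" for i j
        unfolding R_def using that uS xS by (intro Fe.mult_J_right) auto
      moreover have "A' i j \<in> fps_over S \<inter> fps_below J e" if "i < m" "j < m" for i j
        using A'S[of i j] e tr that by (simp add: A'_def)
      ultimately have "B i j \<in> fps_below J e" if "i < m" "j < m" for i j
        using Fe.diff_J that unfolding B_def by blast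
      then show ?thesis using IH(8)[of e p] es p by (auto simp: \<mu>_def less_Suc_eq)
    qed
    have anti: "antitone (Suc m) \<mu>"
    proof -
      have "enat s \<le> \<mu> p" if "p < Suc m" for p
        by (rule le[OF _ that]) (auto simp: fps_below_def min)
      moreover have "\<mu> j \<le> \<mu> i" if "i \<le> j" "j < m" for i j
        using IH(6) that by (simp add: antitone_def \<mu>_def)
      moreover have "\<mu> m = enat s" by (simp add: \<mu>_def)
      ultimately show ?thesis unfolding antitone_def by (metis le_imp_less_Suc less_SucE)
    qed
    have zS: "z v \<in> S" for v
      using xS uS IH(3) \<rho>'m by (cases v) (auto simp: z_def fps_over_def zero_S less_Suc_eq)
    have zp: "z (p, p, 0) \<notin> J" if "p < Suc m" for p
      using that IH(4) u0 by (auto simp: z_def)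
    have zid: "z (p, r, 0) - (if r = p then 1 else 0) \<in> J" if p: "p < Suc m" "Suc m - q \<le> p" for p r
    proof (cases "p = m")
      case True
      then have q: "q > 0" using p by (cases q) auto
      have "fps_nth u 0 - 1 \<in> J" using id[of m m] q0[OF q] q by (simp add: u_def F_def A'_def)
      moreover have "fps_nth (y (\<kappa>' (r - Suc m))) 0 \<in> J" if "\<not> r < m" "r \<noteq> m" "r < Suc (m + m)"
        using that by (intro x0 q \<rho>'m) auto
      ultimately show ?thesis
        using True x0[OF q] \<rho>'m zero_J by (auto simp: z_def)
    next
      case False
      then show ?thesis using IH(5)[of p r] p by (auto simp: z_def)
    qed
    have "\<rho>' permutes {0..<Suc m}" "\<kappa>' permutes {0..<Suc m}"
      using permutes_subset[OF IH(1)] permutes_subset[OF IH(2)] by auto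
    then have "?r \<circ> \<rho>' permutes {0..<Suc m}" "?k \<circ> \<kappa>' permutes {0..<Suc m}"
      using ij0 by (auto intro!: permutes_compose permutes_swap_id)
    then have "is_ldu (Suc m) q A (?r \<circ> \<rho>') (?k \<circ> \<kappa>') z \<mu>"
      unfolding is_ldu_def o_apply using zS zp zid anti cong le by blast
    then show ?thesis by blast
  qed
qed

end

section \<open>Points of jet schemes\<close>

lemma carrier_mp_ring: "p \<in> carrier (mp_ring W) \<longleftrightarrow> mp_vars p \<subseteq> W"
  by (simp add: mp_ring_def)

lemma mp_vars_const: "mp_vars (mp_const c) = {}"
  by (auto simp: mp_vars_def mp_const_def)

lemma mp_vars_var: "mp_vars (mp_var v :: ('v, 'k::comm_ring_1) mpoly) = {v}"
  by (simp add: mp_vars_def mp_var_def)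

lemma mp_vars_uminus: "mp_vars (- p) = mp_vars (p :: ('v, 'k::comm_ring_1) mpoly)"
  by (auto simp: mp_vars_def in_keys_iff)

lemma mp_ring_subring: "subring_ideal (carrier (mp_ring W)) {0 :: ('v, 'k::comm_ring_1) mpoly}"
  by standard (auto simp: carrier_mp_ring mp_vars_add mp_vars_mult mp_vars_uminus,
    auto simp: mp_vars_def)

lemma ideal_iff:
  "ideal P (mp_ring W) \<longleftrightarrow> subring_ideal (carrier (mp_ring W)) (P :: ('v, 'k::comm_ring_1) mpoly set)"
proof
  assume "ideal P (mp_ring W)"
  then interpret ideal P "mp_ring W :: ('v, 'k) mpoly ring" .
  show "subring_ideal (carrier (mp_ring W)) P"
  proof
    show "0 \<in> P" using additive_subgroup.zero_closed[OF is_additive_subgroup] by (simp add: mp_ring_def)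
    fix a b :: "('v, 'k) mpoly"
    show "a + b \<in> P" if "a \<in> P" "b \<in> P"
      using additive_subgroup.a_closed[OF is_additive_subgroup that] by (simp add: mp_ring_def)
    show "a * b \<in> P" if "a \<in> carrier (mp_ring W)" "b \<in> P"
      using I_l_closed[OF that(2,1)] by (simp add: mp_ring_def)
    show "a \<in> carrier (mp_ring W)" if "a \<in> P" using a_subset that by blast
  qed (auto simp: carrier_mp_ring mp_vars_add mp_vars_mult mp_vars_uminus, auto simp: mp_vars_def)
next
  assume "subring_ideal (carrier (mp_ring W)) P"
  then interpret subring_ideal "carrier (mp_ring W)" P .
  interpret cring "mp_ring W :: ('v, 'k) mpoly ring" by (rule mp_ring_cring)
  have mult: "a \<otimes>\<^bsub>mp_ring W\<^esub> b = a * b" for a b :: "('v, 'k) mpoly" by (simp add: mp_ring_def)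
  show "ideal P (mp_ring W)"
  proof (rule idealI[OF ring_axioms])
    show "subgroup P (add_monoid (mp_ring W))"
    proof (rule add.subgroupI)
      show "P \<noteq> {}" using zero_J by blast
      fix a b assume a: "a \<in> P"
      have "\<ominus>\<^bsub>mp_ring W\<^esub> a = - a"
        by (rule minus_equality) (use J_S[OF a] J_S[OF uminus_J[OF a]] in \<open>simp_all add: mp_ring_def\<close>)
      then show "\<ominus>\<^bsub>mp_ring W\<^esub> a \<in> P" using uminus_J a by simp
      show "a \<oplus>\<^bsub>mp_ring W\<^esub> b \<in> P" if "b \<in> P" using add_J[OF a that] by (simp add: mp_ring_def)
    qed (use J_S in auto)
  qed (simp_all add: mult mult_J mult_J_right)
qed

lemma Spec_iff:
  "P \<in> Spec (mp_ring W) \<longleftrightarrow> subring_prime (carrier (mp_ring W)) (P :: ('v, 'k::comm_ring_1) mpoly set)"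
proof
  assume "P \<in> Spec (mp_ring W)"
  then interpret primeideal P "mp_ring W :: ('v, 'k) mpoly ring" by (simp add: Spec_def)
  interpret subring_ideal "carrier (mp_ring W)" P using is_ideal by (simp add: ideal_iff)
  show "subring_prime (carrier (mp_ring W)) P"
  proof
    show "1 \<notin> P" using I_notcarr one_imp_carrier by (auto simp: mp_ring_def)
    show "a \<in> P \<or> b \<in> P" if "a \<in> carrier (mp_ring W)" "b \<in> carrier (mp_ring W)" "a * b \<in> P" for a b
      using I_prime[OF that(1,2)] that(3) by (simp add: mp_ring_def)
  qed
next
  assume "subring_prime (carrier (mp_ring W)) P"
  then interpret subring_prime "carrier (mp_ring W)" P .
  interpret cring "mp_ring W :: ('v, 'k) mpoly ring" by (rule mp_ring_cring)
  have "primeideal P (mp_ring W)"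
  proof (rule primeidealI)
    show "ideal P (mp_ring W)" using subring_ideal_axioms by (simp add: ideal_iff)
    show "carrier (mp_ring W) \<noteq> P" using one_S one_notin_J by blast
  qed (use prime_J in \<open>simp_all add: mp_ring_def cring_axioms[unfolded mp_ring_def]\<close>)
  then show "P \<in> Spec (mp_ring W)" by (simp add: Spec_def)
qed

section \<open>Points with values in a ring, and local rings of points\<close>

text \<open>The point with coordinates \<open>z\<close> in \<open>S / J\<close>, that is, the kernel
  of evaluation into this quotient. With the variables for \<open>z\<close> and the prime itself for
  \<open>J\<close>, every point arises this way.\<close>

definition pt :: "('k::comm_ring_1 \<Rightarrow> 'b::comm_ring_1) \<Rightarrow> ('v \<Rightarrow> 'b) \<Rightarrow> 'b set \<Rightarrow> 'v set \<Rightarrow> ('v, 'k) mpoly set" where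
  "pt h z J W = {p \<in> carrier (mp_ring W). mp_eval h z p \<in> J}"

lemma pt_self: "P \<subseteq> carrier (mp_ring W) \<Longrightarrow> pt mp_const mp_var P W = P"
  by (auto simp: pt_def)

lemma (in subring_prime) pt_Spec:
  assumes h: "comm_ring_hom h" "\<And>c. h c \<in> S" and z: "\<And>v. v \<in> W \<Longrightarrow> z v \<in> S"
  shows "pt h z J W \<in> Spec (mp_ring W)"
proof -
  interpret e: comm_ring_hom "mp_eval h z" by (rule mp_eval_hom[OF h(1)])
  interpret M: subring_ideal "carrier (mp_ring W)" "{0}" by (rule mp_ring_subring)
  have S: "mp_eval h z p \<in> S" if "p \<in> carrier (mp_ring W)" for p
    using that h z by (intro mp_eval_S) (auto simp: carrier_mp_ring)
  show ?thesis
    unfolding Spec_iff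
  proof
    fix a b
    show "a \<in> pt h z J W \<or> b \<in> pt h z J W"
      if "a \<in> carrier (mp_ring W)" "b \<in> carrier (mp_ring W)" "a * b \<in> pt h z J W"
      using that prime_J[OF S S] by (auto simp: pt_def e.hom_mult)
  qed (auto simp: pt_def e.hom_add e.hom_mult M.one_S M.add_S M.mult_S M.uminus_S M.zero_S
      one_notin_J add_J zero_J intro: mult_J S)
qed

lemma pt_trunc: "V' \<subseteq> V \<Longrightarrow> pt h z J V \<inter> carrier (mp_ring V') = pt h z J V'"
  by (auto simp: pt_def carrier_mp_ring)

lemma (in subring_ideal) pt_cong:
  assumes "\<And>c. h c \<in> S" "\<And>v. v \<in> W \<Longrightarrow> z v \<in> S" "\<And>v. v \<in> W \<Longrightarrow> z' v \<in> S"
    and "\<And>v. v \<in> W \<Longrightarrow> z v - z' v \<in> J"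
  shows "pt h z J W = pt h z' J W"
proof -
  have "mp_eval h z p \<in> J \<longleftrightarrow> mp_eval h z' p \<in> J" if "p \<in> carrier (mp_ring W)" for p
    using that assms by (intro cong_iff cong_mp_eval) (auto simp: carrier_mp_ring)
  then show ?thesis by (auto simp: pt_def)
qed

text \<open>The left side is the image of a point under the morphism with coordinate functions
  \<open>y\<close>: evaluating at \<open>z\<close> after substituting \<open>y\<close> is evaluating
  at the values of \<open>y\<close>.\<close>

lemma pt_comp:
  assumes "comm_ring_hom h" "\<And>v. v \<in> V \<Longrightarrow> mp_vars (y v) \<subseteq> W"
  shows "{p \<in> carrier (mp_ring V). mp_eval mp_const y p \<in> pt h z J W} = pt h (\<lambda>v. mp_eval h z (y v)) J V"
proof -
  interpret e: comm_ring_hom "mp_eval h z" by (rule mp_eval_hom[OF assms(1)])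
  interpret M: subring_ideal "carrier (mp_ring W)" "{0}" by (rule mp_ring_subring)
  have "mp_eval h z (mp_eval mp_const y p) = mp_eval h (\<lambda>v. mp_eval h z (y v)) p" for p
    by (subst hom_mp_eval[OF e.comm_ring_hom_axioms]) (simp add: o_def mp_eval_const[OF assms(1)])
  moreover have "mp_eval mp_const y p \<in> carrier (mp_ring W)" if "p \<in> carrier (mp_ring V)" for p
    using that assms(2) by (intro M.mp_eval_S) (auto simp: carrier_mp_ring mp_vars_const)
  ultimately show ?thesis by (auto simp: pt_def)
qed

text \<open>Fractions with denominator outside \<open>J\<close> form the local ring at
  \<open>J\<close>. The embedding \<open>f\<close> into a field makes it a subset of an existing
  type, and fractions are compared by cross-multiplication.\<close>

lemma (in subring_prime) localization:
  fixes f :: "'a \<Rightarrow> 'e::field"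
  assumes f: "comm_ring_hom f" "inj f"
  shows "local_pair {f a / f b | a b. a \<in> S \<and> b \<in> S - J} {f a / f b | a b. a \<in> J \<and> b \<in> S - J}"
    (is "local_pair ?S ?J")
    and "a \<in> S \<Longrightarrow> f a \<in> {f a / f b | a b. a \<in> S \<and> b \<in> S - J}"
    and "a \<in> S \<Longrightarrow> f a \<in> {f a / f b | a b. a \<in> J \<and> b \<in> S - J} \<longleftrightarrow> a \<in> J"
proof -
  interpret f: comm_ring_hom f by fact
  have nz: "f b \<noteq> 0" if "b \<in> S - J" for b
  proof
    assume "f b = 0"
    then have "f b = f 0" by simp
    then have "b = 0" using f(2) by (rule_tac injD)
    then show False using that zero_J by blast
  qed
  have one: "1 \<in> S - J" using one_S one_notin_J by blast
  have mS: "b * b' \<in> S - J" if "b \<in> S - J" "b' \<in> S - J" for b b'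
    using that mult_S prime_J by auto
  show incl: "f a \<in> ?S" if "a \<in> S" for a
    using that one by (intro CollectI exI[of _ a] exI[of _ 1]) simp
  have J_iff: "f a / f b \<in> ?J \<longleftrightarrow> a \<in> J" if "a \<in> S" "b \<in> S - J" for a b
  proof
    assume "f a / f b \<in> ?J"
    then obtain c d where cd: "f a / f b = f c / f d" "c \<in> J" "d \<in> S - J" by auto
    then have "f (a * d) = f (c * b)" using nz that by (simp add: frac_eq_eq f.hom_mult)
    then have "a * d \<in> J" using f(2) cd that mult_J_right by (auto dest!: injD)
    then show "a \<in> J" using prime_J that cd by auto
  qed (use that in blast)
  show "f a \<in> ?J \<longleftrightarrow> a \<in> J" if "a \<in> S" using J_iff[OF that one] by simp
  show "local_pair ?S ?J"
  proof
    show "1 \<in> ?S" using incl[OF one_S] by simp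
    show "0 \<in> ?J" using zero_J one by (intro CollectI exI[of _ 0] exI[of _ 1]) simp
    show "1 \<notin> ?J" using J_iff[OF one_S one] one_notin_J by simp
    fix x y
    show "x + y \<in> ?S" if xy: "x \<in> ?S" "y \<in> ?S"
    proof -
      obtain a b c d where "x = f a / f b" "y = f c / f d" "a \<in> S" "b \<in> S - J" "c \<in> S" "d \<in> S - J"
        using xy by auto
      then show ?thesis using nz mS
        by (intro CollectI exI[of _ "a * d + c * b"] exI[of _ "b * d"])
          (auto simp: add_frac_eq f.hom_add f.hom_mult add_S mult_S)
    qed
    show "x + y \<in> ?J" if xy: "x \<in> ?J" "y \<in> ?J"
    proof -
      obtain a b c d where "x = f a / f b" "y = f c / f d" "a \<in> J" "b \<in> S - J" "c \<in> J" "d \<in> S - J"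
        using xy by auto
      then show ?thesis using nz mS
        by (intro CollectI exI[of _ "a * d + c * b"] exI[of _ "b * d"])
          (auto simp: add_frac_eq f.hom_add f.hom_mult add_J mult_J_right)
    qed
    show "x * y \<in> ?S" if xy: "x \<in> ?S" "y \<in> ?S"
    proof -
      obtain a b c d where "x = f a / f b" "y = f c / f d" "a \<in> S" "b \<in> S - J" "c \<in> S" "d \<in> S - J"
        using xy by auto
      then show ?thesis using nz mS
        by (intro CollectI exI[of _ "a * c"] exI[of _ "b * d"]) (auto simp: f.hom_mult mult_S)
    qed
    show "x * y \<in> ?J" if xy: "x \<in> ?S" "y \<in> ?J"
    proof -
      obtain a b c d where "x = f a / f b" "y = f c / f d" "a \<in> S" "b \<in> S - J" "c \<in> J" "d \<in> S - J"
        using xy by auto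
      then show ?thesis using nz mS
        by (intro CollectI exI[of _ "a * c"] exI[of _ "b * d"]) (auto simp: f.hom_mult mult_J)
    qed
    show "- x \<in> ?S" if xy: "x \<in> ?S"
    proof -
      obtain a b where "x = f a / f b" "a \<in> S" "b \<in> S - J" using xy by auto
      then show ?thesis
        by (intro CollectI exI[of _ "- a"] exI[of _ b]) (auto simp: f.hom_uminus uminus_S)
    qed
    show "x \<in> ?S" if "x \<in> ?J" using that J_S by blast
    show "x \<in> ?J \<or> y \<in> ?J" if xy: "x \<in> ?S" "y \<in> ?S" "x * y \<in> ?J"
    proof -
      obtain a b c d where *: "x = f a / f b" "y = f c / f d" "a \<in> S" "b \<in> S - J" "c \<in> S" "d \<in> S - J"
        using xy(1,2) by auto
      then have "f (a * c) / f (b * d) \<in> ?J" using xy(3) by (simp add: f.hom_mult)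
      then have "a * c \<in> J" using J_iff[OF mult_S mS] * by blast
      then show ?thesis using prime_J * by blast
    qed
    show "inverse x \<in> ?S" if xy: "x \<in> ?S" "x \<notin> ?J"
    proof -
      obtain a b where *: "x = f a / f b" "a \<in> S" "b \<in> S - J" using xy(1) by auto
      then have "a \<notin> J" using xy(2) * by blast
      then show ?thesis using *
        by (intro CollectI exI[of _ b] exI[of _ a]) (auto simp: field_simps)
    qed
  qed
qed

text \<open>The residue field of a point is not a type, but its local ring embeds into the field of
  rational functions in countably many variables.\<close>

type_synonym 'k rat_fun = "(nat, 'k) mpoly fract"

lemma to_fract_hom: "comm_ring_hom (to_fract :: 'a::idom \<Rightarrow> 'a fract)"
  by standard auto

text \<open>Renaming the variables by \<open>to_nat\<close> embeds the polynomial ring into the one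
  in countably many variables, whose fraction field contains the localization at \<open>P\<close>.
  So one field type serves all points.\<close>

lemma Spec_local:
  fixes P :: "('v::countable, 'k::field) mpoly set"
  assumes "P \<in> Spec (mp_ring W)"
  obtains S J h and z :: "'v \<Rightarrow> 'k rat_fun" where
    "local_pair S J" "comm_ring_hom h" "\<And>c. h c \<in> S" "\<And>v. v \<in> W \<Longrightarrow> z v \<in> S" "P = pt h z J W"
proof -
  interpret P: subring_prime "carrier (mp_ring W)" P using assms by (simp add: Spec_iff)
  define r :: "('v, 'k) mpoly \<Rightarrow> (nat, 'k) mpoly" where "r = mp_eval mp_const (\<lambda>v. mp_var (to_nat v))"
  have r: "comm_ring_hom r" unfolding r_def by (rule mp_eval_hom[OF mp_const_hom])
  have l: "comm_ring_hom (mp_eval mp_const (\<lambda>n. mp_var (from_nat n :: 'v)) :: _ \<Rightarrow> ('v, 'k) mpoly)"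
    by (rule mp_eval_hom[OF mp_const_hom])
  have "mp_eval mp_const (\<lambda>n. mp_var (from_nat n)) (r p) = p" for p
    unfolding r_def
    by (subst hom_mp_eval[OF l]) (simp add: o_def mp_eval_const[OF mp_const_hom] mp_eval_var[OF mp_const_hom])
  then have "inj r" by (metis injI)
  define f where "f p = to_fract (r p)" for p
  have f: "comm_ring_hom f"
    unfolding f_def using comm_ring_hom_comp[OF to_fract_hom r] by (simp add: o_def)
  have "inj f" using \<open>inj r\<close> by (auto simp: f_def inj_def)
  note L = P.localization[OF f this]
  have ev: "mp_eval (f \<circ> mp_const) (f \<circ> mp_var) p = f p" for p
    using hom_mp_eval[OF f, of mp_const mp_var p] by simp
  show ?thesis
  proof (rule that[OF L(1)])
    show "comm_ring_hom (f \<circ> mp_const)" by (rule comm_ring_hom_comp[OF f mp_const_hom])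
    show "P = pt (f \<circ> mp_const) (f \<circ> mp_var) {f a / f b |a b. a \<in> P \<and> b \<in> carrier (mp_ring W) - P} W"
      unfolding pt_def ev using L(3) P.J_S by blast
    show "(f \<circ> mp_const) c \<in> {f a / f b |a b. a \<in> carrier (mp_ring W) \<and> b \<in> carrier (mp_ring W) - P}" for c
      unfolding o_def by (rule L(2)) (simp add: carrier_mp_ring mp_vars_const)
    show "(f \<circ> mp_var) v \<in> {f a / f b |a b. a \<in> carrier (mp_ring W) \<and> b \<in> carrier (mp_ring W) - P}"
      if "v \<in> W" for v
      unfolding o_def by (rule L(2)) (simp add: carrier_mp_ring mp_vars_var that)
  qed
qed

section \<open>The determinantal ideals\<close>

definition pminor :: "nat \<Rightarrow> (nat \<Rightarrow> nat) \<Rightarrow> (nat \<Rightarrow> nat) \<Rightarrow> (nat \<times> nat, 'k::comm_ring_1) mpoly" where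
  "pminor j \<alpha> \<beta> = minor j (\<lambda>a b. mp_var (a, b)) \<alpha> \<beta>"

lemma mp_vars_pminor:
  assumes "\<alpha> \<in> {0..<j} \<rightarrow> A" "\<beta> \<in> {0..<j} \<rightarrow> B"
  shows "mp_vars (pminor j \<alpha> \<beta>) \<subseteq> A \<times> B"
proof -
  interpret subring_ideal "carrier (mp_ring (A \<times> B))" "{0}" by (rule mp_ring_subring)
  have "pminor j \<alpha> \<beta> \<in> carrier (mp_ring (A \<times> B))"
    unfolding pminor_def using assms by (intro minor_S) (auto simp: carrier_mp_ring mp_vars_var Pi_iff)
  then show ?thesis by (simp add: carrier_mp_ring)
qed

lemma minor_permute_rows:
  assumes "\<pi> permutes {0..<j}"
  shows "minor j M (\<alpha> \<circ> \<pi>) \<beta> = signof \<pi> * minor j M \<alpha> \<beta>"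
proof -
  have "mat j j (\<lambda>(a, b). M ((\<alpha> \<circ> \<pi>) a) (\<beta> b)) =
      mat j j (\<lambda>(a, b). mat j j (\<lambda>(a, b). M (\<alpha> a) (\<beta> b)) $$ (\<pi> a, b))"
    using permutes_in_image[OF assms] by (intro eq_matI) auto
  then show ?thesis unfolding minor_def by (simp add: det_permute_rows[OF _ assms])
qed

lemma minor_permute_cols:
  assumes "\<pi> permutes {0..<j}"
  shows "minor j M \<alpha> (\<beta> \<circ> \<pi>) = signof \<pi> * minor j M \<alpha> \<beta>"
  using minor_permute_rows[OF assms, of "\<lambda>a b. M b a" \<beta> \<alpha>] unfolding minor_transpose[of j M] .

text \<open>The permutation sends \<open>a\<close> to the rank of \<open>\<alpha> a\<close> in the
  image of \<alpha>.\<close>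

lemma inj_eq_pick_comp:
  assumes "inj_on \<alpha> {0..<j}"
  obtains \<pi> where "\<pi> permutes {0..<j}" "\<And>a. a < j \<Longrightarrow> \<alpha> a = pick (\<alpha> ` {0..<j}) (\<pi> a)"
proof -
  let ?A = "\<alpha> ` {0..<j}"
  define \<pi> where "\<pi> a = (if a < j then card {x \<in> ?A. x < \<alpha> a} else a)" for a
  have eq: "\<alpha> a = pick ?A (\<pi> a)" if "a < j" for a
    using that pick_card_in_set[of "\<alpha> a" ?A] by (simp add: \<pi>_def)
  have "\<pi> ` {0..<j} \<subseteq> {0..<j}"
  proof clarsimp
    fix a assume a: "a < j"
    then have "{x \<in> ?A. x < \<alpha> a} \<subset> ?A" by auto
    then have "card {x \<in> ?A. x < \<alpha> a} < card ?A" by (intro psubset_card_mono) auto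
    then show "\<pi> a < j" using a assms by (simp add: \<pi>_def card_image)
  qed
  moreover have "inj_on \<pi> {0..<j}"
    using assms eq by (auto simp: inj_on_def)
  ultimately have "bij_betw \<pi> {0..<j} {0..<j}"
    by (simp add: bij_betw_def endo_inj_surj)
  then have "\<pi> permutes {0..<j}"
    by (rule bij_imp_permutes) (simp add: \<pi>_def)
  with eq that show ?thesis by blast
qed

text \<open>A repeated index makes a minor 0, and sorting the indices changes only its sign. This
  links minors given by maps with the submatrices that generate the determinantal ideal.\<close>

lemma minor_mem_if_sorted:
  assumes "subring_ideal S J"
    and "\<And>A B. A \<subseteq> {0..<m} \<Longrightarrow> B \<subseteq> {0..<m} \<Longrightarrow> card A = j \<Longrightarrow> card B = j \<Longrightarrow>
      minor j M (pick A) (pick B) \<in> J"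
    and "\<alpha> \<in> {0..<j} \<rightarrow> {0..<m}" "\<beta> \<in> {0..<j} \<rightarrow> {0..<m}"
  shows "minor j M \<alpha> \<beta> \<in> J"
proof -
  interpret subring_ideal S J by fact
  consider "\<not> inj_on \<alpha> {0..<j}" | "\<not> inj_on \<beta> {0..<j}" | "inj_on \<alpha> {0..<j}" "inj_on \<beta> {0..<j}"
    by blast
  then show ?thesis
  proof cases
    case 1
    then obtain a b where "a \<noteq> b" "a < j" "b < j" "\<alpha> a = \<alpha> b" by (auto simp: inj_on_def)
    then show ?thesis by (simp add: minor_eq_0_row zero_J)
  next
    case 2
    then obtain a b where "a \<noteq> b" "a < j" "b < j" "\<beta> a = \<beta> b" by (auto simp: inj_on_def)
    then show ?thesis by (simp add: minor_eq_0_col zero_J)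
  next
    case 3
    let ?A = "\<alpha> ` {0..<j}" and ?B = "\<beta> ` {0..<j}"
    obtain \<pi> where \<pi>: "\<pi> permutes {0..<j}" "\<And>a. a < j \<Longrightarrow> \<alpha> a = pick ?A (\<pi> a)"
      by (rule inj_eq_pick_comp[OF 3(1)]) auto
    obtain \<sigma> where \<sigma>: "\<sigma> permutes {0..<j}" "\<And>a. a < j \<Longrightarrow> \<beta> a = pick ?B (\<sigma> a)"
      by (rule inj_eq_pick_comp[OF 3(2)]) auto
    have "minor j M \<alpha> \<beta> = minor j M (pick ?A \<circ> \<pi>) (pick ?B \<circ> \<sigma>)"
      by (rule minor_cong) (use \<pi> \<sigma> in auto)
    also have "\<dots> = signof \<pi> * (signof \<sigma> * minor j M (pick ?A) (pick ?B))"
      by (simp add: minor_permute_rows[OF \<pi>(1)] minor_permute_cols[OF \<sigma>(1)] mult.left_commute)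
    also have "\<dots> \<in> J"
      using assms(3,4) 3 by (intro mult_J signof_S assms(2)) (auto simp: card_image)
    finally show ?thesis .
  qed
qed

lemma det_submatrix:
  assumes "A \<subseteq> {0..<m}" "B \<subseteq> {0..<m}" "card A = p" "card B = p"
  shows "Determinant.det (submatrix (mat m m mp_var) A B) =
    (pminor p (pick A) (pick B) :: (nat \<times> nat, 'k::comm_ring_1) mpoly)"
proof -
  have A: "{i. i < m \<and> i \<in> A} = A" "{i. i < m \<and> i \<in> B} = B" using assms by auto
  have pick: "pick A i < m" "pick B i < m" if "i < p" for i
    using pick_in_set_le[of i A] pick_in_set_le[of i B] assms that by auto
  have "submatrix (mat m m mp_var) A B =
      (mat p p (\<lambda>(a, b). mp_var (pick A a, pick B b)) :: (nat \<times> nat, 'k) mpoly mat)"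
    unfolding submatrix_def using assms pick by (intro eq_matI) (auto simp: A)
  then show ?thesis by (simp add: pminor_def minor_def)
qed

text \<open>The least-ideal property asks only for injective \<open>\<alpha>\<close>, because the
  generators have sorted rows; the derivative of a minor is computed under that condition.\<close>

lemma minors_ideal_subring_ideal:
  "subring_ideal (carrier (mp_ring (mat_coords m))) (minors_ideal m p :: (nat \<times> nat, 'k::comm_ring_1) mpoly set)"
  and pminor_in_minors_ideal: "\<alpha> \<in> {0..<p} \<rightarrow> {0..<m} \<Longrightarrow> \<beta> \<in> {0..<p} \<rightarrow> {0..<m} \<Longrightarrow>
      pminor p \<alpha> \<beta> \<in> (minors_ideal m p :: (nat \<times> nat, 'k) mpoly set)"
  and minors_ideal_least: "subring_ideal (carrier (mp_ring (mat_coords m))) I \<Longrightarrow>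
      (\<And>\<alpha> \<beta>. \<alpha> \<in> {0..<p} \<rightarrow> {0..<m} \<Longrightarrow> \<beta> \<in> {0..<p} \<rightarrow> {0..<m} \<Longrightarrow> inj_on \<alpha> {0..<p} \<Longrightarrow> pminor p \<alpha> \<beta> \<in> I) \<Longrightarrow>
      minors_ideal m p \<subseteq> (I :: (nat \<times> nat, 'k) mpoly set)"
proof -
  interpret R: cring "mp_ring (mat_coords m) :: (nat \<times> nat, 'k) mpoly ring" by (rule mp_ring_cring)
  let ?gens = "{Determinant.det (submatrix (mat m m mp_var) A B) :: (nat \<times> nat, 'k) mpoly | A B.
        A \<subseteq> {..<m} \<and> B \<subseteq> {..<m} \<and> card A = p \<and> card B = p}"
  have pick: "pick A \<in> {0..<p} \<rightarrow> {0..<m}" "inj_on (pick A) {0..<p}" if "A \<subseteq> {..<m}" "card A = p" for A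
  proof -
    show "pick A \<in> {0..<p} \<rightarrow> {0..<m}"
    proof
      fix a assume "a \<in> {0..<p}"
      then have "pick A a \<in> A" using that by (intro pick_in_set_le) auto
      then show "pick A a \<in> {0..<m}" using that by auto
    qed
    show "inj_on (pick A) {0..<p}"
      using that by (intro linorder_inj_onI) (auto dest: pick_mono_le[of _ A])
  qed
  have eq: "?gens = {pminor p (pick A) (pick B) | A B. A \<subseteq> {..<m} \<and> B \<subseteq> {..<m} \<and> card A = p \<and> card B = p}"
    using det_submatrix[where 'k = 'k and m = m and p = p] unfolding lessThan_atLeast0 by (intro Collect_cong) metis
  have gens: "?gens \<subseteq> carrier (mp_ring (mat_coords m))"
    unfolding eq
  proof clarsimp
    fix A B assume "A \<subseteq> {..<m}" "B \<subseteq> {..<m}" "p = card A" "card B = card A"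
    then show "pminor (card A) (pick A) (pick B) \<in> carrier (mp_ring (mat_coords m))"
      unfolding carrier_mp_ring by (intro mp_vars_pminor) (use pick in \<open>auto simp: lessThan_atLeast0\<close>)
  qed
  show ideal: "subring_ideal (carrier (mp_ring (mat_coords m))) (minors_ideal m p :: (nat \<times> nat, 'k) mpoly set)"
    unfolding minors_ideal_def ideal_iff[symmetric] by (rule R.genideal_ideal[OF gens])
  show "pminor p \<alpha> \<beta> \<in> (minors_ideal m p :: (nat \<times> nat, 'k) mpoly set)"
    if "\<alpha> \<in> {0..<p} \<rightarrow> {0..<m}" "\<beta> \<in> {0..<p} \<rightarrow> {0..<m}" for \<alpha> \<beta>
    unfolding pminor_def
  proof (rule minor_mem_if_sorted[OF ideal _ that])
    fix A B assume "A \<subseteq> {0..<m}" "B \<subseteq> {0..<m}" "card A = p" "card B = p"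
    then have "pminor p (pick A) (pick B) \<in> ?gens" unfolding eq by (auto simp: lessThan_atLeast0)
    then show "minor p (\<lambda>a b. mp_var (a, b)) (pick A) (pick B) \<in> (minors_ideal m p :: (nat \<times> nat, 'k) mpoly set)"
      unfolding minors_ideal_def pminor_def[symmetric] using R.genideal_self[OF gens] by blast
  qed
  show "minors_ideal m p \<subseteq> I" if "subring_ideal (carrier (mp_ring (mat_coords m))) I"
    "\<And>\<alpha> \<beta>. \<alpha> \<in> {0..<p} \<rightarrow> {0..<m} \<Longrightarrow> \<beta> \<in> {0..<p} \<rightarrow> {0..<m} \<Longrightarrow> inj_on \<alpha> {0..<p} \<Longrightarrow> pminor p \<alpha> \<beta> \<in> I"
    for I :: "(nat \<times> nat, 'k) mpoly set"
    unfolding minors_ideal_def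
  proof (rule R.genideal_minimal)
    show "ideal I (mp_ring (mat_coords m))" using that by (simp add: ideal_iff)
    show "?gens \<subseteq> I" unfolding eq using that(2) pick by blast
  qed
qed

lemma minors_ideal_vars: "f \<in> minors_ideal m p \<Longrightarrow> mp_vars f \<subseteq> mat_coords m"
  using subring_ideal.J_S[OF minors_ideal_subring_ideal] by (auto simp: carrier_mp_ring)

text \<open>The series whose coefficient of \<open>t^s\<close> involves only variables of index at
  most \<open>s\<close>, for all \<open>s\<close>, form a ring that contains the generic arc and the
  constants.\<close>

lemma mp_vars_jet_coeff:
  assumes "mp_vars f \<subseteq> (V :: 'v set)"
  shows "mp_vars (jet_coeff s (f :: ('v, 'k::comm_ring_1) mpoly)) \<subseteq> V \<times> {..s}"
proof -
  let ?T = "{F :: ('v \<times> nat, 'k) mpoly fps. \<forall>s. mp_vars (fps_nth F s) \<subseteq> V \<times> {..s}}"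
  have mult: "a * b \<in> ?T" if ab: "a \<in> ?T" "b \<in> ?T" for a b
  proof clarsimp
    fix s x r assume x: "(x, r) \<in> mp_vars (fps_nth (a * b) s)"
    interpret subring_ideal "carrier (mp_ring (V \<times> {..s}))" "{0 :: ('v \<times> nat, 'k) mpoly}" by (rule mp_ring_subring)
    have "fps_nth a i * fps_nth b (s - i) \<in> carrier (mp_ring (V \<times> {..s}))" if "i \<in> {0..s}" for i
    proof (rule mult_S)
      have "mp_vars (fps_nth a i) \<subseteq> V \<times> {..i}" "mp_vars (fps_nth b (s - i)) \<subseteq> V \<times> {..s - i}" using ab by auto
      moreover have "V \<times> {..i} \<subseteq> V \<times> {..s}" "V \<times> {..s - i} \<subseteq> V \<times> {..s}" using that by auto
      ultimately show "fps_nth a i \<in> carrier (mp_ring (V \<times> {..s}))" "fps_nth b (s - i) \<in> carrier (mp_ring (V \<times> {..s}))"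
        unfolding carrier_mp_ring by blast+
    qed
    then have "fps_nth (a * b) s \<in> carrier (mp_ring (V \<times> {..s}))" unfolding fps_mult_nth by (rule sum_S)
    then show "x \<in> V \<and> r \<le> s" using x by (auto simp: carrier_mp_ring)
  qed
  have z: "mp_vars (0 :: ('v \<times> nat, 'k) mpoly) = {}" by (simp add: mp_vars_def)
  interpret subring_ideal ?T "{0}"
  proof
    show "1 \<in> ?T" by (auto simp: fps_one_nth mp_vars_def)
    show "a * b \<in> ?T" if "a \<in> ?T" "b \<in> ?T" for a b using mult that by blast
    show "a + b \<in> ?T" if "a \<in> ?T" "b \<in> ?T" for a b using that by (simp add: mp_vars_add)
    show "- a \<in> ?T" if "a \<in> ?T" for a using that by (simp add: mp_vars_uminus)
  qed (auto simp: z)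
  have "mp_eval (\<lambda>c. fps_const (mp_const c)) generic_arc f \<in> ?T"
    using assms
    by (intro mp_eval_S) (auto simp: fps_nth_fps_const mp_vars_const z generic_arc_def mp_vars_var split: if_splits)
  then show ?thesis by (simp add: jet_coeff_def)
qed

section \<open>Orbits as sets of points\<close>

lemma jet_ring_infinity: "jet_ring V \<infinity> = mp_ring (V \<times> UNIV)"
  by (simp add: jet_ring_def)

lemma jet_ring_enat: "jet_ring V (enat l) = mp_ring (V \<times> {..l})"
  by (simp add: jet_ring_def atMost_def)

definition marc :: "((nat \<times> nat) \<times> nat \<Rightarrow> 'b) \<Rightarrow> nat \<Rightarrow> nat \<Rightarrow> 'b fps" where
  "marc z i j = arc_of z (i, j)"

lemma marc_nth [simp]: "fps_nth (marc z i j) s = z ((i, j), s)"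
  by (simp add: marc_def)

lemma mp_eval_pminor:
  assumes "comm_ring_hom h"
  shows "mp_eval h x (pminor j \<alpha> \<beta>) = minor j (\<lambda>a b. x (a, b)) \<alpha> \<beta>"
  unfolding pminor_def by (simp add: hom_minor[OF mp_eval_hom[OF assms]] mp_eval_var[OF assms])

definition arc_eval :: "('k::comm_ring_1 \<Rightarrow> 'b::comm_ring_1) \<Rightarrow> ('v \<times> nat \<Rightarrow> 'b) \<Rightarrow> ('v, 'k) mpoly \<Rightarrow> 'b fps" where
  "arc_eval h z = mp_eval (fps_const \<circ> h) (arc_of z)"

lemma fps_const_comp_hom: "comm_ring_hom h \<Longrightarrow> comm_ring_hom (fps_const \<circ> h)"
  by (rule comm_ring_hom_comp[OF fps_const_hom])

lemma arc_eval_hom: "comm_ring_hom h \<Longrightarrow> comm_ring_hom (arc_eval h z)"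
  unfolding arc_eval_def by (rule mp_eval_hom[OF fps_const_comp_hom])

lemma arc_eval_pminor: "comm_ring_hom h \<Longrightarrow> arc_eval h z (pminor j \<alpha> \<beta>) = minor j (marc z) \<alpha> \<beta>"
  unfolding arc_eval_def by (simp add: mp_eval_pminor[OF fps_const_comp_hom] marc_def[abs_def])

lemma jet_coeff_in_pt:
  assumes "comm_ring_hom h" "mp_vars f \<subseteq> V" "\<And>r. r \<le> s \<Longrightarrow> enat r \<le> l"
  shows "jet_coeff s f \<in> pt h z J (V \<times> {s. enat s \<le> l}) \<longleftrightarrow> fps_nth (arc_eval h z f) s \<in> J"
proof -
  have "jet_coeff s f \<in> carrier (mp_ring (V \<times> {s. enat s \<le> l}))"
    using mp_vars_jet_coeff[OF assms(2), of s] assms(3) by (fastforce simp: carrier_mp_ring)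
  then show ?thesis by (simp add: pt_def mp_eval_jet_coeff[OF assms(1)] arc_eval_def)
qed

lemma jet_coeff_in_pt_infinity:
  assumes "comm_ring_hom h" "mp_vars f \<subseteq> V"
  shows "jet_coeff s f \<in> pt h z J (V \<times> UNIV) \<longleftrightarrow> fps_nth (arc_eval h z f) s \<in> J"
  using jet_coeff_in_pt[OF assms, of s \<infinity>] by simp

lemma minor_marc_var:
  "fps_nth (minor j (marc mp_var) \<alpha> \<beta>) s = (jet_coeff s (pminor j \<alpha> \<beta>) :: (_, 'k::comm_ring_1) mpoly)"
  using mp_eval_jet_coeff[OF mp_const_hom, of mp_var s "pminor j \<alpha> \<beta> :: (_, 'k) mpoly"]
  by (simp flip: arc_eval_def add: arc_eval_pminor[OF mp_const_hom])

text \<open>Conditions on the universal arc modulo a point can thus be read on any arc that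
  represents the point.\<close>

lemma minors_ge_pt:
  fixes h :: "'k::comm_ring_1 \<Rightarrow> 'b::comm_ring_1"
  assumes "comm_ring_hom h"
  shows "minors_ge (pt h z J (mat_coords m \<times> UNIV)) m (marc mp_var) j e \<longleftrightarrow> minors_ge J m (marc z) j e"
proof -
  have "fps_nth (minor j (marc mp_var) \<alpha> \<beta>) s \<in> pt h z J (mat_coords m \<times> UNIV) \<longleftrightarrow>
      fps_nth (minor j (marc z) \<alpha> \<beta>) s \<in> J"
    if "\<alpha> \<in> {0..<j} \<rightarrow> {0..<m}" "\<beta> \<in> {0..<j} \<rightarrow> {0..<m}" for \<alpha> \<beta> s
  proof -
    have "mp_vars (pminor j \<alpha> \<beta> :: (_, 'k) mpoly) \<subseteq> mat_coords m"
      using mp_vars_pminor[OF that] by (simp add: lessThan_atLeast0)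
    then show ?thesis
      by (simp add: minor_marc_var jet_coeff_in_pt_infinity[OF assms] arc_eval_pminor[OF assms])
  qed
  then show ?thesis by (auto simp: minors_ge_def fps_below_def)
qed

context subring_ideal
begin

lemma arc_eval_over:
  assumes "\<And>c. h c \<in> S" "\<And>v s. v \<in> V \<Longrightarrow> z (v, s) \<in> S" "mp_vars f \<subseteq> V"
  shows "arc_eval h z f \<in> fps_over S"
proof -
  interpret F: subring_ideal "fps_over S" "fps_over S \<inter> fps_below J \<infinity>" by (rule fps_subring_ideal)
  show ?thesis unfolding arc_eval_def
    using assms by (intro F.mp_eval_S) (auto simp: fps_over_def zero_S subset_iff)
qed

text \<open>A preimage of an ideal under a ring map. It reduces conditions on the whole
  determinantal or Jacobian ideal to generators.\<close>

lemma arc_eval_vimage_ideal: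
  assumes h: "comm_ring_hom h" "\<And>c. h c \<in> S" and z: "\<And>v s. v \<in> V \<Longrightarrow> z (v, s) \<in> S"
  shows "subring_ideal (carrier (mp_ring V)) {f \<in> carrier (mp_ring V). arc_eval h z f \<in> fps_below J e}"
proof -
  interpret F: subring_ideal "fps_over S" "fps_over S \<inter> fps_below J e" by (rule fps_subring_ideal)
  interpret M: subring_ideal "carrier (mp_ring V)" "{0}" by (rule mp_ring_subring)
  interpret e: comm_ring_hom "arc_eval h z" by (rule arc_eval_hom[OF h(1)])
  have S: "arc_eval h z f \<in> fps_over S" if "f \<in> carrier (mp_ring V)" for f
    using h z that by (intro arc_eval_over) (auto simp: carrier_mp_ring)
  show ?thesis
  proof
    fix a b
    show "a * b \<in> {f \<in> carrier (mp_ring V). arc_eval h z f \<in> fps_below J e}"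
      if "a \<in> carrier (mp_ring V)" "b \<in> {f \<in> carrier (mp_ring V). arc_eval h z f \<in> fps_below J e}"
      using that F.mult_J[OF S, of a "arc_eval h z b"] S[of b] by (auto simp: M.mult_S e.hom_mult)
    show "a + b \<in> {f \<in> carrier (mp_ring V). arc_eval h z f \<in> fps_below J e}"
      if "a \<in> {f \<in> carrier (mp_ring V). arc_eval h z f \<in> fps_below J e}"
        "b \<in> {f \<in> carrier (mp_ring V). arc_eval h z f \<in> fps_below J e}"
      using that F.add_J[of "arc_eval h z a" "arc_eval h z b"] S[of a] S[of b]
      by (auto simp: M.add_S e.hom_add)
    show "0 \<in> {f \<in> carrier (mp_ring V). arc_eval h z f \<in> fps_below J e}"
      using F.zero_J by (simp add: M.zero_S)
  qed (auto intro: M.one_S M.add_S M.mult_S M.uminus_S)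
qed

end

lemma (in subring_ideal) minors_ideal_below_iff:
  assumes h: "comm_ring_hom h" "\<And>c. h c \<in> S" and z: "\<And>v s. v \<in> mat_coords m \<Longrightarrow> z (v, s) \<in> S"
  shows "(\<forall>f\<in>minors_ideal m p. arc_eval h z f \<in> fps_below J e) \<longleftrightarrow> minors_ge J m (marc z) p e"
proof
  assume "\<forall>f\<in>minors_ideal m p. arc_eval h z f \<in> fps_below J e"
  then show "minors_ge J m (marc z) p e"
    unfolding minors_ge_def using pminor_in_minors_ideal by (metis arc_eval_pminor[OF h(1)])
next
  assume ge: "minors_ge J m (marc z) p e"
  have "minors_ideal m p \<subseteq> {f \<in> carrier (mp_ring (mat_coords m)). arc_eval h z f \<in> fps_below J e}"
  proof (rule minors_ideal_least)
    show "subring_ideal (carrier (mp_ring (mat_coords m)))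
        {f \<in> carrier (mp_ring (mat_coords m)). arc_eval h z f \<in> fps_below J e}"
      using h z by (intro arc_eval_vimage_ideal)
    fix \<alpha> \<beta> assume a: "\<alpha> \<in> {0..<p} \<rightarrow> {0..<m}" "\<beta> \<in> {0..<p} \<rightarrow> {0..<m}"
    then show "pminor p \<alpha> \<beta> \<in> {f \<in> carrier (mp_ring (mat_coords m)). arc_eval h z f \<in> fps_below J e}"
      using ge mp_vars_pminor[OF a]
      by (simp add: minors_ge_def arc_eval_pminor[OF h(1)] carrier_mp_ring lessThan_atLeast0)
  qed
  then show "\<forall>f\<in>minors_ideal m p. arc_eval h z f \<in> fps_below J e" by blast
qed

lemma (in subring_prime) pt_in_D_arcs_iff:
  fixes h :: "'k::field \<Rightarrow> 'a"
  assumes h: "comm_ring_hom h" "\<And>c. h c \<in> S" and z: "\<And>v s. v \<in> mat_coords m \<Longrightarrow> z (v, s) \<in> S"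
  shows "pt h z J (mat_coords m \<times> UNIV) \<in> D_arcs m k \<longleftrightarrow> minors_ge J m (marc z) (Suc k) \<infinity>"
proof -
  have "pt h z J (mat_coords m \<times> UNIV) \<in> Spec (mp_ring (mat_coords m \<times> UNIV))"
    using z by (intro pt_Spec h) auto
  then have "pt h z J (mat_coords m \<times> UNIV) \<in> D_arcs m k \<longleftrightarrow>
      (\<forall>f\<in>minors_ideal m (Suc k). arc_eval h z f \<in> fps_below J \<infinity>)"
    by (simp add: D_arcs_def jets_def jet_ring_infinity jet_coeff_in_pt_infinity[OF h(1)] minors_ideal_vars
        fps_below_def cong: ball_cong)
  then show ?thesis using minors_ideal_below_iff[of h m z "Suc k" \<infinity>] h z by simp
qed

lemma minor_eq_0_large:
  assumes "m < j" "\<alpha> \<in> {0..<j} \<rightarrow> {0..<m}"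
  shows "minor j M \<alpha> \<beta> = 0"
proof -
  have "\<not> inj_on \<alpha> {0..<j}"
    using assms card_inj_on_le[of \<alpha> "{0..<j}" "{0..<m}"] by auto
  then show ?thesis by (auto simp: inj_on_def intro: minor_eq_0_row)
qed

abbreviation garc where "garc z \<equiv> (\<lambda>i p. arc_of z (Inl (i, p)))"
abbreviation harc where "harc z \<equiv> (\<lambda>p j. arc_of z (Inr (p, j)))"

abbreviation GG_vars :: "nat \<Rightarrow> (((nat \<times> nat) + (nat \<times> nat)) \<times> nat) set" where
  "GG_vars m \<equiv> (mat_coords m <+> mat_coords m) \<times> UNIV"

lemma gdh_hom:
  assumes "comm_ring_hom f"
  shows "fps_map f (gdh m G \<mu> H i l) = gdh m (\<lambda>i p. fps_map f (G i p)) \<mu> (\<lambda>p l. fps_map f (H p l)) i l"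
proof -
  interpret f: comm_ring_hom f by fact
  interpret F: comm_ring_hom "fps_map f" by (rule fps_map_hom[OF assms])
  have "fps_map f (tpow a) = tpow a" for a by (simp add: fps_eq_iff tpow_nth)
  then show ?thesis by (simp add: gdh_def F.hom_sum F.hom_mult)
qed

lemma orbit_arc_eq_gdh:
  assumes "i < m" "j < m"
  shows "orbit_arc m (mat m m (\<lambda>(i, j). if i = j then t_power (lam (Suc i)) else 0)) $$ (i, j) =
    gdh m (garc mp_var) (\<lambda>p. lam (Suc p)) (harc (mp_var :: _ \<Rightarrow> 'k::field GG_poly)) i j"
proof -
  let ?c = "\<lambda>a. Abs_fps (\<lambda>s. mp_const (fps_nth a s) :: 'k GG_poly)"
  have c0: "Abs_fps (\<lambda>s. mp_const 0 :: 'k GG_poly) = 0" by (simp add: fps_eq_iff mp_const_def)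
  have ct: "?c (t_power a) = tpow a" for a
    by (cases a) (auto simp: t_power_def tpow_def fps_eq_iff mp_const_def fps_X_power_nth)
  have g: "generic_arc = arc_of mp_var" by (rule ext) (simp add: generic_arc_def arc_of_def)
  show ?thesis
    unfolding orbit_arc_def using assms
    by (simp add: scalar_prod_def gdh_def c0 ct g if_distrib[of ?c] mult.assoc cong: if_cong
        , simp add: if_distrib[of "\<lambda>x. _ * x"] if_distrib[of "\<lambda>x. x * _"] mult.assoc cong: if_cong)
qed

definition orbit_pt :: "nat \<Rightarrow> (nat \<Rightarrow> enat) \<Rightarrow> (((nat \<times> nat) + (nat \<times> nat)) \<times> nat \<Rightarrow> 'b::comm_ring_1) \<Rightarrow>
    (nat \<times> nat) \<times> nat \<Rightarrow> 'b" where
  "orbit_pt m \<mu> zz = (\<lambda>((i, j), s). fps_nth (gdh m (garc zz) \<mu> (harc zz) i j) s)"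

lemma marc_orbit_pt: "marc (orbit_pt m \<mu> zz) = gdh m (garc zz) \<mu> (harc zz)"
  by (intro ext) (simp add: fps_eq_iff orbit_pt_def)

lemma (in subring_ideal) orbit_pt_S:
  assumes "\<And>v. v \<in> GG_vars m \<Longrightarrow> zz v \<in> S" "ij \<in> mat_coords m"
  shows "orbit_pt m \<mu> zz (ij, s) \<in> S"
proof -
  interpret F: subring_ideal "fps_over S" "fps_over S \<inter> fps_below J \<infinity>" by (rule fps_subring_ideal)
  have "gdh m (garc zz) \<mu> (harc zz) (fst ij) (snd ij) \<in> fps_over S"
    unfolding gdh_def
    by (intro F.sum_S F.mult_S; use assms in \<open>auto simp: fps_over_def tpow_nth zero_S one_S Plus_def\<close>)
  then show ?thesis by (simp add: orbit_pt_def fps_over_def case_prod_beta)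
qed

text \<open>The coordinates of the product are polynomials with integer coefficients in those of
  \<open>g\<close> and \<open>h\<close>.\<close>

lemma orbit_pt_hom:
  assumes "comm_ring_hom h"
  shows "mp_eval h zz (orbit_pt m \<mu> mp_var v) = orbit_pt m \<mu> zz v"
proof -
  have e: "comm_ring_hom (mp_eval h zz)" by (rule mp_eval_hom[OF assms])
  have "fps_map (mp_eval h zz) (arc_of mp_var v) = arc_of zz v" for v
    by (simp add: fps_eq_iff mp_eval_var[OF assms])
  then show ?thesis
    by (cases v) (auto simp: orbit_pt_def gdh_hom[OF e] simp flip: fps_map_nth[of "mp_eval h zz"])
qed

lemma orbit_comap_eq:
  assumes "p \<in> carrier (jet_ring (mat_coords m) \<infinity>)"
  shows "orbit_comap m (mat m m (\<lambda>(i, j). if i = j then t_power (lam (Suc i)) else 0)) p =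
    mp_eval mp_const (orbit_pt m (\<lambda>p. lam (Suc p)) mp_var) (p :: (_, 'k::field) mpoly)"
proof -
  let ?A = "mat m m (\<lambda>(i, j). if i = j then t_power (lam (Suc i)) else 0) :: 'k fps mat"
  let ?x = "\<lambda>(ij, s). fps_nth (orbit_arc m ?A $$ ij) s"
  interpret M: subring_ideal UNIV "{0 :: 'k GG_poly}" by standard auto
  have "?x v - orbit_pt m (\<lambda>p. lam (Suc p)) mp_var v \<in> {0}" if "v \<in> mp_vars p" for v
  proof -
    obtain i j s where v: "v = ((i, j), s)" by (cases v) auto
    then have "i < m" "j < m" using that assms by (auto simp: jet_ring_infinity carrier_mp_ring)
    then show ?thesis by (simp add: v orbit_pt_def orbit_arc_eq_gdh)
  qed
  then have "mp_eval mp_const ?x p - mp_eval mp_const (orbit_pt m (\<lambda>p. lam (Suc p)) mp_var) p \<in> {0}"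
    by (intro M.cong_mp_eval) auto
  then show ?thesis by (simp add: orbit_comap_def)
qed

lemma minor_const_coeff: "fps_nth (minor m G id id) 0 = minor m (\<lambda>i j. fps_nth (G i j) 0) id id"
  by (rule hom_minor[OF fps_nth_0_hom])

lemma GG_arcs_iff:
  "Q \<in> GG_arcs m \<longleftrightarrow> Q \<in> Spec (mp_ring (GG_vars m)) \<and>
    unit_det Q m (garc mp_var) \<and> unit_det Q m (harc (mp_var :: _ \<Rightarrow> 'k::field GG_poly))"
proof -
  have "Determinant.det (mat m m (\<lambda>ij. mp_var (f ij, 0) :: 'k GG_poly)) = minor m (\<lambda>i j. mp_var (f (i, j), 0)) id id"
    for f :: "nat \<times> nat \<Rightarrow> (nat \<times> nat) + (nat \<times> nat)"
    unfolding minor_def by (intro arg_cong[where f = Determinant.det] cong_mat) auto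
  then show ?thesis
    by (auto simp: GG_arcs_def jet_ring_infinity unit_det_def minor_const_coeff)
qed

lemma C_orbit_eq:
  "(C_orbit m lam :: 'k::field mat_jet set) =
    (\<lambda>Q. pt mp_const (orbit_pt m (\<lambda>p. lam (Suc p)) mp_var) Q (mat_coords m \<times> UNIV)) ` GG_arcs m"
  unfolding C_orbit_def arc_orbit_def pt_def
  by (intro image_cong refl) (auto simp: orbit_comap_eq, auto simp: jet_ring_infinity orbit_comap_eq)

text \<open>\<open>zz\<close> gives a point of the group whose image under the orbit map is the
  point in question. Congruence of coordinates suffices, as a point sees them only modulo
  \<open>J\<close>.\<close>

lemma (in subring_prime) pt_in_C_orbit:
  fixes h :: "'k::field \<Rightarrow> 'a"
  assumes h: "comm_ring_hom h" "\<And>c. h c \<in> S" and zz: "\<And>v. v \<in> GG_vars m \<Longrightarrow> zz v \<in> S"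
    and unit: "unit_det J m (garc zz)" "unit_det J m (harc zz)"
    and z: "\<And>ij s. ij \<in> mat_coords m \<Longrightarrow> z (ij, s) \<in> S"
      "\<And>ij s. ij \<in> mat_coords m \<Longrightarrow> z (ij, s) - orbit_pt m (\<lambda>p. lam (Suc p)) zz (ij, s) \<in> J"
  shows "pt h z J (mat_coords m \<times> UNIV) \<in> C_orbit m lam"
proof -
  let ?Q = "pt h zz J (GG_vars m)" and ?o = "orbit_pt m (\<lambda>p. lam (Suc p))"
  have Q: "?Q \<in> Spec (mp_ring (GG_vars m))" using zz by (intro pt_Spec h)
  have unit_iff: "unit_det ?Q m (\<lambda>i j. arc_of mp_var (f (i, j))) \<longleftrightarrow> unit_det J m (\<lambda>i j. arc_of zz (f (i, j)))"
    if f: "\<And>ij. ij \<in> mat_coords m \<Longrightarrow> f ij \<in> mat_coords m <+> mat_coords m" for f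
  proof -
    interpret G: subring_ideal "carrier (mp_ring (GG_vars m))" "{0 :: 'k GG_poly}" by (rule mp_ring_subring)
    have "minor m (\<lambda>i j. mp_var (f (i, j), 0) :: 'k GG_poly) id id \<in> carrier (mp_ring (GG_vars m))"
      using f by (intro G.minor_S) (auto simp: carrier_mp_ring mp_vars_var)
    then show ?thesis
      by (simp add: unit_det_def minor_const_coeff pt_def hom_minor[OF mp_eval_hom[OF h(1)]] mp_eval_var[OF h(1)])
  qed
  have "?Q \<in> GG_arcs m"
    using Q unit unit_iff[of Inl] unit_iff[of Inr] by (auto simp: GG_arcs_iff)
  moreover have "pt h z J (mat_coords m \<times> UNIV) = pt mp_const (?o mp_var) ?Q (mat_coords m \<times> UNIV)"
  proof -
    have "pt mp_const (?o mp_var) ?Q (mat_coords m \<times> UNIV) = pt h (?o zz) J (mat_coords m \<times> UNIV)"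
    proof -
      interpret G: subring_ideal "carrier (mp_ring (GG_vars m))" "{0 :: 'k GG_poly}" by (rule mp_ring_subring)
      have "mp_vars (?o mp_var v :: 'k GG_poly) \<subseteq> GG_vars m" if "v \<in> mat_coords m \<times> UNIV" for v
        using G.orbit_pt_S[of m "mp_var :: _ \<Rightarrow> 'k GG_poly" "fst v" "\<lambda>p. lam (Suc p)" "snd v"] that
        by (auto simp: carrier_mp_ring mp_vars_var)
      then show ?thesis
        using pt_comp[OF h(1), of "mat_coords m \<times> UNIV" "?o mp_var" "GG_vars m" zz J]
        by (simp add: orbit_pt_hom[OF h(1)] pt_def[of mp_const "?o mp_var"])
    qed
    also have "\<dots> = pt h z J (mat_coords m \<times> UNIV)"
      using h z orbit_pt_S[OF zz] by (intro pt_cong[symmetric]) auto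
    finally show ?thesis by simp
  qed
  ultimately show ?thesis by (auto simp: C_orbit_eq)
qed

section \<open>Orders of minors as invariants of an orbit\<close>

text \<open>The hypotheses on the partition with positions counted from 0, so that
  \<open>\<mu> p\<close> stands for \<open>lam (Suc p)\<close>.\<close>

definition lam_ok :: "nat \<Rightarrow> nat \<Rightarrow> (nat \<Rightarrow> enat) \<Rightarrow> bool" where
  "lam_ok m k \<mu> \<longleftrightarrow> antitone m \<mu> \<and> k \<le> m \<and> (\<forall>p<m - k. \<mu> p = \<infinity>) \<and> (\<forall>p. m - k \<le> p \<longrightarrow> p < m \<longrightarrow> \<mu> p \<noteq> \<infinity>)"

lemma sum_enat_neq_infinity: "(\<And>a. a \<in> A \<Longrightarrow> f a \<noteq> (\<infinity> :: enat)) \<Longrightarrow> sum f A \<noteq> \<infinity>"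
  by (induction A rule: infinite_finite_induct) (auto simp: plus_eq_infty_iff_enat)

lemma tail_sum_finite: "lam_ok m k \<mu> \<Longrightarrow> j \<le> k \<Longrightarrow> tail_sum m \<mu> j \<noteq> \<infinity>"
  unfolding tail_sum_def by (rule sum_enat_neq_infinity) (auto simp: lam_ok_def)

text \<open>For \<open>j \<le> k\<close> the least order of a \<open>j\<close>-minor is exactly the
  tail sum, a condition on finitely many coefficients if that sum is finite. The first conjunct,
  with infinitely many, holds on all of \<open>D_arcs m k\<close>.\<close>

definition inv_cond :: "'b set \<Rightarrow> nat \<Rightarrow> nat \<Rightarrow> (nat \<Rightarrow> enat) \<Rightarrow> (nat \<Rightarrow> nat \<Rightarrow> 'b::comm_ring_1 fps) \<Rightarrow> bool" where
  "inv_cond J m k \<mu> A \<longleftrightarrow> minors_ge J m A (Suc k) \<infinity> \<and>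
    (\<forall>j\<le>k. minors_ge J m A j (tail_sum m \<mu> j) \<and> \<not> minors_ge J m A j (tail_sum m \<mu> j + 1))"

lemma enat_add_1_not_le: "a \<noteq> \<infinity> \<Longrightarrow> \<not> a + 1 \<le> (a :: enat)"
  by (cases a) (auto simp: one_enat_def)

context subring_prime
begin

lemma inv_cond_gdh:
  assumes ok: "lam_ok m k \<mu>"
    and G: "\<And>i p. i < m \<Longrightarrow> p < m \<Longrightarrow> G i p \<in> fps_over S" "unit_det J m G"
    and H: "\<And>i p. i < m \<Longrightarrow> p < m \<Longrightarrow> H i p \<in> fps_over S" "unit_det J m H"
    and A: "\<And>i l. i < m \<Longrightarrow> l < m \<Longrightarrow> A i l \<in> fps_over S"
      "\<And>i l. i < m \<Longrightarrow> l < m \<Longrightarrow> A i l - gdh m G \<mu> H i l \<in> fps_below J \<infinity>"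
  shows "inv_cond J m k \<mu> A"
proof -
  have ge: "minors_ge J m A j e \<longleftrightarrow> e \<le> tail_sum m \<mu> j" if "j \<le> m" for j e
    using ok that by (intro minors_ge_gdh_iff[where G = G and H = H] G H A) (auto simp: lam_ok_def)
  have "minors_ge J m A (Suc k) \<infinity>"
  proof (cases "k < m")
    case True
    then have "tail_sum m \<mu> (Suc k) = \<infinity>"
      using ok tail_sum_Suc[of k m \<mu>] by (simp add: lam_ok_def)
    then show ?thesis using ge[of "Suc k"] True by simp
  next
    case False
    then have "m < Suc k" by simp
    then show ?thesis
      by (simp add: minors_ge_def minor_eq_0_large fps_below_def zero_J)
  qed
  then show ?thesis
    using ge ok tail_sum_finite[OF ok] enat_add_1_not_le by (simp add: inv_cond_def lam_ok_def)
qed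

text \<open>The tail sums of \<mu>' agree with those of \<mu> up to \<open>j = k\<close>; being
  finite, they can be cancelled, which recovers the last \<open>k\<close> exponents. The next tail
  sum is \<infinity>, and monotonicity propagates this to all smaller indices.\<close>

lemma inv_cond_unique:
  assumes ok: "lam_ok m k \<mu>" and \<mu>': "antitone m \<mu>'" and inv: "inv_cond J m k \<mu> A"
    and G: "\<And>i p. i < m \<Longrightarrow> p < m \<Longrightarrow> G i p \<in> fps_over S" "unit_det J m G"
    and H: "\<And>i p. i < m \<Longrightarrow> p < m \<Longrightarrow> H i p \<in> fps_over S" "unit_det J m H"
    and A: "\<And>i l. i < m \<Longrightarrow> l < m \<Longrightarrow> A i l \<in> fps_over S"
      "\<And>i l. i < m \<Longrightarrow> l < m \<Longrightarrow> A i l - gdh m G \<mu>' H i l \<in> fps_below J \<infinity>"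
    and p: "p < m"
  shows "\<mu>' p = \<mu> p"
proof -
  have km: "k \<le> m" using ok by (simp add: lam_ok_def)
  have ge: "minors_ge J m A j e \<longleftrightarrow> e \<le> tail_sum m \<mu>' j" if "j \<le> m" for j e
    using that by (intro minors_ge_gdh_iff[where G = G and H = H] \<mu>' G H A)
  have eq: "tail_sum m \<mu>' j = tail_sum m \<mu> j" if jk: "j \<le> k" for j
  proof -
    obtain n where n: "tail_sum m \<mu> j = enat n" using tail_sum_finite[OF ok jk] by auto
    have "enat n \<le> tail_sum m \<mu>' j" "\<not> enat n + 1 \<le> tail_sum m \<mu>' j"
      using inv jk km ge[of j] by (auto simp: inv_cond_def n)
    then show ?thesis unfolding n by (cases "tail_sum m \<mu>' j") (auto simp: one_enat_def)
  qed
  show ?thesis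
  proof (cases "m - k \<le> p")
    case True
    define j where "j = m - Suc p"
    have j: "Suc j \<le> k" "p = m - Suc j" "j < m" using True p by (auto simp: j_def)
    have "\<mu>' p + tail_sum m \<mu> j = \<mu> p + tail_sum m \<mu> j"
      using tail_sum_Suc[OF j(3), of \<mu>] tail_sum_Suc[OF j(3), of \<mu>'] eq[of j] eq[OF j(1)] j(1)
      unfolding j(2)[symmetric] by (metis Suc_leD)
    then show ?thesis using tail_sum_finite[OF ok, of j] j by auto
  next
    case False
    then have "k < m" by simp
    then have "\<infinity> \<le> tail_sum m \<mu>' (Suc k)" using inv ge[of "Suc k"] by (auto simp: inv_cond_def)
    then have "\<mu>' (m - Suc k) + tail_sum m \<mu> k = \<infinity>"
      using tail_sum_Suc[OF \<open>k < m\<close>, of \<mu>'] eq[of k] by simp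
    then have "\<mu>' (m - Suc k) = \<infinity>" using tail_sum_finite[OF ok order_refl] by (simp add: plus_eq_infty_iff_enat)
    moreover have "\<mu>' (m - Suc k) \<le> \<mu>' p"
      using \<mu>' False \<open>k < m\<close> by (auto simp: antitone_def)
    ultimately show ?thesis using ok False p by (simp add: lam_ok_def)
  qed
qed

end

section \<open>The triangular factors of the pivoted form\<close>

text \<open>The left factor of the pivoted form, with the scalars \<open>u_p\<close> absorbed;
  \<open>upper_of\<close> is the right one. As pivot \<open>p\<close> occupies rows and columns up
  to \<open>p\<close>, before permutation this factor is in fact upper triangular and the other one
  lower triangular.\<close>

definition lower_of where
  "lower_of z \<rho> i p = (if \<rho> i \<le> p then zser z p p * xser z p (\<rho> i) else 0)"

definition upper_of where
  "upper_of z \<kappa> p j = (if \<kappa> j \<le> p then yser z p (\<kappa> j) else 0)"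

lemma gdh_lower_upper:
  assumes "\<rho> i < m" "\<kappa> j < m"
  shows "gdh m (lower_of z \<rho>) \<mu> (upper_of z \<kappa>) i j = ldu m \<mu> z (\<rho> i) (\<kappa> j)"
proof -
  have "gdh m (lower_of z \<rho>) \<mu> (upper_of z \<kappa>) i j =
      (\<Sum>p = 0..<m. if max (\<rho> i) (\<kappa> j) \<le> p then ldu_term \<mu> z p (\<rho> i) (\<kappa> j) else 0)"
    unfolding gdh_def by (intro sum.cong refl) (auto simp: lower_of_def upper_of_def ldu_term_def mult_ac)
  also have "\<dots> = ldu m \<mu> z (\<rho> i) (\<kappa> j)"
    unfolding ldu_def by (rule sum.mono_neutral_cong_right) auto
  finally show ?thesis .
qed

lemma minor_upper_triangular:
  assumes "\<And>i j. j < i \<Longrightarrow> i < m \<Longrightarrow> M i j = 0"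
  shows "minor m M id id = (\<Prod>p = 0..<m. M p p)"
proof -
  have "minor m M id id = prod_list (diag_mat (mat m m (\<lambda>(a, b). M (id a) (id b))))"
    unfolding minor_def using assms by (intro det_upper_triangular) auto
  then show ?thesis by (simp add: diag_mat_def prod.list_conv_set_nth)
qed

lemma minor_lower_upper:
  assumes "\<rho> permutes {0..<m}"
  shows "minor m (lower_of z \<rho>) id id = signof \<rho> * (\<Prod>p = 0..<m. zser z p p)"
    and "minor m (upper_of z \<rho>) id id = signof \<rho>"
proof -
  have "minor m (lower_of z \<rho>) id id = minor m (lower_of z id) (id \<circ> \<rho>) id"
    by (simp add: minor_def lower_of_def id_def)
  also have "\<dots> = signof \<rho> * minor m (lower_of z id) id id"
    by (rule minor_permute_rows[OF assms])
  also have "minor m (lower_of z id) id id = (\<Prod>p = 0..<m. lower_of z id p p)"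
    by (rule minor_upper_triangular) (simp add: lower_of_def)
  also have "(\<Prod>p = 0..<m. lower_of z id p p) = (\<Prod>p = 0..<m. zser z p p)"
    by (simp add: lower_of_def xser_def)
  finally show "minor m (lower_of z \<rho>) id id = signof \<rho> * (\<Prod>p = 0..<m. zser z p p)" .
  have "minor m (upper_of z \<rho>) id id = minor m (upper_of z id) id (id \<circ> \<rho>)"
    by (simp add: minor_def upper_of_def id_def)
  also have "\<dots> = signof \<rho> * minor m (upper_of z id) id id"
    by (rule minor_permute_cols[OF assms])
  also have "minor m (upper_of z id) id id = minor m (\<lambda>a b. upper_of z id b a) id id"
    by (rule minor_transpose[symmetric])
  also have "\<dots> = (\<Prod>p = 0..<m. upper_of z id p p)"
    by (rule minor_upper_triangular) (simp add: upper_of_def)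
  also have "\<dots> = 1" by (simp add: upper_of_def yser_def)
  finally show "minor m (upper_of z \<rho>) id id = signof \<rho>" by (simp only: mult_1_right)
qed

context subring_prime
begin

lemma lower_upper_over:
  assumes "\<And>v. z v \<in> S"
  shows "lower_of z \<rho> i p \<in> fps_over S" "upper_of z \<rho> p i \<in> fps_over S"
proof -
  interpret F: subring_ideal "fps_over S" "fps_over S \<inter> fps_below J \<infinity>" by (rule fps_subring_ideal)
  have "zser z p r \<in> fps_over S" for p r using assms by (simp add: fps_over_def)
  then show "lower_of z \<rho> i p \<in> fps_over S" "upper_of z \<rho> p i \<in> fps_over S"
    by (auto simp: lower_of_def upper_of_def xser_def yser_def F.zero_S F.one_S F.mult_S)
qed

lemma signof_notin_J: "signof p \<notin> J"
  using signof_cases[of p, where 'a = 'a] one_notin_J uminus_J[of "- 1"] by auto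

lemma unit_det_lower_upper:
  assumes "\<And>v. z v \<in> S" "\<And>p. p < m \<Longrightarrow> z (p, p, 0) \<notin> J" "\<rho> permutes {0..<m}"
  shows "unit_det J m (lower_of z \<rho>)" "unit_det J m (upper_of z \<rho>)"
proof -
  interpret c: comm_ring_hom "\<lambda>F :: 'a fps. fps_nth F 0" by (rule fps_nth_0_hom)
  have "(\<Prod>p = 0..<m. z (p, p, 0)) \<notin> J" "(\<Prod>p = 0..<m. z (p, p, 0)) \<in> S"
    using assms by (intro prod_notin_J prod_S; simp)+
  then show "unit_det J m (lower_of z \<rho>)" "unit_det J m (upper_of z \<rho>)"
    using prime_J[OF signof_S[of \<rho>], of "\<Prod>p = 0..<m. z (p, p, 0)"] signof_notin_J[of \<rho>]
    by (auto simp: unit_det_def minor_lower_upper[OF assms(3)] c.hom_mult c.hom_prod simp del: fps_mult_nth_0)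
qed

end

context local_pair
begin

text \<open>\<open>is_ldu\<close> describes the permuted matrix; for \<open>A\<close> itself the
  permutations are inverted.\<close>

lemma is_ldu_gdh:
  assumes "is_ldu m q A \<rho> \<kappa> z \<mu>" "i < m" "j < m"
  shows "A i j - gdh m (lower_of z (Hilbert_Choice.inv \<rho>)) \<mu> (upper_of z (Hilbert_Choice.inv \<kappa>)) i j \<in> fps_below J \<infinity>"
proof -
  have p: "\<rho> permutes {0..<m}" "\<kappa> permutes {0..<m}" using assms by (auto simp: is_ldu_def)
  let ?\<rho> = "Hilbert_Choice.inv \<rho>" and ?\<kappa> = "Hilbert_Choice.inv \<kappa>"
  have "?\<rho> i < m" "?\<kappa> j < m"
    using permutes_in_image[OF permutes_inv[OF p(1)], of i] permutes_in_image[OF permutes_inv[OF p(2)], of j] assms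
    by auto
  moreover from this have "A (\<rho> (?\<rho> i)) (\<kappa> (?\<kappa> j)) - ldu m \<mu> z (?\<rho> i) (?\<kappa> j) \<in> fps_below J \<infinity>"
    using assms(1) unfolding is_ldu_def by blast
  ultimately show ?thesis
    by (simp add: gdh_lower_upper permutes_inverses[OF p(1)] permutes_inverses[OF p(2)])
qed

text \<open>Pivoting produces some exponents \<mu>'; the orders of the minors identify them with
  \<mu>.\<close>

lemma inv_cond_ldu:
  assumes ok: "lam_ok m k \<mu>" and inv: "inv_cond J m k \<mu> A"
    and A: "\<And>i j. i < m \<Longrightarrow> j < m \<Longrightarrow> A i j \<in> fps_over S" and q: "q \<le> m"
    and id: "\<And>i j. i < m \<Longrightarrow> j < m \<Longrightarrow> m - q \<le> i \<or> m - q \<le> j \<Longrightarrow>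
      fps_nth (A i j) 0 - (if i = j then 1 else 0) \<in> J"
  shows "\<exists>\<rho> \<kappa> z \<mu>'. is_ldu m q A \<rho> \<kappa> z \<mu>' \<and> (\<forall>p<m. \<mu>' p = \<mu> p)"
proof -
  obtain \<rho> \<kappa> z \<mu>' where ldu: "is_ldu m q A \<rho> \<kappa> z \<mu>'" using ldu_exists[OF A q id] by blast
  then have z: "\<And>v. z v \<in> S" "\<And>p. p < m \<Longrightarrow> z (p, p, 0) \<notin> J"
    and p: "\<rho> permutes {0..<m}" "\<kappa> permutes {0..<m}" and anti: "antitone m \<mu>'"
    unfolding is_ldu_def by blast+
  have "\<mu>' p = \<mu> p" if "p < m" for p
    using that z p by (intro inv_cond_unique[OF ok anti inv _ _ _ _ A is_ldu_gdh[OF ldu]]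
        lower_upper_over unit_det_lower_upper permutes_inv) auto
  with ldu show ?thesis by blast
qed

end

section \<open>Orbits and orders of minors\<close>

lemma lower_upper_arcs:
  fixes z :: "nat \<times> nat \<times> nat \<Rightarrow> 'b::comm_ring_1" and m :: nat
  obtains zz where "garc zz = lower_of z \<rho>" "harc zz = upper_of z \<kappa>"
    "\<And>v. \<exists>i p. zz v = fps_nth (lower_of z \<rho> i p) (snd v) \<or> zz v = fps_nth (upper_of z \<kappa> p i) (snd v)"
proof -
  define zz where "zz v = (case fst v of Inl (i, p) \<Rightarrow> fps_nth (lower_of z \<rho> i p) (snd v)
    | Inr (p, j) \<Rightarrow> fps_nth (upper_of z \<kappa> p j) (snd v))" for v
  show ?thesis
  proof (rule that)
    show "garc zz = lower_of z \<rho>" "harc zz = upper_of z \<kappa>"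
      by (auto simp: zz_def fps_eq_iff fun_eq_iff)
    show "\<exists>i p. zz v = fps_nth (lower_of z \<rho> i p) (snd v) \<or> zz v = fps_nth (upper_of z \<kappa> p i) (snd v)" for v
      by (cases "fst v") (auto simp: zz_def)
  qed
qed

lemma (in subring_prime) ldu_pt_in_C_orbit:
  fixes h :: "'k::field \<Rightarrow> 'a"
  assumes h: "comm_ring_hom h" "\<And>c. h c \<in> S"
    and z: "\<And>v. z v \<in> S" "\<And>p. p < m \<Longrightarrow> z (p, p, 0) \<notin> J"
    and p: "\<rho> permutes {0..<m}" "\<kappa> permutes {0..<m}"
    and y: "\<And>i j s. i < m \<Longrightarrow> j < m \<Longrightarrow> y ((i, j), s) \<in> S"
      "\<And>i j s. i < m \<Longrightarrow> j < m \<Longrightarrow>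
        y ((i, j), s) - fps_nth (gdh m (lower_of z \<rho>) (\<lambda>p. lam (Suc p)) (upper_of z \<kappa>) i j) s \<in> J"
  shows "pt h y J (mat_coords m \<times> UNIV) \<in> C_orbit m lam"
proof -
  obtain zz where zz: "garc zz = lower_of z \<rho>" "harc zz = upper_of z \<kappa>"
    "\<And>v. \<exists>i p. zz v = fps_nth (lower_of z \<rho> i p) (snd v) \<or> zz v = fps_nth (upper_of z \<kappa> p i) (snd v)"
    using lower_upper_arcs[of z \<rho> \<kappa>] by blast
  have "zz v \<in> S" for v
    using zz(3)[of v] lower_upper_over[of z, OF z(1)] unfolding fps_over_def by fastforce
  then show ?thesis
    using unit_det_lower_upper[of z m \<rho>, OF z p(1)] unit_det_lower_upper[of z m \<kappa>, OF z p(2)] y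
    by (intro pt_in_C_orbit[OF h, of m zz]) (auto simp: zz orbit_pt_def)
qed

lemma inv_cond_pt:
  assumes "comm_ring_hom h"
  shows "inv_cond (pt h z J (mat_coords m \<times> UNIV)) m k \<mu> (marc mp_var) \<longleftrightarrow> inv_cond J m k \<mu> (marc z)"
  by (simp add: inv_cond_def minors_ge_pt[OF assms])

lemma C_orbit_subset_Spec:
  "(\<gamma> :: 'k::field mat_jet) \<in> C_orbit m lam \<Longrightarrow> \<gamma> \<in> Spec (mp_ring (mat_coords m \<times> UNIV))"
  and C_orbit_inv_cond:
  "\<gamma> \<in> C_orbit m lam \<Longrightarrow> lam_ok m k (\<lambda>p. lam (Suc p)) \<Longrightarrow> inv_cond \<gamma> m k (\<lambda>p. lam (Suc p)) (marc mp_var)"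
proof -
  let ?\<mu> = "\<lambda>p. lam (Suc p)"
  assume "\<gamma> \<in> C_orbit m lam"
  then obtain Q where Q: "Q \<in> GG_arcs m" "\<gamma> = pt mp_const (orbit_pt m ?\<mu> mp_var) Q (mat_coords m \<times> UNIV)"
    by (auto simp: C_orbit_eq)
  then interpret subring_prime "carrier (mp_ring (GG_vars m))" Q by (auto simp: GG_arcs_iff Spec_iff)
  have c: "mp_const c \<in> carrier (mp_ring (GG_vars m))" for c :: 'k
    by (simp add: carrier_mp_ring mp_vars_const)
  have v: "mp_var v \<in> carrier (mp_ring (GG_vars m) :: 'k GG_poly ring)" if "v \<in> GG_vars m" for v
    using that by (simp add: carrier_mp_ring mp_vars_var)
  have o: "orbit_pt m ?\<mu> mp_var v \<in> carrier (mp_ring (GG_vars m) :: 'k GG_poly ring)"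
    if "v \<in> mat_coords m \<times> UNIV" for v
    using orbit_pt_S[where zz = mp_var and m = m and ij = "fst v" and \<mu> = ?\<mu> and s = "snd v", OF v] that by auto
  show "\<gamma> \<in> Spec (mp_ring (mat_coords m \<times> UNIV))"
    unfolding Q(2) using o by (intro pt_Spec mp_const_hom c)
  show "inv_cond \<gamma> m k ?\<mu> (marc mp_var)" if ok: "lam_ok m k ?\<mu>"
    unfolding Q(2) inv_cond_pt[OF mp_const_hom] marc_orbit_pt
  proof (rule inv_cond_gdh[where G = "garc mp_var" and H = "harc mp_var", OF ok])
    fix i l assume il: "i < m" "l < m"
    show "garc mp_var i l \<in> fps_over (carrier (mp_ring (GG_vars m) :: 'k GG_poly ring))"
      "harc mp_var i l \<in> fps_over (carrier (mp_ring (GG_vars m) :: 'k GG_poly ring))"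
      using il by (auto simp: fps_over_def carrier_mp_ring mp_vars_var)
    show "gdh m (garc mp_var) ?\<mu> (harc mp_var) i l \<in> fps_over (carrier (mp_ring (GG_vars m) :: 'k GG_poly ring))"
      using o[of "((i, l), _)"] il by (simp add: fps_over_def flip: marc_orbit_pt)
  qed (use Q in \<open>auto simp: GG_arcs_iff fps_below_def zero_J\<close>)
qed

text \<open>Pivoting over the local ring of \<gamma>. The choice \<open>q = 0\<close> describes the
  orbit; for positive \<open>q\<close>, where the last \<open>q\<close> rows and columns of the
  constant term are fixed, the parameters of the last \<open>q\<close> pivots have fixed constant
  terms modulo \<open>J\<close>.\<close>

lemma C_orbit_ldu:
  fixes \<gamma> :: "'k::field mat_jet"
  assumes ok: "lam_ok m k (\<lambda>p. lam (Suc p))" and q: "q \<le> m"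
    and \<gamma>: "\<gamma> \<in> Spec (mp_ring (mat_coords m \<times> UNIV))"
    and inv: "inv_cond \<gamma> m k (\<lambda>p. lam (Suc p)) (marc mp_var)"
    and id: "\<And>i j. i < m \<Longrightarrow> j < m \<Longrightarrow> m - q \<le> i \<or> m - q \<le> j \<Longrightarrow>
      mp_var ((i, j), 0) - mp_const (if i = j then 1 else 0) \<in> \<gamma>"
  obtains S J h and y :: "_ \<Rightarrow> 'k rat_fun" and \<rho> \<kappa> z where
    "local_pair S J" "comm_ring_hom h" "\<And>c. h c \<in> S" "\<And>v. v \<in> mat_coords m \<times> UNIV \<Longrightarrow> y v \<in> S"
    "\<gamma> = pt h y J (mat_coords m \<times> UNIV)"
    "\<rho> permutes {0..<m}" "\<kappa> permutes {0..<m}" "\<And>v. z v \<in> S" "\<And>p. p < m \<Longrightarrow> z (p, p, 0) \<notin> J"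
    "\<And>p r. p < m \<Longrightarrow> m - q \<le> p \<Longrightarrow> z (p, r, 0) - (if r = p then 1 else 0) \<in> J"
    "\<And>i j s. i < m \<Longrightarrow> j < m \<Longrightarrow> y ((i, j), s) -
      fps_nth (gdh m (lower_of z \<rho>) (\<lambda>p. lam (Suc p)) (upper_of z \<kappa>) i j) s \<in> J"
proof -
  obtain S J h and y :: "_ \<Rightarrow> 'k rat_fun" where P: "local_pair S J" "comm_ring_hom h" "\<And>c. h c \<in> S"
    "\<And>v. v \<in> mat_coords m \<times> UNIV \<Longrightarrow> y v \<in> S" "\<gamma> = pt h y J (mat_coords m \<times> UNIV)"
    using Spec_local[OF \<gamma>] by metis
  interpret local_pair S J by (rule P(1))
  interpret e: comm_ring_hom "mp_eval h y" by (rule mp_eval_hom[OF P(2)])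
  interpret h: comm_ring_hom h by (rule P(2))
  have invJ: "inv_cond J m k (\<lambda>p. lam (Suc p)) (marc y)"
    using inv by (simp add: P(5) inv_cond_pt[OF P(2)])
  have idJ: "fps_nth (marc y i j) 0 - (if i = j then 1 else 0) \<in> J"
    if "i < m" "j < m" "m - q \<le> i \<or> m - q \<le> j" for i j
    using id[OF that] by (auto simp: P(5) pt_def e.hom_minus mp_eval_var[OF P(2)] mp_eval_const[OF P(2)] split: if_splits)
  have "marc y i j \<in> fps_over S" if "i < m" "j < m" for i j
    using P(4) that by (simp add: fps_over_def)
  then have "\<exists>\<rho> \<kappa> z \<mu>'. is_ldu m q (marc y) \<rho> \<kappa> z \<mu>' \<and> (\<forall>p<m. \<mu>' p = lam (Suc p))"
    by (intro inv_cond_ldu[OF ok invJ _ q] idJ)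
  then obtain \<rho> \<kappa> z \<mu>' where ldu: "is_ldu m q (marc y) \<rho> \<kappa> z \<mu>'" "\<And>p. p < m \<Longrightarrow> \<mu>' p = lam (Suc p)"
    by blast
  then have L: "\<rho> permutes {0..<m}" "\<kappa> permutes {0..<m}" "\<And>v. z v \<in> S" "\<And>p. p < m \<Longrightarrow> z (p, p, 0) \<notin> J"
    "\<And>p r. p < m \<Longrightarrow> m - q \<le> p \<Longrightarrow> z (p, r, 0) - (if r = p then 1 else 0) \<in> J"
    unfolding is_ldu_def by blast+
  have "y ((i, j), s) - fps_nth (gdh m (lower_of z (Hilbert_Choice.inv \<rho>)) (\<lambda>p. lam (Suc p))
      (upper_of z (Hilbert_Choice.inv \<kappa>)) i j) s \<in> J" if "i < m" "j < m" for i j s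
  proof -
    have "gdh m (lower_of z (Hilbert_Choice.inv \<rho>)) \<mu>' (upper_of z (Hilbert_Choice.inv \<kappa>)) i j =
        gdh m (lower_of z (Hilbert_Choice.inv \<rho>)) (\<lambda>p. lam (Suc p)) (upper_of z (Hilbert_Choice.inv \<kappa>)) i j"
      unfolding gdh_def by (intro sum.cong refl) (simp add: ldu(2))
    then show ?thesis using is_ldu_gdh[OF ldu(1) that] by (simp add: fps_below_def)
  qed
  then show ?thesis
    using P L permutes_inv[OF L(1)] permutes_inv[OF L(2)]
    by (intro that[of S J h y "Hilbert_Choice.inv \<rho>" "Hilbert_Choice.inv \<kappa>" z]) auto
qed

text \<open>Invertible factors preserve the orders of the minors; conversely the triangular factors
  of the pivoted form are a point of the group. This replaces the image of the orbit map by
  equations and inequations.\<close>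

lemma C_orbit_iff:
  fixes \<gamma> :: "'k::field mat_jet"
  assumes ok: "lam_ok m k (\<lambda>p. lam (Suc p))"
  shows "\<gamma> \<in> C_orbit m lam \<longleftrightarrow>
    \<gamma> \<in> Spec (mp_ring (mat_coords m \<times> UNIV)) \<and> inv_cond \<gamma> m k (\<lambda>p. lam (Suc p)) (marc mp_var)"
proof safe
  assume \<gamma>: "\<gamma> \<in> Spec (mp_ring (mat_coords m \<times> UNIV))"
    and inv: "inv_cond \<gamma> m k (\<lambda>p. lam (Suc p)) (marc mp_var)"
  show "\<gamma> \<in> C_orbit m lam"
  proof (rule C_orbit_ldu[OF ok _ \<gamma> inv, of 0])
    fix S J h and y :: "_ \<Rightarrow> 'k rat_fun" and \<rho> \<kappa> z
    assume *: "local_pair S J" "comm_ring_hom h" "\<And>c. h c \<in> S" "\<And>v. v \<in> mat_coords m \<times> UNIV \<Longrightarrow> y v \<in> S"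
      "\<gamma> = pt h y J (mat_coords m \<times> UNIV)"
      "\<rho> permutes {0..<m}" "\<kappa> permutes {0..<m}" "\<And>v. z v \<in> S" "\<And>p. p < m \<Longrightarrow> z (p, p, 0) \<notin> J"
      "\<And>i j s. i < m \<Longrightarrow> j < m \<Longrightarrow> y ((i, j), s) -
        fps_nth (gdh m (lower_of z \<rho>) (\<lambda>p. lam (Suc p)) (upper_of z \<kappa>) i j) s \<in> J"
    interpret local_pair S J by fact
    show ?thesis unfolding *(5) by (rule ldu_pt_in_C_orbit[of h z m \<rho> \<kappa> y lam]) (use * in auto)
  qed auto
qed (use C_orbit_subset_Spec C_orbit_inv_cond ok in blast)+

lemma C_orbit_subset_D_arcs:
  assumes "lam_ok m k (\<lambda>p. lam (Suc p))"
  shows "(C_orbit m lam :: 'k::field mat_jet set) \<subseteq> D_arcs m k"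
proof
  fix \<gamma> :: "'k mat_jet" assume "\<gamma> \<in> C_orbit m lam"
  then have \<gamma>: "\<gamma> \<in> Spec (mp_ring (mat_coords m \<times> UNIV))" "inv_cond \<gamma> m k (\<lambda>p. lam (Suc p)) (marc mp_var)"
    by (auto simp: C_orbit_iff[OF assms])
  interpret subring_prime "carrier (mp_ring (mat_coords m \<times> UNIV))" \<gamma> using \<gamma> by (simp add: Spec_iff)
  have eq: "pt mp_const mp_var \<gamma> (mat_coords m \<times> UNIV) = \<gamma>" using J_S by (intro pt_self) blast
  have "pt mp_const mp_var \<gamma> (mat_coords m \<times> UNIV) \<in> D_arcs m k \<longleftrightarrow> minors_ge \<gamma> m (marc mp_var) (Suc k) \<infinity>"
    by (intro pt_in_D_arcs_iff mp_const_hom) (auto simp: carrier_mp_ring mp_vars_const mp_vars_var)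
  then show "\<gamma> \<in> D_arcs m k" using \<gamma>(2) by (simp add: eq inv_cond_def)
qed

section \<open>Zariski topology and Krull dimension\<close>

lemma Spec_prime: "P \<in> Spec (mp_ring W) \<Longrightarrow> subring_prime (carrier (mp_ring W)) P"
  by (simp add: Spec_iff)

text \<open>Intersections of two such sets are obtained by multiplying the equations, as points are
  prime; unions by uniting them.\<close>

lemma openin_zariski_iff:
  "openin (zariski (mp_ring W :: ('v, 'k::comm_ring_1) mpoly ring)) U \<longleftrightarrow>
    (\<exists>E\<subseteq>carrier (mp_ring W). U = {P \<in> Spec (mp_ring W). \<not> E \<subseteq> P})"
proof
  assume "openin (zariski (mp_ring W :: ('v, 'k) mpoly ring)) U"
  then have "generate_topology_on {{P \<in> Spec (mp_ring W). f \<notin> P} | f. f \<in> carrier (mp_ring W :: ('v, 'k) mpoly ring)} U"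
    unfolding zariski_def by (simp add: openin_topology_generated_by_iff)
  then show "\<exists>E\<subseteq>carrier (mp_ring W). U = {P \<in> Spec (mp_ring W). \<not> E \<subseteq> P}"
  proof (induction rule: generate_topology_on.induct)
    case Empty
    show ?case by (rule exI[of _ "{}"]) auto
  next
    case (Int a b)
    then obtain E F where EF: "E \<subseteq> carrier (mp_ring W)" "a = {P \<in> Spec (mp_ring W). \<not> E \<subseteq> P}"
      "F \<subseteq> carrier (mp_ring W)" "b = {P \<in> Spec (mp_ring W). \<not> F \<subseteq> P}" by auto
    have "\<not> {e * f | e f. e \<in> E \<and> f \<in> F} \<subseteq> P \<longleftrightarrow> \<not> E \<subseteq> P \<and> \<not> F \<subseteq> P" if "P \<in> Spec (mp_ring W)" for P
    proof -
      interpret subring_prime "carrier (mp_ring W)" P by (rule Spec_prime[OF that])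
      have "e * f \<in> P \<longleftrightarrow> e \<in> P \<or> f \<in> P" if "e \<in> E" "f \<in> F" for e f
        using that EF mult_J mult_J_right prime_J by blast
      then show ?thesis by blast
    qed
    then have "a \<inter> b = {P \<in> Spec (mp_ring W). \<not> {e * f | e f. e \<in> E \<and> f \<in> F} \<subseteq> P}"
      unfolding EF by blast
    moreover have "{e * f | e f. e \<in> E \<and> f \<in> F} \<subseteq> carrier (mp_ring W)"
    proof clarify
      fix e f assume "e \<in> E" "f \<in> F"
      then show "e * f \<in> carrier (mp_ring W)"
        by (intro subring_ideal.mult_S[OF mp_ring_subring] subsetD[OF EF(1)] subsetD[OF EF(3)])
    qed
    ultimately show ?case by (intro exI conjI)
  next
    case (UN K)
    have "\<forall>k\<in>K. \<exists>E. E \<subseteq> carrier (mp_ring W) \<and> k = {P \<in> Spec (mp_ring W). \<not> E \<subseteq> P}"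
      using UN.IH by simp
    from bchoice[OF this] obtain E where
      "\<forall>k\<in>K. E k \<subseteq> carrier (mp_ring W) \<and> k = {P \<in> Spec (mp_ring W). \<not> E k \<subseteq> P}"
      by (elim exE)
    note E = bspec[OF this]
    show ?case
    proof (intro exI[of _ "\<Union>k\<in>K. E k"] conjI)
      have "(\<Union>k\<in>K. k) = (\<Union>k\<in>K. {P \<in> Spec (mp_ring W). \<not> E k \<subseteq> P})"
        by (intro SUP_cong refl conjunct2[OF E])
      also have "\<dots> = {P \<in> Spec (mp_ring W). \<not> \<Union>(E ` K) \<subseteq> P}" by auto
      finally show "\<Union>K = {P \<in> Spec (mp_ring W). \<not> \<Union>(E ` K) \<subseteq> P}" by simp
    qed (use E in blast)
  next
    case (Basis s)
    then obtain f where "f \<in> carrier (mp_ring W)" "s = {P \<in> Spec (mp_ring W). f \<notin> P}" by auto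
    then show ?case by (intro exI[of _ "{f}"]) auto
  qed
next
  assume "\<exists>E\<subseteq>carrier (mp_ring W). U = {P \<in> Spec (mp_ring W). \<not> E \<subseteq> P}"
  then obtain E where E: "E \<subseteq> carrier (mp_ring W)" "U = {P \<in> Spec (mp_ring W). \<not> E \<subseteq> P}" by blast
  have U: "U = (\<Union>f\<in>E. {P \<in> Spec (mp_ring W). f \<notin> P})" unfolding E(2) by auto
  have "openin (zariski (mp_ring W)) {P \<in> Spec (mp_ring W). f \<notin> P}" if "f \<in> E" for f
    unfolding zariski_def using that E by (intro topology_generated_by_Basis) blast
  then show "openin (zariski (mp_ring W)) U" unfolding U by (intro openin_Union) blast
qed

lemma topspace_zariski_mp: "topspace (zariski (mp_ring W :: ('v, 'k::comm_ring_1) mpoly ring)) = Spec (mp_ring W)"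
  by (rule topspace_zariski[OF mp_ring_cring])

section \<open>Closed and irreducible subsets of an arbitrary set of primes, and chains\<close>

context
  fixes W :: "'v set" and T :: "('v, 'k::comm_ring_1) mpoly set set"
  assumes T: "T \<subseteq> Spec (mp_ring W)"
begin

abbreviation (input) "Spec_subspace \<equiv> subtopology (zariski (mp_ring W :: ('v, 'k) mpoly ring)) T"

lemma topspace_X: "topspace Spec_subspace = T"
  using T by (auto simp: topspace_zariski_mp)

lemma closedin_X_iff: "closedin Spec_subspace Z \<longleftrightarrow> (\<exists>E\<subseteq>carrier (mp_ring W). Z = {P \<in> T. E \<subseteq> P})"
proof
  assume Z: "closedin Spec_subspace Z"
  then have "Z \<subseteq> T" "openin Spec_subspace (T - Z)" unfolding closedin_def topspace_X by simp_all
  then obtain E where E: "E \<subseteq> carrier (mp_ring W)" "T - Z = {P \<in> Spec (mp_ring W). \<not> E \<subseteq> P} \<inter> T"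
    unfolding openin_subtopology openin_zariski_iff by (elim exE conjE) simp
  have "Z = T - (T - Z)" using \<open>Z \<subseteq> T\<close> by (simp add: double_diff)
  also have "\<dots> = {P \<in> T. E \<subseteq> P}" unfolding E(2) using T by auto
  finally show "\<exists>E\<subseteq>carrier (mp_ring W). Z = {P \<in> T. E \<subseteq> P}" using E(1) by (intro exI conjI)
next
  assume "\<exists>E\<subseteq>carrier (mp_ring W). Z = {P \<in> T. E \<subseteq> P}"
  then obtain E where E: "E \<subseteq> carrier (mp_ring W)" "Z = {P \<in> T. E \<subseteq> P}" by (elim exE conjE)
  have "openin (zariski (mp_ring W)) {P \<in> Spec (mp_ring W). \<not> E \<subseteq> P}"
    unfolding openin_zariski_iff using E(1) by (intro exI[of _ E]) simp
  moreover have "T - Z = {P \<in> Spec (mp_ring W). \<not> E \<subseteq> P} \<inter> T" unfolding E(2) using T by auto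
  ultimately have "openin Spec_subspace (T - Z)" unfolding openin_subtopology by (intro exI conjI)
  moreover have "Z \<subseteq> T" unfolding E(2) by auto
  ultimately show "closedin Spec_subspace Z" unfolding closedin_def topspace_X by simp
qed

text \<open>The intersection is the generic point of the closure of \<open>Z\<close> in the whole
  spectrum. It need not belong to \<open>T\<close>, so the upper bound deals with chains in
  \<open>Spec (mp_ring W)\<close>.\<close>

lemma irreducible_Inter_Spec:
  assumes "irreducible_in Spec_subspace Z"
  shows "\<Inter>Z \<in> Spec (mp_ring W)"
proof -
  have Z: "Z \<subseteq> T" "Z \<noteq> {}" and irr: "\<And>A B. closedin Spec_subspace A \<Longrightarrow> closedin Spec_subspace B \<Longrightarrow> Z \<subseteq> A \<union> B \<Longrightarrow> Z \<subseteq> A \<or> Z \<subseteq> B"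
    using assms unfolding irreducible_in_def topspace_X by blast+
  interpret M: subring_ideal "carrier (mp_ring W)" "{0 :: ('v, 'k) mpoly}" by (rule mp_ring_subring)
  have P: "subring_prime (carrier (mp_ring W)) P" if "P \<in> Z" for P using that Z T Spec_prime by blast
  note I = subring_prime.axioms(1)[OF P]
  obtain P0 where P0: "P0 \<in> Z" using Z by blast
  show ?thesis unfolding Spec_iff
  proof
    fix a b
    show "a \<in> carrier (mp_ring W)" if "a \<in> \<Inter>Z" using that subring_ideal.J_S[OF I[OF P0]] P0 by blast
    show "0 \<in> \<Inter>Z" using subring_ideal.zero_J[OF I] by blast
    show "a + b \<in> \<Inter>Z" if "a \<in> \<Inter>Z" "b \<in> \<Inter>Z" using that subring_ideal.add_J[OF I] by blast
    show "a * b \<in> \<Inter>Z" if "a \<in> carrier (mp_ring W)" "b \<in> \<Inter>Z" using that subring_ideal.mult_J[OF I] by blast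
    show "1 \<notin> \<Inter>Z" using subring_prime.one_notin_J[OF P[OF P0]] P0 by blast
    show "a \<in> \<Inter>Z \<or> b \<in> \<Inter>Z" if ab: "a \<in> carrier (mp_ring W)" "b \<in> carrier (mp_ring W)" "a * b \<in> \<Inter>Z"
    proof -
      have "Z \<subseteq> {P \<in> T. {a} \<subseteq> P} \<union> {P \<in> T. {b} \<subseteq> P}"
        using ab Z subring_prime.prime_J[OF P ab(1,2)] by blast
      moreover have "closedin Spec_subspace {P \<in> T. {a} \<subseteq> P}" "closedin Spec_subspace {P \<in> T. {b} \<subseteq> P}"
        using ab by (auto simp: closedin_X_iff)
      ultimately show ?thesis using irr by blast
    qed
  qed (auto intro: M.one_S M.add_S M.mult_S M.uminus_S)
qed

lemma irreducible_finite_cover: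
  assumes "irreducible_in Spec_subspace Z" "finite \<K>" "\<And>K. K \<in> \<K> \<Longrightarrow> K \<subseteq> carrier (mp_ring W)"
    and "Z \<subseteq> (\<Union>K\<in>\<K>. {P \<in> T. K \<subseteq> P})"
  shows "\<exists>K\<in>\<K>. Z \<subseteq> {P \<in> T. K \<subseteq> P}"
  using assms(2-4)
proof (induction \<K> rule: finite_induct)
  case empty
  then show ?case using assms(1) by (auto simp: irreducible_in_def)
next
  case (insert K \<K>)
  have cl: "closedin Spec_subspace {P \<in> T. K \<subseteq> P}" if "K \<subseteq> carrier (mp_ring W)" for K
    using that by (auto simp: closedin_X_iff)
  have "closedin Spec_subspace (\<Union>K\<in>\<K>. {P \<in> T. K \<subseteq> P})"
  proof (rule closedin_Union)
    show "finite ((\<lambda>K. {P \<in> T. K \<subseteq> P}) ` \<K>)" using insert.hyps by simp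
    fix Y assume "Y \<in> (\<lambda>K. {P \<in> T. K \<subseteq> P}) ` \<K>"
    then obtain K' where "K' \<in> \<K>" "Y = {P \<in> T. K' \<subseteq> P}" by (elim imageE)
    then show "closedin Spec_subspace Y" using cl[of K'] insert.prems(1)[of K'] by simp
  qed
  moreover have "closedin Spec_subspace {P \<in> T. K \<subseteq> P}" using insert.prems(1) by (intro cl) simp
  moreover have "Z \<subseteq> {P \<in> T. K \<subseteq> P} \<union> (\<Union>K\<in>\<K>. {P \<in> T. K \<subseteq> P})"
    using insert.prems(2) by simp
  ultimately have "Z \<subseteq> {P \<in> T. K \<subseteq> P} \<or> Z \<subseteq> (\<Union>K\<in>\<K>. {P \<in> T. K \<subseteq> P})"
    using assms(1) unfolding irreducible_in_def by simp
  then show ?case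
  proof
    assume "Z \<subseteq> (\<Union>K\<in>\<K>. {P \<in> T. K \<subseteq> P})"
    then have "\<exists>K\<in>\<K>. Z \<subseteq> {P \<in> T. K \<subseteq> P}" using insert.prems(1) by (intro insert.IH) simp_all
    then show ?thesis by (rule bexE) (rule bexI, assumption, erule insertI2)
  qed simp
qed

text \<open>Irreducible closed sets correspond to their generic points with inclusions reversed. The
  largest set of a chain is covered by finitely many closed sets, hence lies in one of them, so its
  generic point contains some \<open>K\<close>.\<close>

lemma krull_dim_le:
  assumes "finite \<K>" "\<And>K. K \<in> \<K> \<Longrightarrow> K \<subseteq> carrier (mp_ring W)"
    and "\<And>P. P \<in> T \<Longrightarrow> \<exists>K\<in>\<K>. K \<subseteq> P"
    and chain: "\<And>K n P. K \<in> \<K> \<Longrightarrow> (\<And>i. i \<le> n \<Longrightarrow> P i \<in> Spec (mp_ring W)) \<Longrightarrow>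
      (\<And>i. i < n \<Longrightarrow> P i \<subset> P (Suc i)) \<Longrightarrow> K \<subseteq> P 0 \<Longrightarrow> n \<le> N"
  shows "krull_dim Spec_subspace \<le> ereal (real N)"
  unfolding krull_dim_def
proof (rule Sup_least, clarsimp)
  fix n and Z :: "nat \<Rightarrow> ('v, 'k) mpoly set set"
  assume Z: "\<forall>i\<le>n. closedin Spec_subspace (Z i) \<and> irreducible_in Spec_subspace (Z i)" "\<forall>i<n. Z i \<subset> Z (Suc i)"
  have ZT: "Z i \<subseteq> T" if "i \<le> n" for i
  proof -
    have "irreducible_in Spec_subspace (Z i)" using Z(1) that by simp
    then show ?thesis unfolding irreducible_in_def topspace_X by simp
  qed
  have "\<exists>K\<in>\<K>. Z n \<subseteq> {P \<in> T. K \<subseteq> P}"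
  proof (rule irreducible_finite_cover[OF _ assms(1,2)])
    show "irreducible_in Spec_subspace (Z n)" using Z(1) by simp
    show "Z n \<subseteq> (\<Union>K\<in>\<K>. {P \<in> T. K \<subseteq> P})" using ZT[of n] assms(3) by blast
  qed
  then obtain K where K: "K \<in> \<K>" "Z n \<subseteq> {P \<in> T. K \<subseteq> P}" by (elim bexE)
  \<comment> \<open>Reversed, so that the primes increase and \<open>P 0\<close> belongs to the
    largest set.\<close>
  define P where "P i = \<Inter>(Z (n - i))" for i
  have eq: "Z i = {P \<in> T. \<Inter>(Z i) \<subseteq> P}" if i: "i \<le> n" for i
  proof -
    obtain E where E: "Z i = {P \<in> T. E \<subseteq> P}"
      using Z(1)[rule_format, OF i] unfolding closedin_X_iff by (elim conjE exE)
    have "E \<subseteq> \<Inter>(Z i)" unfolding E by blast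
    show ?thesis
    proof (intro equalityI subsetI)
      fix P assume "P \<in> Z i"
      then show "P \<in> {P \<in> T. \<Inter>(Z i) \<subseteq> P}" using ZT[OF i] by blast
    next
      fix P assume "P \<in> {P \<in> T. \<Inter>(Z i) \<subseteq> P}"
      then have P: "P \<in> T" "\<Inter>(Z i) \<subseteq> P" by simp_all
      have "E \<subseteq> P" by (rule subset_trans[OF \<open>E \<subseteq> \<Inter>(Z i)\<close> P(2)])
      then show "P \<in> Z i" by (subst E) (simp add: P(1))
    qed
  qed
  show "n \<le> N"
  proof (rule chain[OF K(1)])
    show "P i \<in> Spec (mp_ring W)" if "i \<le> n" for i
      unfolding P_def using Z by (intro irreducible_Inter_Spec) auto
    show "P i \<subset> P (Suc i)" if "i < n" for i
    proof -
      have lt: "Z (n - Suc i) \<subset> Z (n - i)"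
        using Z(2)[rule_format, of "n - Suc i"] that by (simp add: Suc_diff_Suc)
      have "P i \<noteq> P (Suc i)"
      proof
        assume "P i = P (Suc i)"
        then have "\<Inter>(Z (n - i)) = \<Inter>(Z (n - Suc i))" by (simp add: P_def)
        then have "Z (n - i) = Z (n - Suc i)"
          using eq[of "n - i"] eq[of "n - Suc i"] by simp
        then show False using lt by simp
      qed
      moreover have "P i \<subseteq> P (Suc i)" unfolding P_def using lt by (intro Inter_anti_mono) simp
      ultimately show ?thesis by simp
    qed
    show "K \<subseteq> P 0" using K by (auto simp: P_def)
  qed
qed

text \<open>The closure of a point is irreducible; the primes are taken in \<open>T\<close> so that
  their closures within \<open>T\<close> remain distinct.\<close>

lemma krull_dim_ge:
  assumes "\<And>i. i \<le> N \<Longrightarrow> P i \<in> T" "\<And>i. i < N \<Longrightarrow> P (Suc i) \<subset> P i"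
  shows "ereal (real N) \<le> krull_dim Spec_subspace"
  unfolding krull_dim_def
proof (rule Sup_upper, intro CollectI exI[of _ N] conjI refl)
  define Z where "Z i = {Q \<in> T. P i \<subseteq> Q}" for i
  have "P i \<subseteq> carrier (mp_ring W)" if "i \<le> N" for i
    using subring_ideal.J_S[OF subring_prime.axioms(1)[OF Spec_prime]] assms(1)[OF that] T by blast
  then have "closedin Spec_subspace (Z i)" if "i \<le> N" for i
    using that by (auto simp: closedin_X_iff Z_def)
  moreover have "irreducible_in Spec_subspace (Z i)" if i: "i \<le> N" for i
    unfolding irreducible_in_def topspace_X
  proof (intro conjI allI impI)
    show "Z i \<subseteq> T" "Z i \<noteq> {}" using assms(1)[OF i] by (auto simp: Z_def)
    fix A B assume AB: "closedin Spec_subspace A \<and> closedin Spec_subspace B \<and> Z i \<subseteq> A \<union> B"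
    have Pi: "P i \<in> Z i" using assms(1)[OF i] by (auto simp: Z_def)
    have "Z i \<subseteq> C" if C: "closedin Spec_subspace C" "P i \<in> C" for C
    proof -
      obtain E where "C = {P \<in> T. E \<subseteq> P}" using C(1) unfolding closedin_X_iff by blast
      then show ?thesis using C(2) by (auto simp: Z_def)
    qed
    then show "Z i \<subseteq> A \<or> Z i \<subseteq> B" using AB Pi by blast
  qed
  moreover have "Z i \<subset> Z (Suc i)" if "i < N" for i
  proof -
    have "P (Suc i) \<in> Z (Suc i)" "P (Suc i) \<notin> Z i"
      using assms(1)[of "Suc i"] assms(2)[OF that] that by (auto simp: Z_def)
    then show ?thesis using assms(2)[OF that] by (auto simp: Z_def)
  qed
  ultimately show "\<exists>Z. (\<forall>i\<le>N. closedin Spec_subspace (Z i) \<and> irreducible_in Spec_subspace (Z i)) \<and> (\<forall>i<N. Z i \<subset> Z (Suc i))"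
    by blast
qed

end

section \<open>Constructible sets and truncation of jets\<close>

lemma constructible_closed_open:
  assumes V: "\<And>f. f \<in> I \<Longrightarrow> mp_vars f \<subseteq> V"
    and F: "F \<subseteq> carrier (jet_ring V (enat r))" and U: "finite A" "\<And>a. a \<in> A \<Longrightarrow> E a \<subseteq> carrier (jet_ring V (enat r))"
  shows "constructible_in (jet_space V I (enat r)) {P \<in> jets V I (enat r). F \<subseteq> P \<and> (\<forall>a\<in>A. \<not> E a \<subseteq> P)}"
proof -
  let ?X = "jet_space V I (enat r)" and ?J = "jets V I (enat r)"
  have J: "?J \<subseteq> Spec (mp_ring (V \<times> {..r}))" by (auto simp: jets_def jet_ring_enat)
  have X: "?X = subtopology (zariski (mp_ring (V \<times> {..r}))) ?J" by (simp add: jet_space_def jet_ring_enat)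
  have top: "topspace ?X = ?J" unfolding X by (rule topspace_X[OF J])
  have op: "openin ?X {P \<in> ?J. \<not> G \<subseteq> P}" if "G \<subseteq> carrier (jet_ring V (enat r))" for G
  proof -
    have "closedin ?X {P \<in> ?J. G \<subseteq> P}"
      unfolding X closedin_X_iff[OF J] using that by (auto simp: jet_ring_enat)
    then have "openin ?X (?J - {P \<in> ?J. G \<subseteq> P})" by (simp add: closedin_def top)
    moreover have "?J - {P \<in> ?J. G \<subseteq> P} = {P \<in> ?J. \<not> G \<subseteq> P}" by blast
    ultimately show ?thesis by simp
  qed
  have "constructible_in ?X (topspace ?X - {P \<in> ?J. \<not> F \<subseteq> P})"
    by (intro constructible_in.intros op F)
  moreover have "constructible_in ?X {P \<in> ?J. \<forall>a\<in>A. \<not> E a \<subseteq> P}" using U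
  proof (induction A rule: finite_induct)
    case empty
    have "openin ?X ?J" using openin_topspace[of ?X] by (simp add: top)
    then show ?case by (auto intro: constructible_in.intros)
  next
    case (insert a A)
    have eq: "{P \<in> ?J. \<forall>a\<in>insert a A. \<not> E a \<subseteq> P} = {P \<in> ?J. \<not> E a \<subseteq> P} \<inter> {P \<in> ?J. \<forall>a\<in>A. \<not> E a \<subseteq> P}" by auto
    show ?case
      unfolding eq by (rule constructible_in.intros(3)[OF constructible_in.intros(1)[OF op]]) (use insert in simp_all)
  qed
  ultimately have "constructible_in ?X ((topspace ?X - {P \<in> ?J. \<not> F \<subseteq> P}) \<inter> {P \<in> ?J. \<forall>a\<in>A. \<not> E a \<subseteq> P})"
    by (rule constructible_in.intros)
  moreover have "(topspace ?X - {P \<in> ?J. \<not> F \<subseteq> P}) \<inter> {P \<in> ?J. \<forall>a\<in>A. \<not> E a \<subseteq> P} =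
      {P \<in> ?J. F \<subseteq> P \<and> (\<forall>a\<in>A. \<not> E a \<subseteq> P)}" by (auto simp: top)
  ultimately show ?thesis by simp
qed

lemma trunc_jets:
  fixes \<gamma> :: "('v \<times> nat, 'k::comm_ring_1) mpoly set"
  assumes "\<gamma> \<in> jets V I \<infinity>" "\<And>f. f \<in> I \<Longrightarrow> mp_vars f \<subseteq> V"
  shows "trunc V (enat l) \<gamma> \<in> jets V I (enat l)"
proof -
  have \<gamma>: "\<gamma> \<in> Spec (mp_ring (V \<times> UNIV))" using assms by (simp add: jets_def jet_ring_infinity)
  interpret subring_prime "carrier (mp_ring (V \<times> UNIV))" \<gamma> by (rule Spec_prime[OF \<gamma>])
  have eq: "\<gamma> = pt mp_const mp_var \<gamma> (V \<times> UNIV)" using J_S by (intro pt_self[symmetric]) blast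
  have "pt mp_const mp_var \<gamma> (V \<times> {..l}) \<in> Spec (mp_ring (V \<times> {..l}))"
    by (rule pt_Spec[OF mp_const_hom]) (auto simp: carrier_mp_ring mp_vars_const mp_vars_var)
  moreover have "trunc V (enat l) \<gamma> = pt mp_const mp_var \<gamma> (V \<times> {..l})"
    unfolding trunc_def jet_ring_enat by (subst eq) (rule pt_trunc, auto)
  moreover have "jet_coeff s f \<in> trunc V (enat l) \<gamma>" if "f \<in> I" "s \<le> l" for f s
  proof -
    have "mp_vars (jet_coeff s f) \<subseteq> V \<times> {..l}"
      using mp_vars_jet_coeff[OF assms(2)[OF that(1)], of s] that(2) by fastforce
    then show ?thesis using assms(1) that by (auto simp: trunc_def jet_ring_enat carrier_mp_ring jets_def)
  qed
  ultimately show ?thesis by (simp add: jets_def jet_ring_enat)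
qed

section \<open>Algebraic dependence and chains of primes\<close>

text \<open>Exponent vectors are lists so that lexicographic arguments become inductions on the
  list; lists of different length are cut to the shorter one.\<close>

fun list_monom :: "'a::comm_ring_1 list \<Rightarrow> nat list \<Rightarrow> 'a" where
  "list_monom (x # xs) (a # e) = x ^ a * list_monom xs e"
| "list_monom _ _ = 1"

lemma hom_list_monom:
  assumes "comm_ring_hom f"
  shows "f (list_monom xs e) = list_monom (map f xs) e"
proof -
  interpret f: comm_ring_hom f by fact
  show ?thesis by (induction xs e rule: list_monom.induct) (auto simp: f.hom_mult f.hom_power)
qed

lemma (in subring_ideal) list_monom_S: "set xs \<subseteq> S \<Longrightarrow> list_monom xs e \<in> S"
  by (induction xs e rule: list_monom.induct) (auto intro: mult_S power_S one_S)

text \<open>The degree is bounded in each variable separately, so that for finite \<open>W\<close>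
  there are at most \<open>(d + 1) ^ card W\<close> monomials.\<close>

definition deg_le :: "'w set \<Rightarrow> nat \<Rightarrow> ('w, 'k::comm_ring_1) mpoly set" where
  "deg_le W d = {p. \<forall>\<mu>\<in>Poly_Mapping.keys p. Poly_Mapping.keys \<mu> \<subseteq> W \<and> (\<forall>v. Poly_Mapping.lookup \<mu> v \<le> d)}"

lemma deg_le_mult: "p \<in> deg_le W a \<Longrightarrow> q \<in> deg_le W b \<Longrightarrow> p * q \<in> deg_le W (a + b)"
proof -
  assume p: "p \<in> deg_le W a" and q: "q \<in> deg_le W b"
  have "Poly_Mapping.keys \<mu> \<subseteq> W \<and> (\<forall>v. Poly_Mapping.lookup \<mu> v \<le> a + b)"
    if pq: "\<mu> \<in> Poly_Mapping.keys (p * q)" for \<mu>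
  proof -
    obtain \<alpha> \<beta> where \<mu>: "\<mu> = \<alpha> + \<beta>" "\<alpha> \<in> Poly_Mapping.keys p" "\<beta> \<in> Poly_Mapping.keys q"
      using pq keys_mult[of p q] by blast
    have "Poly_Mapping.keys \<alpha> \<subseteq> W" "Poly_Mapping.keys \<beta> \<subseteq> W"
      and "\<And>v. Poly_Mapping.lookup \<alpha> v \<le> a" "\<And>v. Poly_Mapping.lookup \<beta> v \<le> b"
      using p q \<mu>(2,3) unfolding deg_le_def by simp_all
    then show ?thesis
      using Poly_Mapping.keys_add[of \<alpha> \<beta>] unfolding \<mu>(1) lookup_add by (auto intro: add_mono)
  qed
  then show ?thesis by (simp add: deg_le_def)
qed

lemma deg_le_one: "1 \<in> deg_le W d"
  by (simp add: deg_le_def)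

lemma deg_le_mono: "p \<in> deg_le W a \<Longrightarrow> a \<le> b \<Longrightarrow> p \<in> deg_le W b"
  unfolding deg_le_def by (auto intro: order_trans)

lemma deg_le_power: "p \<in> deg_le W d \<Longrightarrow> p ^ n \<in> deg_le W (n * d)"
  by (induction n) (auto simp: deg_le_one intro: deg_le_mult)

lemma deg_le_list_monom:
  "set xs \<subseteq> deg_le W d \<Longrightarrow> set e \<subseteq> {..D} \<Longrightarrow> list_monom xs e \<in> deg_le W (length xs * (D * d))"
proof (induction xs e rule: list_monom.induct)
  case (1 x xs a e)
  have "x ^ a \<in> deg_le W (D * d)"
    using 1(2,3) by (intro deg_le_mono[OF deg_le_power[of x W d a]]) auto
  then show ?case using deg_le_mult[OF _ 1(1)] 1(2,3) by simp
qed (auto intro: deg_le_one)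

lemma exists_deg_le:
  assumes "finite A" "A \<subseteq> carrier (mp_ring W)"
  shows "\<exists>d. A \<subseteq> deg_le W d"
proof -
  have *: "\<exists>d. p \<in> deg_le W d" if "p \<in> carrier (mp_ring W)" for p :: "('a, 'b) mpoly"
  proof
    show "p \<in> deg_le W (\<Sum>\<mu>\<in>Poly_Mapping.keys p. \<Sum>v\<in>Poly_Mapping.keys \<mu>. Poly_Mapping.lookup \<mu> v)"
    proof (unfold deg_le_def, intro CollectI ballI conjI allI)
      fix \<mu> v assume \<mu>: "\<mu> \<in> Poly_Mapping.keys p"
      then show "Poly_Mapping.keys \<mu> \<subseteq> W" using that by (auto simp: carrier_mp_ring mp_vars_def)
      have "Poly_Mapping.lookup \<mu> v \<le> (\<Sum>v\<in>Poly_Mapping.keys \<mu>. Poly_Mapping.lookup \<mu> v)"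
        by (cases "v \<in> Poly_Mapping.keys \<mu>") (auto intro: member_le_sum simp: in_keys_iff)
      also have "\<dots> \<le> (\<Sum>\<mu>\<in>Poly_Mapping.keys p. \<Sum>v\<in>Poly_Mapping.keys \<mu>. Poly_Mapping.lookup \<mu> v)"
        using \<mu> by (intro member_le_sum) auto
      finally show "Poly_Mapping.lookup \<mu> v \<le> \<dots>" .
    qed
  qed
  show ?thesis using assms
  proof (induction A rule: finite_induct)
    case (insert p A)
    then obtain d e where "A \<subseteq> deg_le W d" "p \<in> deg_le W e" using *[of p] by auto
    then have "insert p A \<subseteq> deg_le W (max d e)"
      using deg_le_mono[of _ W d "max d e"] deg_le_mono[of p W e "max d e"] by auto
    then show ?case by blast
  qed auto
qed

lemma mpoly_vector_space: "vector_space (\<lambda>c (p :: ('w, 'k::field) mpoly). mp_const c * p)"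
proof -
  interpret c: comm_ring_hom "mp_const :: 'k \<Rightarrow> ('w, 'k) mpoly" by (rule mp_const_hom)
  show ?thesis
    by standard (simp_all add: distrib_left distrib_right c.hom_add c.hom_mult mult.assoc)
qed

text \<open>There are more products \<open>f\<^sub>1\<^bsup>e\<^sub>1\<^esup> \<cdots> f\<^sub>n\<^bsup>e\<^sub>n\<^esup>\<close> with exponents at most \<open>D\<close> than monomials of the
  degrees that occur in them, if \<open>D\<close> is large and \<open>n\<close> exceeds the number of variables.\<close>

lemma algebraic_dependence:
  fixes fs :: "('w, 'k::field) mpoly list"
  assumes W: "finite W" and fs: "set fs \<subseteq> carrier (mp_ring W)" and len: "length fs = Suc (card W)"
  shows "\<exists>F c. finite F \<and> F \<noteq> {} \<and> (\<forall>e\<in>F. length e = length fs \<and> c e \<noteq> 0) \<and>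
    (\<Sum>e\<in>F. mp_const (c e) * list_monom fs e) = 0"
proof -
  interpret vector_space "\<lambda>c (p :: ('w, 'k) mpoly). mp_const c * p" by (rule mpoly_vector_space)
  let ?N = "card W"
  obtain d where d: "set fs \<subseteq> deg_le W d" using exists_deg_le[OF _ fs] by auto
  \<comment> \<open>With N variables there are \<open>(D + 1) ^ (N + 1)\<close> exponent vectors and
    at most \<open>(M + 1) ^ N \<le> (b * (D + 1)) ^ N\<close> monomials. The choice
    \<open>D = b ^ N\<close> makes the first number larger.\<close>
  define b where "b = Suc (Suc ?N * d)"
  define D where "D = b ^ ?N"
  define M where "M = Suc ?N * (D * d)"
  define Mon where "Mon = {\<mu> :: 'w \<Rightarrow>\<^sub>0 nat. Poly_Mapping.keys \<mu> \<subseteq> W \<and> (\<forall>v. Poly_Mapping.lookup \<mu> v \<le> M)}"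
  have inj: "inj_on (\<lambda>\<mu>. restrict (Poly_Mapping.lookup \<mu>) W) Mon"
  proof (rule inj_onI)
    fix \<mu> \<nu> assume *: "\<mu> \<in> Mon" "\<nu> \<in> Mon" "restrict (Poly_Mapping.lookup \<mu>) W = restrict (Poly_Mapping.lookup \<nu>) W"
    show "\<mu> = \<nu>"
    proof (rule poly_mapping_eqI)
      fix v show "Poly_Mapping.lookup \<mu> v = Poly_Mapping.lookup \<nu> v"
      proof (cases "v \<in> W")
        case True
        then show ?thesis using fun_cong[OF *(3), of v] by simp
      next
        case False
        then have "v \<notin> Poly_Mapping.keys \<mu>" "v \<notin> Poly_Mapping.keys \<nu>" using *(1,2) by (auto simp: Mon_def)
        then show ?thesis by (simp add: in_keys_iff)
      qed
    qed
  qed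
  have sub: "(\<lambda>\<mu>. restrict (Poly_Mapping.lookup \<mu>) W) ` Mon \<subseteq> W \<rightarrow>\<^sub>E {..M}"
    by (auto simp: Mon_def)
  have finM: "finite Mon" and cardM: "card Mon \<le> Suc M ^ ?N"
    using finite_imageD[OF finite_subset[OF sub] inj] card_inj_on_le[OF inj sub] W
    by (auto simp: finite_PiE card_PiE)
  let ?B = "(\<lambda>\<mu>. Poly_Mapping.single \<mu> (1::'k)) ` Mon"
  have finB: "finite ?B" using finM by simp
  have span: "p \<in> span ?B" if "p \<in> deg_le W M" for p
  proof -
    have "p = (\<Sum>\<mu>\<in>Poly_Mapping.keys p. mp_const (Poly_Mapping.lookup p \<mu>) * Poly_Mapping.single \<mu> 1)"
      using mp_sum_single[of p] by (simp add: mp_const_def mult_single)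
    also have "\<dots> \<in> span ?B"
    proof (intro span_sum span_scale span_base imageI)
      fix \<mu> assume "\<mu> \<in> Poly_Mapping.keys p"
      then show "\<mu> \<in> Mon" using that by (simp add: deg_le_def Mon_def)
    qed
    finally show ?thesis .
  qed
  define E where "E = {e. set e \<subseteq> {..D} \<and> length e = Suc ?N}"
  have E: "finite E" "card E = Suc D ^ Suc ?N"
    unfolding E_def using finite_lists_length_eq[of "{..D}" "Suc ?N"] card_lists_length_eq[of "{..D}" "Suc ?N"] by simp_all
  have gE: "list_monom fs e \<in> span ?B" if "e \<in> E" for e
    using that deg_le_list_monom[OF d, of e D] by (intro span) (simp add: E_def len M_def)
  have "Suc M \<le> b * Suc D"
    by (simp add: M_def b_def algebra_simps)
  then have "Suc M ^ ?N \<le> b ^ ?N * Suc D ^ ?N"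
    by (simp add: power_mono flip: power_mult_distrib)
  also have "\<dots> < Suc D * Suc D ^ ?N" by (intro mult_strict_right_mono) (simp_all add: D_def)
  finally have lt: "card ?B < card E"
    using cardM card_image_le[OF finM, of "\<lambda>\<mu>. Poly_Mapping.single \<mu> (1::'k)"] E(2) by simp
  show ?thesis
  \<comment> \<open>Two exponent vectors with equal products already give a relation; otherwise the
    products are too many to be linearly independent.\<close>
  proof (cases "inj_on (list_monom fs) E")
    case False
    then obtain e e' where e: "e \<in> E" "e' \<in> E" "e \<noteq> e'" "list_monom fs e = list_monom fs e'"
      by (auto simp: inj_on_def)
    interpret c: comm_ring_hom "mp_const :: 'k \<Rightarrow> ('w, 'k) mpoly" by (rule mp_const_hom)
    show ?thesis
      by (rule exI[of _ "{e, e'}"], rule exI[of _ "\<lambda>x. if x = e then 1 else -1"])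
        (use e in \<open>auto simp: E_def len c.hom_uminus\<close>)
  next
    case True
    let ?G = "list_monom fs ` E"
    have "card ?G = card E" using True by (rule card_image)
    then have "dependent ?G"
      using independent_span_bound[OF finB, of ?G] gE lt by auto
    then obtain u where u: "\<exists>v\<in>?G. u v \<noteq> 0" "(\<Sum>v\<in>?G. mp_const (u v) * v) = 0"
      using dependent_finite[of ?G] E(1) by auto
    let ?F = "{e \<in> E. u (list_monom fs e) \<noteq> 0}"
    have "(\<Sum>e\<in>?F. mp_const (u (list_monom fs e)) * list_monom fs e) =
        (\<Sum>e\<in>E. mp_const (u (list_monom fs e)) * list_monom fs e)"
      using E(1) by (intro sum.mono_neutral_left) (auto simp: mp_const_def)
    also have "\<dots> = 0" using u(2) by (simp add: sum.reindex[OF True])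
    finally have sum: "(\<Sum>e\<in>?F. mp_const (u (list_monom fs e)) * list_monom fs e) = 0" .
    have "finite ?F" "?F \<noteq> {}" using E(1) u(1) by auto
    moreover have "length e = length fs" if "e \<in> E" for e using that by (simp add: E_def len)
    ultimately show ?thesis
      using sum by (intro exI[of _ ?F] exI[of _ "\<lambda>e. u (list_monom fs e)"]) simp
  qed
qed

text \<open>The lexicographically least exponent in a relation between elements \<open>x\<^sub>i\<close> of \<open>P\<^sub>i\<^sub>+\<^sub>1 - P\<^sub>i\<close> gives a
  contradiction.\<close>

lemma chain_no_relation:
  fixes P :: "nat \<Rightarrow> ('v, 'k::field) mpoly set"
  assumes "\<And>i. i \<le> length xs \<Longrightarrow> P i \<in> Spec (mp_ring W)" "\<And>i. i < length xs \<Longrightarrow> P i \<subseteq> P (Suc i)"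
    and "\<And>i. i < length xs \<Longrightarrow> xs ! i \<in> P (Suc i) - P i"
    and "finite F" "F \<noteq> {}" "\<And>e. e \<in> F \<Longrightarrow> length e = length xs" "\<And>e. e \<in> F \<Longrightarrow> c e \<noteq> 0"
  shows "(\<Sum>e\<in>F. mp_const (c e) * list_monom xs e) \<notin> P 0"
  using assms
proof (induction xs arbitrary: P F c)
  case Nil
  then have F: "F = {[]}" by auto
  interpret subring_prime "carrier (mp_ring W)" "P 0" using Nil(1)[of 0] by (simp add: Spec_iff)
  interpret c: comm_ring_hom "mp_const :: 'k \<Rightarrow> ('v, 'k) mpoly" by (rule mp_const_hom)
  have "mp_const (inverse (c [])) * mp_const (c []) = (1 :: ('v, 'k) mpoly)"
    using Nil.prems(7)[of "[]"] F by (simp flip: c.hom_mult)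
  moreover have "mp_const (inverse (c [])) \<in> carrier (mp_ring W :: ('v, 'k) mpoly ring)"
    by (simp add: carrier_mp_ring mp_vars_const)
  ultimately have "mp_const (c []) \<notin> P 0" using mult_J one_notin_J by metis
  then show ?case by (simp add: F)
next
  case (Cons x xs)
  interpret P0: subring_prime "carrier (mp_ring W)" "P 0" using Cons.prems(1)[of 0] by (simp add: Spec_iff)
  interpret P1: subring_prime "carrier (mp_ring W)" "P 1" using Cons.prems(1)[of 1] by (simp add: Spec_iff)
  have x: "x \<in> P 1" "x \<notin> P 0" using Cons.prems(3)[of 0] by auto
  have xc: "x \<in> carrier (mp_ring W)" using x P1.J_S by blast
  have xsc: "set xs \<subseteq> carrier (mp_ring W)"
  proof
    fix y assume "y \<in> set xs"
    then obtain i where i: "i < length xs" "y = xs ! i" by (auto simp: in_set_conv_nth)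
    have "subring_prime (carrier (mp_ring W)) (P (Suc (Suc i)))"
      using Cons.prems(1)[of "Suc (Suc i)"] i by (simp add: Spec_iff)
    then interpret P2: subring_prime "carrier (mp_ring W)" "P (Suc (Suc i))" .
    show "y \<in> carrier (mp_ring W)" using Cons.prems(3)[of "Suc i"] i P2.J_S by auto
  qed
  \<comment> \<open>The least exponent of \<open>x\<close>. The terms with this exponent make up
    \<open>x ^ a * A\<close>, and the others are divisible by \<open>x ^ (a + 1)\<close>.\<close>
  define a where "a = Min (hd ` F)"
  have cons: "hd e # tl e = e" "length (tl e) = length xs" if "e \<in> F" for e
    using Cons.prems(6)[OF that] by (cases e; simp)+
  have cons0: "a # tl e = e" if "e \<in> F" "hd e = a" for a e
    using cons(1)[OF that(1)] that(2) by simp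
  have a_le: "a \<le> hd e" if "e \<in> F" for e using that Cons.prems(4) by (simp add: a_def)
  have "a \<in> hd ` F" unfolding a_def using Cons.prems(4,5) by (intro Min_in) auto
  define F0 where "F0 = {e \<in> F. hd e = a}"
  have F0: "F0 \<noteq> {}" "finite F0" using \<open>a \<in> hd ` F\<close> Cons.prems(4) by (auto simp: F0_def)
  define R where "R = (\<Sum>e\<in>F - F0. mp_const (c e) * (x ^ (hd e - Suc a) * list_monom xs (tl e)))"
  define A where "A = (\<Sum>e\<in>F0. mp_const (c e) * list_monom xs (tl e))"
  have mc: "mp_const c \<in> carrier (mp_ring W :: ('v, 'k) mpoly ring)" for c :: 'k
    by (simp add: carrier_mp_ring mp_vars_const)
  have RA: "R \<in> carrier (mp_ring W)" "A \<in> carrier (mp_ring W)"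
    unfolding R_def A_def
    by (intro P0.sum_S P0.mult_S P0.power_S P0.list_monom_S mc xc xsc)+
  have t0: "list_monom (x # xs) e = x ^ a * list_monom xs (tl e)" if "e \<in> F0" for e
    using that by (subst cons0[of e a, symmetric]) (auto simp: F0_def)
  have t1: "list_monom (x # xs) e = x ^ a * (x * (x ^ (hd e - Suc a) * list_monom xs (tl e)))" if "e \<in> F - F0" for e
  proof -
    have "a < hd e" using that a_le[of e] by (auto simp: F0_def)
    then have "hd e = a + Suc (hd e - Suc a)" by simp
    then have "x ^ hd e = x ^ a * (x * x ^ (hd e - Suc a))" by (metis power_add power_Suc)
    moreover have "list_monom (x # xs) e = x ^ hd e * list_monom xs (tl e)"
      using that by (subst cons(1)[of e, symmetric]) auto
    ultimately show ?thesis by (simp only: mult.assoc)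
  qed
  have "(\<Sum>e\<in>F. mp_const (c e) * list_monom (x # xs) e) =
      (\<Sum>e\<in>F0. mp_const (c e) * list_monom (x # xs) e) + (\<Sum>e\<in>F - F0. mp_const (c e) * list_monom (x # xs) e)"
    using Cons.prems(4) by (subst sum.subset_diff[of F0 F]) (auto simp: F0_def add.commute)
  also have "(\<Sum>e\<in>F0. mp_const (c e) * list_monom (x # xs) e) = x ^ a * A"
    by (simp add: A_def sum_distrib_left t0 mult.left_commute cong: sum.cong)
  also have "(\<Sum>e\<in>F - F0. mp_const (c e) * list_monom (x # xs) e) = x ^ a * (x * R)"
    unfolding R_def sum_distrib_left by (intro sum.cong refl) (simp only: t1 mult.left_commute)
  finally have eq: "(\<Sum>e\<in>F. mp_const (c e) * list_monom (x # xs) e) = x ^ a * (A + x * R)"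
    by (simp add: distrib_left)
  show ?case
  proof
    \<comment> \<open>As \<open>x\<close> avoids the prime \<open>P 0\<close>, the factor
      \<open>x ^ a\<close> can be removed. Passing to \<open>P 1\<close>, which contains
      \<open>x\<close>, leaves the relation \<open>A\<close> for the remaining elements.\<close>
    assume "(\<Sum>e\<in>F. mp_const (c e) * list_monom (x # xs) e) \<in> P 0"
    then have "x ^ a * (A + x * R) \<in> P 0" by (simp only: eq)
    then have "A + x * R \<in> P 0"
      using P0.prime_J[OF P0.power_S[OF xc] P0.add_S[OF RA(2) P0.mult_S[OF xc RA(1)]]]
        P0.power_notin_J[OF xc x(2)] by metis
    moreover have "P 0 \<subseteq> P 1" using Cons.prems(2)[of 0] by simp
    ultimately have "A + x * R \<in> P 1" by (rule rev_subsetD)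
    moreover have "x * R \<in> P 1" using P1.mult_J_right[OF x(1) RA(1)] .
    ultimately have A1: "A \<in> P 1" using P1.diff_J[of "A + x * R" "x * R"] by simp
    have inj: "inj_on tl F0"
    proof (rule inj_onI)
      fix e e' assume e: "e \<in> F0" "e' \<in> F0" "tl e = tl e'"
      have "e = a # tl e" by (rule cons0[symmetric]) (use e in \<open>simp_all add: F0_def\<close>)
      also have "\<dots> = a # tl e'" by (simp only: e(3))
      also have "\<dots> = e'" by (rule cons0) (use e in \<open>simp_all add: F0_def\<close>)
      finally show "e = e'" .
    qed
    have "(\<Sum>e\<in>tl ` F0. mp_const (c (a # e)) * list_monom xs e) \<notin> P (Suc 0)"
    proof (rule Cons.IH[of "\<lambda>i. P (Suc i)" "tl ` F0" "\<lambda>e. c (a # e)"])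
      show "P (Suc i) \<in> Spec (mp_ring W)" if "i \<le> length xs" for i using Cons.prems(1)[of "Suc i"] that by simp
      show "P (Suc i) \<subseteq> P (Suc (Suc i))" if "i < length xs" for i using Cons.prems(2)[of "Suc i"] that by simp
      show "xs ! i \<in> P (Suc (Suc i)) - P (Suc i)" if "i < length xs" for i
        using Cons.prems(3)[of "Suc i"] that by simp
      show "finite (tl ` F0)" "tl ` F0 \<noteq> {}" using F0 by auto
      show "length e = length xs" if "e \<in> tl ` F0" for e using that cons(2) by (auto simp: F0_def)
      show "c (a # e) \<noteq> 0" if "e \<in> tl ` F0" for e
      proof -
        obtain e' where e': "e' \<in> F0" "e = tl e'" using \<open>e \<in> tl ` F0\<close> by blast
        then have "a # e = e'" "e' \<in> F" using cons0[of e' a] by (simp_all add: F0_def)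
        then show ?thesis using Cons.prems(7)[of e'] by simp
      qed
    qed
    moreover have "(\<Sum>e\<in>tl ` F0. mp_const (c (a # e)) * list_monom xs e) = A"
      unfolding A_def sum.reindex[OF inj] o_def
    proof (intro sum.cong refl)
      fix e assume "e \<in> F0"
      then have "a # tl e = e" using cons0[of e a] by (simp add: F0_def)
      then show "mp_const (c (a # tl e)) * list_monom xs (tl e) = mp_const (c e) * list_monom xs (tl e)" by simp
    qed
    ultimately show False using A1 by simp
  qed
qed

text \<open>From a chain that is too long, pick one new element per step. Their images in the
  polynomial ring on \<open>Y\<close> are algebraically dependent; the same relation among the
  elements lies in the kernel and hence in \<open>P 0\<close>, against
  \<open>chain_no_relation\<close>.\<close>

lemma chain_length_le:
  fixes y :: "'v \<Rightarrow> ('w, 'k::field) mpoly"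
  assumes Y: "finite Y" and y: "\<And>v. v \<in> W \<Longrightarrow> mp_vars (y v) \<subseteq> Y"
    and P: "\<And>i. i \<le> n \<Longrightarrow> P i \<in> Spec (mp_ring W)" "\<And>i. i < n \<Longrightarrow> P i \<subset> P (Suc i)"
    and K: "pt mp_const y {0} W \<subseteq> P 0"
  shows "n \<le> card Y"
proof (rule ccontr)
  assume n: "\<not> n \<le> card Y"
  let ?N = "Suc (card Y)"
  define x where "x i = (SOME x. x \<in> P (Suc i) - P i)" for i
  have x: "x i \<in> P (Suc i) - P i" if "i < n" for i
    unfolding x_def by (rule someI_ex) (rule psubset_imp_ex_mem[OF P(2)[OF that]])
  define xs where "xs = map x [0..<?N]"
  have len: "length xs = ?N" by (simp add: xs_def)
  interpret M: subring_ideal "carrier (mp_ring W)" "{0 :: ('v, 'k) mpoly}" by (rule mp_ring_subring)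
  interpret MY: subring_ideal "carrier (mp_ring Y)" "{0 :: ('w, 'k) mpoly}" by (rule mp_ring_subring)
  let ?f = "mp_eval mp_const y"
  have f: "comm_ring_hom ?f" by (rule mp_eval_hom[OF mp_const_hom])
  interpret f: comm_ring_hom ?f by (rule f)
  have xc: "x i \<in> carrier (mp_ring W)" if "i < n" for i
    using x[OF that] P(1)[of "Suc i"] that subring_ideal.J_S[OF subring_prime.axioms(1)[OF Spec_prime]] by fastforce
  have "set (map ?f xs) \<subseteq> carrier (mp_ring Y)"
  proof
    fix q assume "q \<in> set (map ?f xs)"
    then obtain i where i: "i < ?N" "q = ?f (x i)" by (auto simp: xs_def simp del: upt_Suc)
    then have "x i \<in> carrier (mp_ring W)" using n by (intro xc) simp
    then show "q \<in> carrier (mp_ring Y)"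
      unfolding i(2) using y by (intro MY.mp_eval_S) (auto simp: carrier_mp_ring mp_vars_const)
  qed
  from algebraic_dependence[OF Y this] obtain F c where
    "finite F \<and> F \<noteq> {} \<and> (\<forall>e\<in>F. length e = length (map ?f xs) \<and> c e \<noteq> 0) \<and>
      (\<Sum>e\<in>F. mp_const (c e) * list_monom (map ?f xs) e) = 0"
    by (elim exE meta_impE) (simp_all add: len)
  then have F: "finite F" "F \<noteq> {}" "\<And>e. e \<in> F \<Longrightarrow> length e = length xs" "\<And>e. e \<in> F \<Longrightarrow> c e \<noteq> 0"
    "(\<Sum>e\<in>F. mp_const (c e) * list_monom (map ?f xs) e) = 0"
    by simp_all
  let ?s = "\<Sum>e\<in>F. mp_const (c e) * list_monom xs e"
  have "?f ?s = 0"
    using F(5) by (simp add: f.hom_sum f.hom_mult hom_list_monom[OF f] mp_eval_const[OF mp_const_hom])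
  moreover have "set xs \<subseteq> carrier (mp_ring W)" using xc n by (auto simp: xs_def)
  then have "?s \<in> carrier (mp_ring W)"
    by (intro M.sum_S M.mult_S M.list_monom_S) (auto simp: carrier_mp_ring mp_vars_const)
  ultimately have "?s \<in> P 0" using K by (auto simp: pt_def)
  moreover have "?s \<notin> P 0"
  proof (rule chain_no_relation[of xs P W F c])
    show "P i \<in> Spec (mp_ring W)" if "i \<le> length xs" for i using that n len by (intro P) simp
    show "P i \<subseteq> P (Suc i)" if "i < length xs" for i using that n len P(2)[of i] by auto
    show "xs ! i \<in> P (Suc i) - P i" if "i < length xs" for i
    proof -
      have "xs ! i = x i" "i < n" using that len n by (simp_all add: xs_def del: upt_Suc)
      then show ?thesis using x by simp
    qed
  qed (fact F)+
  ultimately show False by blast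
qed

section \<open>The order of the Jacobian ideal along an orbit\<close>

lemma mp_deriv_superset:
  assumes "finite S" "Poly_Mapping.keys p \<subseteq> S"
  shows "mp_deriv v p = (\<Sum>\<mu>\<in>S. Poly_Mapping.single (\<mu> - Poly_Mapping.single v 1)
    (of_nat (Poly_Mapping.lookup \<mu> v) * Poly_Mapping.lookup p \<mu>))"
  unfolding mp_deriv_def using assms by (intro sum.mono_neutral_left) (auto simp: in_keys_iff)

lemma mp_deriv_single:
  "mp_deriv v (Poly_Mapping.single \<mu> c) =
    Poly_Mapping.single (\<mu> - Poly_Mapping.single v 1) (of_nat (Poly_Mapping.lookup \<mu> v) * c)"
  by (subst mp_deriv_superset[of "{\<mu>}"]) auto

lemma mp_deriv_add: "mp_deriv v (p + q) = mp_deriv v p + mp_deriv v q"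
proof -
  let ?S = "Poly_Mapping.keys p \<union> Poly_Mapping.keys q"
  have *: "mp_deriv v r = (\<Sum>\<mu>\<in>?S. Poly_Mapping.single (\<mu> - Poly_Mapping.single v 1)
    (of_nat (Poly_Mapping.lookup \<mu> v) * Poly_Mapping.lookup r \<mu>))" if "Poly_Mapping.keys r \<subseteq> ?S" for r
    using that by (intro mp_deriv_superset) auto
  show ?thesis
    using Poly_Mapping.keys_add[of p q]
    by (simp add: * lookup_add distrib_left single_add sum.distrib)
qed

lemma mp_deriv_0 [simp]: "mp_deriv v 0 = 0"
  by (simp add: mp_deriv_def)

lemma mp_deriv_sum: "mp_deriv v (\<Sum>a\<in>A. f a) = (\<Sum>a\<in>A. mp_deriv v (f a))"
  by (induction A rule: infinite_finite_induct) (auto simp: mp_deriv_add)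

lemma mp_deriv_mult: "mp_deriv v (p * q) = mp_deriv v p * q + p * mp_deriv v q"
proof -
  let ?s = "\<lambda>p \<mu>. Poly_Mapping.single \<mu> (Poly_Mapping.lookup p \<mu>)"
  \<comment> \<open>Subtraction of exponents is truncated, so the shift needs \<open>v\<close> to
    occur in the monomial; otherwise the coefficient in the derivative is 0.\<close>
  have shift: "\<alpha> - Poly_Mapping.single v 1 + \<beta> = \<alpha> + \<beta> - Poly_Mapping.single v 1"
    if "Poly_Mapping.lookup \<alpha> v \<noteq> 0" for \<alpha> \<beta> :: "'a \<Rightarrow>\<^sub>0 nat"
    using that by (intro poly_mapping_eqI) (auto simp: lookup_add lookup_minus lookup_single when_def)
  have s: "mp_deriv v (Poly_Mapping.single \<alpha> a * Poly_Mapping.single \<beta> b) =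
      mp_deriv v (Poly_Mapping.single \<alpha> a) * Poly_Mapping.single \<beta> b +
      Poly_Mapping.single \<alpha> a * mp_deriv v (Poly_Mapping.single \<beta> b)" for \<alpha> \<beta> :: "'a \<Rightarrow>\<^sub>0 nat" and a b :: 'b
  proof -
    have 1: "mp_deriv v (Poly_Mapping.single \<alpha> a) * Poly_Mapping.single \<beta> b =
        Poly_Mapping.single (\<alpha> + \<beta> - Poly_Mapping.single v 1) (of_nat (Poly_Mapping.lookup \<alpha> v) * (a * b))"
      using shift[of \<alpha> \<beta>]
      by (cases "Poly_Mapping.lookup \<alpha> v = 0") (auto simp: mp_deriv_single mult_single mult.assoc)
    have 2: "Poly_Mapping.single \<alpha> a * mp_deriv v (Poly_Mapping.single \<beta> b) =
        Poly_Mapping.single (\<alpha> + \<beta> - Poly_Mapping.single v 1) (of_nat (Poly_Mapping.lookup \<beta> v) * (a * b))"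
      using shift[of \<beta> \<alpha>]
      by (cases "Poly_Mapping.lookup \<beta> v = 0") (auto simp: mp_deriv_single mult_single add.commute mult_ac)
    show ?thesis
      unfolding 1 2 by (simp add: mult_single mp_deriv_single lookup_add distrib_right single_add)
  qed
  have p: "p = (\<Sum>\<alpha>\<in>Poly_Mapping.keys p. ?s p \<alpha>)" and q: "q = (\<Sum>\<beta>\<in>Poly_Mapping.keys q. ?s q \<beta>)"
    by (rule mp_sum_single)+
  have "mp_deriv v ((\<Sum>\<alpha>\<in>A. ?s p \<alpha>) * (\<Sum>\<beta>\<in>B. ?s q \<beta>)) =
      mp_deriv v (\<Sum>\<alpha>\<in>A. ?s p \<alpha>) * (\<Sum>\<beta>\<in>B. ?s q \<beta>) + (\<Sum>\<alpha>\<in>A. ?s p \<alpha>) * mp_deriv v (\<Sum>\<beta>\<in>B. ?s q \<beta>)" for A B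
    by (simp add: sum_product mp_deriv_sum s sum.distrib)
  from this[of "Poly_Mapping.keys p" "Poly_Mapping.keys q"] show ?thesis
    by (simp flip: p q)
qed

lemma mp_deriv_var: "mp_deriv v (mp_var u) = (if u = v then 1 else 0)"
  by (auto simp: mp_var_def mp_deriv_single lookup_single)

lemma mp_deriv_eq_0: "v \<notin> mp_vars p \<Longrightarrow> mp_deriv v p = 0"
  unfolding mp_deriv_def by (intro sum.neutral) (auto simp: mp_vars_def in_keys_iff)

lemma mp_vars_deriv: "mp_vars (mp_deriv v p) \<subseteq> mp_vars p"
proof -
  have "mp_deriv v p \<in> carrier (mp_ring (mp_vars p))"
    unfolding mp_deriv_def
  proof (rule subring_ideal.sum_S[OF mp_ring_subring])
    fix \<mu> assume \<mu>: "\<mu> \<in> Poly_Mapping.keys p"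
    have "Poly_Mapping.keys (\<mu> - Poly_Mapping.single v 1) \<subseteq> Poly_Mapping.keys \<mu>"
      by (auto simp: in_keys_iff lookup_minus)
    then show "Poly_Mapping.single (\<mu> - Poly_Mapping.single v 1)
        (of_nat (Poly_Mapping.lookup \<mu> v) * Poly_Mapping.lookup p \<mu>) \<in> carrier (mp_ring (mp_vars p))"
      using \<mu> by (auto simp: carrier_mp_ring mp_vars_def)
  qed
  then show ?thesis by (simp add: carrier_mp_ring)
qed

section \<open>Derivatives of minors and Jacobian minors\<close>

text \<open>The increasing map that omits the value \<open>i\<close>; composing with it deletes a
  row or a column.\<close>

definition skip :: "nat \<Rightarrow> nat \<Rightarrow> nat" where
  "skip i a = (if a < i then a else Suc a)"

lemma minor_laplace:
  assumes "a < Suc k"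
  shows "minor (Suc k) M \<alpha> \<beta> =
    (\<Sum>b<Suc k. M (\<alpha> a) (\<beta> b) * ((-1) ^ (a + b) * minor k M (\<alpha> \<circ> skip a) (\<beta> \<circ> skip b)))"
proof -
  let ?A = "mat (Suc k) (Suc k) (\<lambda>(a, b). M (\<alpha> a) (\<beta> b))"
  have "mat_delete ?A a b = mat k k (\<lambda>(i, j). M ((\<alpha> \<circ> skip a) i) ((\<beta> \<circ> skip b) j))" for b
    unfolding mat_delete_def by (intro eq_matI) (auto simp: skip_def)
  then have "cofactor ?A a b = (-1) ^ (a + b) * minor k M (\<alpha> \<circ> skip a) (\<beta> \<circ> skip b)" for b
    by (simp add: cofactor_def minor_def)
  then show ?thesis
    unfolding minor_def[of "Suc k"] using assms
    by (subst laplace_expansion_row[of _ "Suc k" a]) (auto intro!: sum.cong)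
qed

text \<open>Expand along row \<open>a\<close>. As \<alpha> is injective, the cofactors contain no
  variable of the row \<open>\<alpha> a\<close>, so only the entries are differentiated. Columns may
  repeat, hence the sum over \<open>b\<close>.\<close>

lemma mp_deriv_pminor:
  assumes a: "a < Suc k" and inj: "inj_on \<alpha> {0..<Suc k}"
  shows "mp_deriv (\<alpha> a, j) (pminor (Suc k) \<alpha> \<beta> :: (_, 'k::comm_ring_1) mpoly) =
    (\<Sum>b<Suc k. if \<beta> b = j then (-1) ^ (a + b) * pminor k (\<alpha> \<circ> skip a) (\<beta> \<circ> skip b) else 0)"
proof -
  have c: "mp_deriv (\<alpha> a, j) ((-1) ^ (a + b) * pminor k (\<alpha> \<circ> skip a) (\<beta> \<circ> skip b)) = (0 :: (_, 'k) mpoly)" for b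
  proof (rule mp_deriv_eq_0)
    interpret subring_ideal "carrier (mp_ring ((- {\<alpha> a}) \<times> UNIV))" "{0 :: (nat \<times> nat, 'k) mpoly}"
      by (rule mp_ring_subring)
    have "\<alpha> (skip a i) \<noteq> \<alpha> a" if "i < k" for i
      using that a inj_onD[OF inj, of "skip a i" a] by (auto simp: skip_def split: if_splits)
    then have "mp_vars (pminor k (\<alpha> \<circ> skip a) (\<beta> \<circ> skip b) :: (_, 'k) mpoly) \<subseteq> (- {\<alpha> a}) \<times> UNIV"
      by (intro mp_vars_pminor) auto
    then have "(-1) ^ (a + b) * pminor k (\<alpha> \<circ> skip a) (\<beta> \<circ> skip b) \<in>
        carrier (mp_ring ((- {\<alpha> a}) \<times> UNIV) :: (nat \<times> nat, 'k) mpoly ring)"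
      by (intro mult_S power_S uminus_S one_S) (simp add: carrier_mp_ring)
    then show "(\<alpha> a, j) \<notin> mp_vars ((-1) ^ (a + b) * pminor k (\<alpha> \<circ> skip a) (\<beta> \<circ> skip b) :: (_, 'k) mpoly)"
      unfolding carrier_mp_ring by blast
  qed
  define C where "C b = (-1) ^ (a + b) * (pminor k (\<alpha> \<circ> skip a) (\<beta> \<circ> skip b) :: (_, 'k) mpoly)" for b
  have "mp_deriv (\<alpha> a, j) (mp_var (\<alpha> a, \<beta> b) * C b) = (if \<beta> b = j then C b else 0)" for b
    using c[of b, folded C_def] by (simp add: mp_deriv_mult mp_deriv_var)
  moreover have "(pminor (Suc k) \<alpha> \<beta> :: (_, 'k) mpoly) = (\<Sum>b<Suc k. mp_var (\<alpha> a, \<beta> b) * C b)"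
    unfolding pminor_def C_def by (rule minor_laplace[OF a])
  ultimately show ?thesis
    unfolding C_def[symmetric] by (simp only: mp_deriv_sum)
qed

lemma mp_deriv_pminor_0:
  assumes "i \<notin> \<alpha> ` {0..<k}"
  shows "mp_deriv (i, j) (pminor k \<alpha> \<beta>) = 0"
proof (rule mp_deriv_eq_0)
  have "mp_vars (pminor k \<alpha> \<beta>) \<subseteq> (- {i}) \<times> UNIV"
    using assms by (intro mp_vars_pminor) auto
  then show "(i, j) \<notin> mp_vars (pminor k \<alpha> \<beta>)" by blast
qed

text \<open>By the product rule, the polynomials that vanish at \<open>x\<close> and whose partial
  derivatives there are divisible by \<open>t\<close> form an ideal. It contains the
  \<open>(k+1)\<close>-minors, whose derivatives are signed sums of \<open>k\<close>-minors.\<close>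

lemma dvd_deriv_minors_ideal:
  fixes h :: "'k::comm_ring_1 \<Rightarrow> 'b::comm_ring_1"
  assumes h: "comm_ring_hom h" and k: "\<And>\<alpha> \<beta>. t dvd minor k (\<lambda>i j. x (i, j)) \<alpha> \<beta>"
    and Suc_k: "\<And>\<alpha> \<beta>. \<alpha> \<in> {0..<Suc k} \<rightarrow> {0..<m} \<Longrightarrow> minor (Suc k) (\<lambda>i j. x (i, j)) \<alpha> \<beta> = 0"
    and f: "f \<in> minors_ideal m (Suc k)"
  shows "mp_eval h x f = 0" "t dvd mp_eval h x (mp_deriv v f)"
proof -
  interpret e: comm_ring_hom "mp_eval h x" by (rule mp_eval_hom[OF h])
  interpret M: subring_ideal "carrier (mp_ring (mat_coords m))" "{0 :: (_, 'k) mpoly}" by (rule mp_ring_subring)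
  let ?I = "{f \<in> carrier (mp_ring (mat_coords m)). mp_eval h x f = 0 \<and> (\<forall>v. t dvd mp_eval h x (mp_deriv v f))}"
  have "minors_ideal m (Suc k) \<subseteq> ?I"
  proof (rule minors_ideal_least)
    show "subring_ideal (carrier (mp_ring (mat_coords m))) ?I"
    proof
      fix p q
      show "p + q \<in> ?I" if "p \<in> ?I" "q \<in> ?I"
        using that by (simp add: M.add_S e.hom_add mp_deriv_add dvd_add)
      show "p * q \<in> ?I" if "p \<in> carrier (mp_ring (mat_coords m))" "q \<in> ?I"
        using that by (simp add: M.mult_S e.hom_mult e.hom_add mp_deriv_mult dvd_mult)
    qed (simp_all add: M.add_S M.mult_S M.uminus_S M.one_S M.zero_S)
    fix \<alpha> \<beta> assume \<alpha>: "\<alpha> \<in> {0..<Suc k} \<rightarrow> {0..<m}" and \<beta>: "\<beta> \<in> {0..<Suc k} \<rightarrow> {0..<m}"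
      and inj: "inj_on \<alpha> {0..<Suc k}"
    have "t dvd mp_eval h x (mp_deriv (i, j) (pminor (Suc k) \<alpha> \<beta>))" for i j
    proof (cases "i \<in> \<alpha> ` {0..<Suc k}")
      case True
      then obtain a where a: "a < Suc k" "i = \<alpha> a" by auto
      have "t dvd mp_eval h x (if \<beta> b = j then (-1) ^ (a + b) * pminor k (\<alpha> \<circ> skip a) (\<beta> \<circ> skip b) else 0)" for b
        using k by (simp add: e.hom_mult mp_eval_pminor[OF h])
      then show ?thesis
        unfolding a(2) mp_deriv_pminor[OF a(1) inj] e.hom_sum by (rule dvd_sum)
    qed (simp add: mp_deriv_pminor_0)
    then show "pminor (Suc k) \<alpha> \<beta> \<in> ?I"
      using mp_vars_pminor[OF \<alpha> \<beta>] Suc_k[OF \<alpha>]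
      by (auto simp: carrier_mp_ring mp_eval_pminor[OF h] lessThan_atLeast0)
  qed
  from subsetD[OF this f] have *: "mp_eval h x f = 0" "\<forall>v. t dvd mp_eval h x (mp_deriv v f)" by blast+
  show "mp_eval h x f = 0" "t dvd mp_eval h x (mp_deriv v f)" by (rule *(1), rule spec[OF *(2)])
qed

lemma dvd_det:
  assumes "\<And>i j. i < c \<Longrightarrow> j < c \<Longrightarrow> t dvd (g i j :: 'b::comm_ring_1)"
  shows "t ^ c dvd minor c g id id"
  unfolding minor_leibniz
proof (intro dvd_sum dvd_mult)
  fix \<pi> assume "\<pi> \<in> {\<pi>. \<pi> permutes {0..<c}}"
  then have \<pi>: "\<pi> a < c" if "a < c" for a using that permutes_in_image[of \<pi> "{0..<c}" a] by auto
  have "(\<Prod>a = 0..<c. t) dvd (\<Prod>a = 0..<c. g (id a) (id (\<pi> a)))"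
    using \<pi> by (intro prod_dvd_prod assms) auto
  then show "t ^ c dvd (\<Prod>a = 0..<c. g (id a) (id (\<pi> a)))" by simp
qed

text \<open>The \<open>c\<close>-th powers of \<open>k\<close>-minors are Jacobian minors, for \<open>c = (m - k)\<^sup>2\<close>: enlarge the \<open>k\<close>-minor by
  one row and one column in all possible ways and differentiate by the new corner.\<close>

lemma pminor_power_in_jac_minors:
  assumes \<alpha>: "\<alpha> \<in> {0..<k} \<rightarrow> {0..<m}" "inj_on \<alpha> {0..<k}" and \<beta>: "\<beta> \<in> {0..<k} \<rightarrow> {0..<m}" "inj_on \<beta> {0..<k}"
  shows "pminor k \<alpha> \<beta> ^ ((m - k) ^ 2) \<in>
    jac_minors (mat_coords m) (minors_ideal m (Suc k) :: (_, 'k::comm_ring_1) mpoly set) ((m - k) ^ 2)"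
proof -
  let ?A = "{0..<m} - \<alpha> ` {0..<k}" and ?B = "{0..<m} - \<beta> ` {0..<k}" and ?c = "(m - k) ^ 2"
  have compl: "card ({0..<m} - \<gamma> ` {0..<k}) = m - k" if "\<gamma> \<in> {0..<k} \<rightarrow> {0..<m}" "inj_on \<gamma> {0..<k}" for \<gamma>
  proof -
    have "card ({0..<m} - \<gamma> ` {0..<k}) = card {0..<m} - card (\<gamma> ` {0..<k})"
      by (rule card_Diff_subset) (use that(1) in auto)
    then show ?thesis by (simp add: card_image[OF that(2)])
  qed
  have "card (?A \<times> ?B) = ?c"
    by (simp only: card_cartesian_product compl[OF \<alpha>] compl[OF \<beta>] power2_eq_square)
  moreover have "finite (?A \<times> ?B)" by simp
  ultimately obtain w where w: "bij_betw w {0..<?c} (?A \<times> ?B)"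
    using ex_bij_betw_nat_finite[of "?A \<times> ?B"] by metis
  define f where "f a = (pminor (Suc k) (\<alpha>(k := fst (w a))) (\<beta>(k := snd (w a))) :: (_, 'k) mpoly)" for a
  have wAB: "fst (w a) \<in> ?A" "snd (w a) \<in> ?B" if "a < ?c" for a
    using bij_betwE[OF w] that by (auto simp: mem_Times_iff)
  have f: "f a \<in> minors_ideal m (Suc k)" if "a < ?c" for a
    unfolding f_def
  proof (rule pminor_in_minors_ideal)
    show "\<alpha>(k := fst (w a)) \<in> {0..<Suc k} \<rightarrow> {0..<m}" "\<beta>(k := snd (w a)) \<in> {0..<Suc k} \<rightarrow> {0..<m}"
      unfolding atLeast0_lessThan_Suc using wAB[OF that] funcset_mem[OF \<alpha>(1)] funcset_mem[OF \<beta>(1)]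
      by (simp_all add: Pi_iff)
  qed
  \<comment> \<open>This part of the Jacobian matrix is scalar: the corner \<open>w b\<close> is a
    variable of the enlarged minor \<open>f a\<close> only if \<open>w a = w b\<close>, and its
    cofactor there is the original minor.\<close>
  have deriv: "mp_deriv (w b) (f a) = (if a = b then pminor k \<alpha> \<beta> else 0)" if ab: "a < ?c" "b < ?c" for a b
  proof (cases "fst (w b) = fst (w a)")
    case True
    let ?\<alpha> = "\<alpha>(k := fst (w a))" and ?\<beta> = "\<beta>(k := snd (w a))"
    have inj: "inj_on ?\<alpha> {0..<Suc k}"
    proof -
      have "inj_on ?\<alpha> {0..<k}" by (rule inj_on_cong[THEN iffD1, OF _ \<alpha>(2)]) simp
      moreover have "?\<alpha> ` ({0..<k} - {k}) = \<alpha> ` {0..<k}" by (rule image_cong) simp_all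
      ultimately show ?thesis
        unfolding atLeast0_lessThan_Suc inj_on_insert using wAB(1)[OF ab(1)] by simp
    qed
    have wb: "w b = (?\<alpha> k, snd (w b))" using True by (simp add: prod_eq_iff)
    have "mp_deriv (w b) (f a) =
      (\<Sum>b'<Suc k. if ?\<beta> b' = snd (w b) then (-1) ^ (k + b') * pminor k (?\<alpha> \<circ> skip k) (?\<beta> \<circ> skip b') else 0)"
      unfolding f_def by (subst wb, rule mp_deriv_pminor[OF _ inj]) simp
    also have "\<dots> = (\<Sum>b'\<in>{k}. if ?\<beta> b' = snd (w b) then (-1) ^ (k + b') * pminor k (?\<alpha> \<circ> skip k) (?\<beta> \<circ> skip b') else 0)"
    proof (rule sum.mono_neutral_right)
      have "\<beta> i \<noteq> snd (w b)" if "i < k" for i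
      proof
        assume "\<beta> i = snd (w b)"
        then have "snd (w b) \<in> \<beta> ` {0..<k}" using that by (intro image_eqI[of _ _ i]) simp_all
        then show False using wAB(2)[OF ab(2)] by simp
      qed
      then show "\<forall>i\<in>{..<Suc k} - {k}. (if ?\<beta> i = snd (w b) then (-1) ^ (k + i) *
          pminor k (?\<alpha> \<circ> skip k) (?\<beta> \<circ> skip i) else (0 :: (_, 'k) mpoly)) = 0"
        by (simp add: lessThan_Suc)
    qed simp_all
    also have "\<dots> = (if snd (w a) = snd (w b) then pminor k (?\<alpha> \<circ> skip k) (?\<beta> \<circ> skip k) else 0)"
      by (simp add: power_add flip: power_mult_distrib)
    also have "pminor k (?\<alpha> \<circ> skip k) (?\<beta> \<circ> skip k) = (pminor k \<alpha> \<beta> :: (_, 'k) mpoly)"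
      unfolding pminor_def by (rule minor_cong) (auto simp: skip_def)
    also have "snd (w a) = snd (w b) \<longleftrightarrow> a = b"
    proof
      assume "snd (w a) = snd (w b)"
      then have "w a = w b" using True by (simp add: prod_eq_iff)
      then show "a = b" using inj_onD[OF bij_betw_imp_inj_on[OF w], of a b] ab by simp
    qed simp
    finally show ?thesis .
  next
    case False
    have eq: "(\<alpha>(k := fst (w a))) ` {0..<k} = \<alpha> ` {0..<k}" by (rule image_cong) simp_all
    have "fst (w b) \<notin> (\<alpha>(k := fst (w a))) ` {0..<Suc k}"
      unfolding atLeast0_lessThan_Suc image_insert eq using wAB(1)[OF ab(2)] False by simp
    then have "mp_deriv (fst (w b), snd (w b)) (f a) = 0"
      unfolding f_def by (rule mp_deriv_pminor_0)
    moreover have "a \<noteq> b" using False by blast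
    ultimately show ?thesis by simp
  qed
  have "mat ?c ?c (\<lambda>(a, b). mp_deriv (w b) (f a)) = pminor k \<alpha> \<beta> \<cdot>\<^sub>m 1\<^sub>m ?c"
    by (intro eq_matI) (simp_all add: deriv)
  then have det: "Determinant.det (mat ?c ?c (\<lambda>(a, b). mp_deriv (w b) (f a))) = pminor k \<alpha> \<beta> ^ ?c" by simp
  have "w b \<in> mat_coords m" if "b < ?c" for b
    using wAB[OF that] by (simp add: mem_Times_iff)
  then show ?thesis
    unfolding jac_minors_def using f by (intro CollectI exI[of _ f] exI[of _ w] conjI det[symmetric]) simp_all
qed

lemma card_coords_minus: "k \<le> m \<Longrightarrow> card (mat_coords m) - k * (2 * m - k) = (m - k) ^ 2"
proof -
  assume "k \<le> m"
  then obtain d where "m = k + d" using le_Suc_ex by blast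
  then show ?thesis by (simp add: card_cartesian_product power2_eq_square algebra_simps)
qed

text \<open>The arc is lifted to the universal product \<open>g D h\<close> over a point of the
  group. There the divisibility of the \<open>k\<close>-minors by \<open>t^L\<close> and the
  vanishing of the \<open>(k+1)\<close>-minors are identities, not just congruences, as required for
  \<open>dvd_deriv_minors_ideal\<close>. The resulting bound is attained by the power of a
  \<open>k\<close>-minor of order \<open>L\<close>.\<close>

lemma arc_ord_Jac:
  fixes \<gamma> :: "'k::field mat_jet"
  assumes ok: "lam_ok m k (\<lambda>p. lam (Suc p))" and L: "tail_sum m (\<lambda>p. lam (Suc p)) k = enat L"
    and \<gamma>: "\<gamma> \<in> C_orbit m lam"
  shows "arc_ord (Jac (mat_coords m) (minors_ideal m (k + 1)) (k * (2 * m - k))) \<gamma> = enat ((m - k) ^ 2 * L)"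
proof -
  let ?\<mu> = "\<lambda>p. lam (Suc p)" and ?c = "(m - k) ^ 2"
  let ?I = "minors_ideal m (Suc k) :: (_, 'k) mpoly set"
  let ?Jac = "Jac (mat_coords m) ?I (k * (2 * m - k))"
  have km: "k \<le> m" and anti: "antitone m ?\<mu>" using ok by (auto simp: lam_ok_def)
  have Jac_eq: "?Jac = genideal (mp_ring (mat_coords m)) (?I \<union> jac_minors (mat_coords m) ?I ?c)"
    by (simp only: Jac_def card_coords_minus[OF km])
  obtain Q where Q: "Q \<in> GG_arcs m" "\<gamma> = pt mp_const (orbit_pt m ?\<mu> mp_var) Q (mat_coords m \<times> UNIV)"
    using \<gamma> by (auto simp: C_orbit_eq)
  define z where "z = (orbit_pt m ?\<mu> mp_var :: _ \<Rightarrow> 'k GG_poly)"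
  interpret subring_prime "carrier (mp_ring (GG_vars m))" Q using Q by (auto simp: GG_arcs_iff Spec_iff)
  interpret M: subring_ideal "carrier (mp_ring (mat_coords m))" "{0 :: (_, 'k) mpoly}" by (rule mp_ring_subring)
  have zS: "z (v, s) \<in> carrier (mp_ring (GG_vars m))" if "v \<in> mat_coords m" for v s
    unfolding z_def by (rule orbit_pt_S[OF _ that]) (simp add: carrier_mp_ring mp_vars_var)
  have cS: "mp_const c \<in> carrier (mp_ring (GG_vars m) :: 'k GG_poly ring)" for c
    by (simp add: carrier_mp_ring mp_vars_const)
  let ?ev = "arc_eval mp_const z :: (_, 'k) mpoly \<Rightarrow> _"
  interpret e: comm_ring_hom ?ev by (rule arc_eval_hom[OF mp_const_hom])
  have marc: "marc z = gdh m (garc mp_var) ?\<mu> (harc mp_var)" by (simp add: z_def marc_orbit_pt)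
  have kdvd: "tpow (enat L) dvd minor k (marc z) \<alpha> \<beta>" for \<alpha> \<beta>
    unfolding marc using tpow_dvd_minor_gdh[OF anti, of k] by (simp add: L)
  have Suc0: "minor (Suc k) (marc z) \<alpha> \<beta> = 0" if "\<alpha> \<in> {0..<Suc k} \<rightarrow> {0..<m}" for \<alpha> \<beta>
  proof (cases "k < m")
    case True
    have "tail_sum m ?\<mu> (Suc k) = \<infinity>" using ok True tail_sum_Suc[OF True, of ?\<mu>] by (simp add: lam_ok_def)
    then show ?thesis
      unfolding marc using tpow_dvd_minor_gdh[OF anti, of "Suc k"] by (simp add: tpow_def)
  next
    case False
    then show ?thesis using that by (intro minor_eq_0_large) auto
  qed
  have I: "?ev f = 0" "tpow (enat L) dvd ?ev (mp_deriv v f)" if "f \<in> ?I" for f v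
    using dvd_deriv_minors_ideal[OF fps_const_comp_hom[OF mp_const_hom], of "tpow (enat L)" k "arc_of z" m f]
      kdvd Suc0 that unfolding arc_eval_def marc_def[abs_def] by blast+
  have tpow_power: "tpow (enat L) ^ c = (tpow (enat (c * L)) :: 'k GG_poly fps)" for c
    by (simp add: tpow_def power_mult mult.commute)
  have jc: "jet_coeff s f \<in> \<gamma> \<longleftrightarrow> fps_nth (?ev f) s \<in> Q" if "f \<in> carrier (mp_ring (mat_coords m))" for s f
    unfolding Q(2) z_def[symmetric] using that
    by (intro jet_coeff_in_pt_infinity mp_const_hom) (simp add: carrier_mp_ring)
  have low: "?Jac \<subseteq> {f \<in> carrier (mp_ring (mat_coords m)). ?ev f \<in> fps_below Q (enat (?c * L))}"
    unfolding Jac_eq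
  proof (rule ring.genideal_minimal)
    show "ring (mp_ring (mat_coords m) :: (_, 'k) mpoly ring)"
      using mp_ring_cring by (rule cring.axioms)
    show "ideal {f \<in> carrier (mp_ring (mat_coords m)). ?ev f \<in> fps_below Q (enat (?c * L))} (mp_ring (mat_coords m))"
      unfolding ideal_iff by (intro arc_eval_vimage_ideal mp_const_hom cS zS)
    have "f \<in> carrier (mp_ring (mat_coords m)) \<and> ?ev f \<in> fps_below Q (enat (?c * L))"
      if "f \<in> jac_minors (mat_coords m) ?I ?c" for f
    proof -
      obtain g w where gw: "f = Determinant.det (mat ?c ?c (\<lambda>(a, b). mp_deriv (w b) (g a)))"
        "\<And>a. a < ?c \<Longrightarrow> g a \<in> ?I" "\<And>b. b < ?c \<Longrightarrow> w b \<in> mat_coords m"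
        using \<open>f \<in> jac_minors (mat_coords m) ?I ?c\<close> unfolding jac_minors_def by auto
      have "f \<in> carrier (mp_ring (mat_coords m))"
        unfolding gw(1)
      proof (rule M.det_S[of _ ?c])
        fix a b assume "a < ?c" "b < ?c"
        then show "mat ?c ?c (\<lambda>(a, b). mp_deriv (w b) (g a)) $$ (a, b) \<in> carrier (mp_ring (mat_coords m))"
          using mp_vars_deriv[of "w b" "g a"] minors_ideal_vars[OF gw(2)[of a]] by (auto simp: carrier_mp_ring)
      qed simp
      moreover have "?ev f = minor ?c (\<lambda>a b. ?ev (mp_deriv (w b) (g a))) id id"
        unfolding hom_minor[OF e.comm_ring_hom_axioms, symmetric] gw(1) minor_def by simp
      then have "tpow (enat L) ^ ?c dvd ?ev f"
        using dvd_det[of ?c "tpow (enat L)" "\<lambda>a b. ?ev (mp_deriv (w b) (g a))"] I(2) gw by simp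
      then have "?ev f \<in> fps_below Q (enat (?c * L))"
        unfolding tpow_power using tpow_dvd_nth zero_J by (fastforce simp: fps_below_def)
      ultimately show ?thesis by blast
    qed
    moreover have "f \<in> carrier (mp_ring (mat_coords m)) \<and> ?ev f \<in> fps_below Q (enat (?c * L))" if "f \<in> ?I" for f
      using I(1)[OF that] minors_ideal_vars[OF that] by (simp add: carrier_mp_ring fps_below_def zero_J)
    ultimately show "?I \<union> jac_minors (mat_coords m) ?I ?c \<subseteq>
        {f \<in> carrier (mp_ring (mat_coords m)). ?ev f \<in> fps_below Q (enat (?c * L))}" by blast
  qed
  have "inv_cond Q m k ?\<mu> (marc z)"
    using C_orbit_inv_cond[OF \<gamma> ok] by (simp add: Q(2) inv_cond_pt[OF mp_const_hom] z_def)
  then have "\<not> minors_ge Q m (marc z) k (tail_sum m ?\<mu> k + 1)" unfolding inv_cond_def by blast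
  then have "\<not> minors_ge Q m (marc z) k (enat L + 1)" by (simp add: L)
  then obtain \<alpha> \<beta> where ab: "\<alpha> \<in> {0..<k} \<rightarrow> {0..<m}" "\<beta> \<in> {0..<k} \<rightarrow> {0..<m}"
    and "minor k (marc z) \<alpha> \<beta> \<notin> fps_below Q (enat L + 1)"
    unfolding minors_ge_def by blast
  then obtain s where "enat s < enat L + 1" and "fps_nth (minor k (marc z) \<alpha> \<beta>) s \<notin> Q"
    unfolding fps_below_def by blast
  then have s: "s \<le> L" "fps_nth (minor k (marc z) \<alpha> \<beta>) s \<notin> Q" by (simp_all add: one_enat_def)
  have sL: "s = L"
  proof (rule ccontr)
    assume "s \<noteq> L"
    then have "fps_nth (minor k (marc z) \<alpha> \<beta>) s = 0"
      using tpow_dvd_nth[OF kdvd, of s] s(1) by simp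
    then show False using s(2) zero_J by simp
  qed
  have inj: "inj_on \<alpha> {0..<k}" "inj_on \<beta> {0..<k}"
  proof -
    have "minor k (marc z) \<alpha> \<beta> \<noteq> 0" using s(2) zero_J by auto
    then show "inj_on \<alpha> {0..<k}" "inj_on \<beta> {0..<k}"
      using minor_eq_0_row[of _ _ k \<alpha> "marc z" \<beta>] minor_eq_0_col[of _ _ k \<beta> "marc z" \<alpha>]
      unfolding inj_on_def by (metis atLeastLessThan_iff)+
  qed
  let ?d = "pminor k \<alpha> \<beta> :: (_, 'k) mpoly"
  have "?d ^ ?c \<in> jac_minors (mat_coords m) ?I ?c" by (rule pminor_power_in_jac_minors[OF ab(1) inj(1) ab(2) inj(2)])
  moreover have jac_sub: "?I \<union> jac_minors (mat_coords m) ?I ?c \<subseteq> carrier (mp_ring (mat_coords m))"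
  proof -
    have "f \<in> carrier (mp_ring (mat_coords m))" if "f \<in> jac_minors (mat_coords m) ?I ?c" for f
    proof -
      obtain g w where gw: "f = Determinant.det (mat ?c ?c (\<lambda>(a, b). mp_deriv (w b) (g a)))"
        "\<And>a. a < ?c \<Longrightarrow> g a \<in> ?I"
        using \<open>f \<in> jac_minors (mat_coords m) ?I ?c\<close> unfolding jac_minors_def by auto
      show ?thesis unfolding gw(1)
      proof (rule M.det_S[of _ ?c])
        fix a b assume "a < ?c" "b < ?c"
        then show "mat ?c ?c (\<lambda>(a, b). mp_deriv (w b) (g a)) $$ (a, b) \<in> carrier (mp_ring (mat_coords m))"
          using mp_vars_deriv[of "w b" "g a"] minors_ideal_vars[OF gw(2)[of a]] by (auto simp: carrier_mp_ring)
      qed simp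
    qed
    then show ?thesis by (intro Un_least subsetI) (simp_all add: carrier_mp_ring minors_ideal_vars)
  qed
  ultimately have dJ: "?d ^ ?c \<in> ?Jac"
    unfolding Jac_eq using ring.genideal_self[OF cring.axioms(1)[OF mp_ring_cring] jac_sub] by blast
  obtain d where d: "minor k (marc z) \<alpha> \<beta> = tpow (enat L) * d" using kdvd unfolding dvd_def by blast
  have d0: "fps_nth d 0 = fps_nth (minor k (marc z) \<alpha> \<beta>) L" by (simp add: d tpow_mult_nth)
  have "?ev (?d ^ ?c) = tpow (enat (?c * L)) * d ^ ?c"
    by (simp add: e.hom_power arc_eval_pminor[OF mp_const_hom] d power_mult_distrib tpow_power)
  then have "fps_nth (?ev (?d ^ ?c)) (?c * L) = fps_nth d 0 ^ ?c"
    by (simp add: tpow_mult_nth fps_power_zeroth)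
  moreover have "fps_nth d 0 \<in> carrier (mp_ring (GG_vars m))"
  proof -
    interpret F: subring_ideal "fps_over (carrier (mp_ring (GG_vars m)))"
      "fps_over (carrier (mp_ring (GG_vars m))) \<inter> fps_below Q \<infinity>" by (rule fps_subring_ideal)
    have "minor k (marc z) \<alpha> \<beta> \<in> fps_over (carrier (mp_ring (GG_vars m)))"
      using ab zS by (intro F.minor_S) (auto simp: fps_over_def Pi_iff)
    then show ?thesis unfolding d0 by (simp add: fps_over_def)
  qed
  ultimately have "fps_nth (?ev (?d ^ ?c)) (?c * L) \<notin> Q"
    using s(2) power_notin_J[of "fps_nth d 0" ?c] by (simp add: d0 sL)
  moreover have "?d ^ ?c \<in> carrier (mp_ring (mat_coords m))" using dJ low by blast
  ultimately have mem: "jet_coeff (?c * L) (?d ^ ?c) \<notin> \<gamma>" using jc[of "?d ^ ?c" "?c * L"] by simp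
  show ?thesis
    unfolding arc_ord_def Suc_eq_plus1[symmetric]
  proof (rule antisym)
    show "Inf {enat s |s. \<exists>f\<in>?Jac. jet_coeff s f \<notin> \<gamma>} \<le> enat (?c * L)"
      using dJ mem by (intro Inf_lower) blast
    show "enat (?c * L) \<le> Inf {enat s |s. \<exists>f\<in>?Jac. jet_coeff s f \<notin> \<gamma>}"
    proof (rule Inf_greatest)
      fix x assume "x \<in> {enat s |s. \<exists>f\<in>?Jac. jet_coeff s f \<notin> \<gamma>}"
      then obtain s f where x: "x = enat s" and f: "f \<in> ?Jac" "jet_coeff s f \<notin> \<gamma>" by blast
      have fc: "f \<in> carrier (mp_ring (mat_coords m))" "?ev f \<in> fps_below Q (enat (?c * L))"
        using subsetD[OF low f(1)] by simp_all
      have notin: "fps_nth (?ev f) s \<notin> Q" using f(2) jc[OF fc(1), of s] by simp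
      show "enat (?c * L) \<le> x"
      proof (rule ccontr)
        assume "\<not> enat (?c * L) \<le> x"
        then have "fps_nth (?ev f) s \<in> Q" using fc(2) by (simp add: x fps_below_def)
        with notin show False by contradiction
      qed
    qed
  qed
qed

section \<open>The dimension of truncated orbits\<close>

definition ldu_pt :: "nat \<Rightarrow> (nat \<Rightarrow> enat) \<Rightarrow> (nat \<times> nat \<times> nat \<Rightarrow> 'b::comm_ring_1) \<Rightarrow>
    (nat \<Rightarrow> nat) \<Rightarrow> (nat \<Rightarrow> nat) \<Rightarrow> (nat \<times> nat) \<times> nat \<Rightarrow> 'b" where
  "ldu_pt m \<mu> z \<rho> \<kappa> = (\<lambda>((i, j), s). fps_nth (gdh m (lower_of z \<rho>) \<mu> (upper_of z \<kappa>) i j) s)"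

lemma ldu_pt_hom:
  assumes "comm_ring_hom f"
  shows "f (ldu_pt m \<mu> z \<rho> \<kappa> v) = ldu_pt m \<mu> (\<lambda>v. f (z v)) \<rho> \<kappa> v"
proof -
  interpret f: comm_ring_hom f by fact
  interpret F: comm_ring_hom "fps_map f" by (rule fps_map_hom[OF assms])
  have z: "fps_map f (zser z p r) = zser (\<lambda>v. f (z v)) p r" for p r by (simp add: fps_eq_iff)
  have "fps_map f (lower_of z \<rho> i p) = lower_of (\<lambda>v. f (z v)) \<rho> i p"
    "fps_map f (upper_of z \<kappa> p i) = upper_of (\<lambda>v. f (z v)) \<kappa> p i" for i p
    by (simp_all add: lower_of_def upper_of_def xser_def yser_def F.hom_mult z)
  then show ?thesis
    by (cases v) (auto simp: ldu_pt_def gdh_hom[OF assms] simp flip: fps_map_nth[of f])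
qed

lemma (in subring_ideal) cong_ldu_pt:
  assumes "\<And>v. z v \<in> S" "\<And>v. z' v \<in> S" "\<And>p r s. p < m \<Longrightarrow> z (p, r, s) - z' (p, r, s) \<in> J"
  shows "ldu_pt m \<mu> z \<rho> \<kappa> v - ldu_pt m \<mu> z' \<rho> \<kappa> v \<in> J" "ldu_pt m \<mu> z \<rho> \<kappa> v \<in> S"
proof -
  interpret F: subring_ideal "fps_over S" "fps_over S \<inter> fps_below J \<infinity>" by (rule fps_subring_ideal)
  have zS: "zser z p r \<in> fps_over S" "zser z' p r \<in> fps_over S" for p r using assms by (simp_all add: fps_over_def)
  have zz: "zser z p r - zser z' p r \<in> fps_over S \<inter> fps_below J \<infinity>" if "p < m" for p r
    using F.diff_S[OF zS] assms(3)[OF that] by (simp add: fps_below_def)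
  have xS: "xser z p r \<in> fps_over S" "xser z' p r \<in> fps_over S" "yser z p r \<in> fps_over S" "yser z' p r \<in> fps_over S" for p r
    using zS F.one_S by (simp_all add: xser_def yser_def)
  have xx: "xser z p r - xser z' p r \<in> fps_over S \<inter> fps_below J \<infinity>"
    "yser z p r - yser z' p r \<in> fps_over S \<inter> fps_below J \<infinity>" if "p < m" for p r
    using zz[OF that] F.zero_J by (simp_all add: xser_def yser_def)
  have tp: "tpow a \<in> fps_over S" for a by (auto simp: fps_over_def tpow_nth one_S zero_S)
  have l: "lower_of z \<rho> i p \<in> fps_over S" "lower_of z' \<rho> i p \<in> fps_over S"
    "upper_of z \<kappa> p i \<in> fps_over S" "upper_of z' \<kappa> p i \<in> fps_over S" for i p
    using zS xS F.zero_S F.mult_S by (simp_all add: lower_of_def upper_of_def)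
  have ll: "lower_of z \<rho> i p - lower_of z' \<rho> i p \<in> fps_over S \<inter> fps_below J \<infinity>"
    "upper_of z \<kappa> p i - upper_of z' \<kappa> p i \<in> fps_over S \<inter> fps_below J \<infinity>" if "p < m" for i p
    using F.cong_mult[OF zz[OF that] xx(1)[OF that] zS(2) xS(1)] xx(2)[OF that] F.zero_J
    by (simp_all add: lower_of_def upper_of_def)
  have "gdh m (lower_of z \<rho>) \<mu> (upper_of z \<kappa>) i j - gdh m (lower_of z' \<rho>) \<mu> (upper_of z' \<kappa>) i j
      \<in> fps_over S \<inter> fps_below J \<infinity>" for i j
    unfolding gdh_def
  proof (intro F.cong_sum)
    fix p assume "p \<in> {0..<m}"
    then have p: "p < m" by simp
    have t0: "tpow (\<mu> p) - tpow (\<mu> p) \<in> fps_over S \<inter> fps_below J \<infinity>" using F.zero_J by simp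
    show "lower_of z \<rho> i p * (tpow (\<mu> p) * upper_of z \<kappa> p j) - lower_of z' \<rho> i p * (tpow (\<mu> p) * upper_of z' \<kappa> p j)
        \<in> fps_over S \<inter> fps_below J \<infinity>"
      by (rule F.cong_mult[OF ll(1)[OF p] F.cong_mult[OF t0 ll(2)[OF p] tp l(3)] l(2) F.mult_S[OF tp l(3)]])
  qed
  then show "ldu_pt m \<mu> z \<rho> \<kappa> v - ldu_pt m \<mu> z' \<rho> \<kappa> v \<in> J"
    by (cases v) (auto simp: ldu_pt_def fps_below_def)
  have "gdh m (lower_of z \<rho>) \<mu> (upper_of z \<kappa>) i j \<in> fps_over S" for i j
    unfolding gdh_def by (intro F.sum_S F.mult_S l tp)
  then show "ldu_pt m \<mu> z \<rho> \<kappa> v \<in> S"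
    by (cases v) (auto simp: ldu_pt_def fps_over_def)
qed

section \<open>The upper bound for the dimension: parameters visible modulo t^(l+1)\<close>

text \<open>Indices of the parameters that matter at level \<open>l\<close>. Pivots
  \<open>p < m - k\<close> have exponent \<infinity> and drop out; for the last \<open>q\<close>
  pivots the range of \<open>s\<close> starts at 1, their constant terms being fixed.\<close>

definition lvars :: "nat \<Rightarrow> nat \<Rightarrow> (nat \<Rightarrow> enat) \<Rightarrow> nat \<Rightarrow> nat \<Rightarrow> (nat \<times> nat \<times> nat) set" where
  "lvars m k \<mu> q l = (SIGMA p:{m - k..<m}. {..2 * p} \<times>
    {(if m - q \<le> p then 1 else 0)..<Suc l - the_enat (\<mu> p)})"

lemma finite_lvars: "finite (lvars m k \<mu> q l)"
  by (simp add: lvars_def)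

lemma card_lvars:
  "card (lvars m k \<mu> q l) =
    (\<Sum>p = m - k..<m. (2 * p + 1) * (Suc l - the_enat (\<mu> p) - (if m - q \<le> p then 1 else 0)))"
proof -
  have "card (lvars m k \<mu> q l) = (\<Sum>p = m - k..<m. card ({..2 * p} \<times>
    {(if m - q \<le> p then 1 else 0)..<Suc l - the_enat (\<mu> p)}))"
    unfolding lvars_def by (rule card_SigmaI) auto
  then show ?thesis by (simp add: card_cartesian_product)
qed

text \<open>The trivial parameters, with scalars 1 and all other series 0, for which the pivoted
  form is the diagonal matrix itself.\<close>

definition lconst :: "nat \<times> nat \<times> nat \<Rightarrow> 'b::comm_ring_1" where
  "lconst = (\<lambda>(p, r, s). if r = p \<and> s = 0 then 1 else 0)"

lemma lconst_hom: "comm_ring_hom f \<Longrightarrow> f (lconst v) = lconst v"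
proof -
  assume "comm_ring_hom f"
  then interpret f: comm_ring_hom f .
  show ?thesis by (simp add: lconst_def case_prod_beta)
qed

text \<open>The generic parameters: independent variables, except for the constant terms prescribed
  on the last \<open>q\<close> pivots.\<close>

definition lgen :: "nat \<Rightarrow> nat \<Rightarrow> nat \<times> nat \<times> nat \<Rightarrow> (nat, 'k::comm_ring_1) mpoly" where
  "lgen m q = (\<lambda>(p, r, s). if m - q \<le> p \<and> s = 0 then lconst (p, r, s) else mp_var (to_nat (p, r, s)))"

lemma (in subring_ideal) fps_mult_coeffs_S:
  assumes "\<And>i. i \<le> N \<Longrightarrow> fps_nth F i \<in> S" "\<And>i. i \<le> N \<Longrightarrow> fps_nth G i \<in> S" "n \<le> N"
  shows "fps_nth (F * G) n \<in> S"
  unfolding fps_mult_nth using assms by (intro sum_S mult_S) auto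

text \<open>Once the factor \<open>t^(\<mu> p)\<close> is split off, the coefficient of
  \<open>t^s\<close> involves only coefficients of index at most \<open>s - \<mu> p\<close> of the
  three series.\<close>

lemma mp_vars_ldu_pt_lgen:
  assumes ok: "lam_ok m k \<mu>" and ij: "\<rho> i < m" "\<kappa> j < m" and s: "s \<le> l"
  shows "mp_vars (ldu_pt m \<mu> (lgen m q) \<rho> \<kappa> ((i, j), s) :: (nat, 'k::comm_ring_1) mpoly) \<subseteq> to_nat ` lvars m k \<mu> q l"
proof -
  let ?Y = "to_nat ` lvars m k \<mu> q l"
  interpret subring_ideal "carrier (mp_ring ?Y)" "{0 :: (nat, 'k) mpoly}" by (rule mp_ring_subring)
  have c: "lconst v \<in> carrier (mp_ring ?Y :: (nat, 'k) mpoly ring)" for v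
    by (simp add: lconst_def case_prod_beta one_S zero_S)
  have "fps_nth (ldu_term \<mu> (lgen m q) p a b :: (nat, 'k) mpoly fps) s \<in> carrier (mp_ring ?Y)"
    if p: "a \<le> p" "b \<le> p" "p < m" for p a b
  proof (cases "\<mu> p")
    case infinity
    then show ?thesis by (simp add: ldu_term_def tpow_def zero_S)
  next
    case (enat n)
    then have pk: "m - k \<le> p" using ok by (force simp: lam_ok_def not_le)
    show ?thesis
    proof (cases "s < n")
      case True
      then show ?thesis by (simp add: ldu_term_def enat tpow_mult_nth mult.assoc zero_S)
    next
      case False
      have z: "fps_nth (zser (lgen m q) p r :: (nat, 'k) mpoly fps) t \<in> carrier (mp_ring ?Y)"
        if "r \<le> 2 * p" "t \<le> s - n" for r t
      proof (cases "m - q \<le> p \<and> t = 0")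
        case True
        then show ?thesis using c by (simp add: lgen_def)
      next
        case nc: False
        have "(p, r, t) \<in> lvars m k \<mu> q l"
          using that p pk s False nc by (auto simp: lvars_def enat)
        moreover have "lgen m q (p, r, t) = (mp_var (to_nat (p, r, t)) :: (nat, 'k) mpoly)"
          using nc by (auto simp: lgen_def)
        ultimately show ?thesis by (simp add: carrier_mp_ring mp_vars_var)
      qed
      have one: "fps_nth (1 :: (nat, 'k) mpoly fps) t \<in> carrier (mp_ring ?Y)" for t
        by (simp add: fps_one_nth one_S zero_S)
      have x: "fps_nth (xser (lgen m q) p a :: (nat, 'k) mpoly fps) t \<in> carrier (mp_ring ?Y)"
        "fps_nth (yser (lgen m q) p b :: (nat, 'k) mpoly fps) t \<in> carrier (mp_ring ?Y)" if "t \<le> s - n" for t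
        using z[of a t] z[of "Suc (p + b)" t] one that p by (auto simp: xser_def yser_def)
      have "fps_nth (zser (lgen m q) p p * xser (lgen m q) p a * yser (lgen m q) p b :: (nat, 'k) mpoly fps) (s - n)
          \<in> carrier (mp_ring ?Y)"
        by (intro fps_mult_coeffs_S[of "s - n"] z x) auto
      then show ?thesis using False by (simp add: ldu_term_def enat tpow_mult_nth mult.assoc)
    qed
  qed
  then have "fps_nth (ldu m \<mu> (lgen m q) (\<rho> i) (\<kappa> j) :: (nat, 'k) mpoly fps) s \<in> carrier (mp_ring ?Y)"
    unfolding ldu_def fps_sum_nth by (intro sum_S) auto
  then show ?thesis
    by (simp add: ldu_pt_def gdh_lower_upper[where \<rho> = \<rho> and i = i and \<kappa> = \<kappa> and j = j, OF ij] carrier_mp_ring)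
qed

lemma trunc_pt: "trunc V (enat l) (pt h y J (V \<times> UNIV)) = pt h y J (V \<times> {..l})"
  unfolding trunc_def jet_ring_enat by (rule pt_trunc) auto

text \<open>The point is a specialization of a generic pivoted arc: an equation satisfied by
  independent parameters persists under the ring map that sends them to the actual ones. The
  permutations come from pivoting.\<close>

lemma C_orbit_trunc_contains:
  fixes \<gamma> :: "'k::field mat_jet"
  assumes ok: "lam_ok m k (\<lambda>p. lam (Suc p))" and q: "q \<le> m" and \<gamma>: "\<gamma> \<in> C_orbit m lam"
    and id: "\<And>i j. i < m \<Longrightarrow> j < m \<Longrightarrow> m - q \<le> i \<or> m - q \<le> j \<Longrightarrow>
      mp_var ((i, j), 0) - mp_const (if i = j then 1 else 0) \<in> \<gamma>"
  shows "\<exists>\<rho> \<kappa>. \<rho> permutes {0..<m} \<and> \<kappa> permutes {0..<m} \<and>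
    pt mp_const (ldu_pt m (\<lambda>p. lam (Suc p)) (lgen m q) \<rho> \<kappa>) {0} (mat_coords m \<times> {..l}) \<subseteq> trunc (mat_coords m) (enat l) \<gamma>"
proof (rule C_orbit_ldu[OF ok q C_orbit_subset_Spec[OF \<gamma>] C_orbit_inv_cond[OF \<gamma> ok] id])
  let ?\<mu> = "\<lambda>p. lam (Suc p)"
  fix S J h and y :: "_ \<Rightarrow> 'k rat_fun" and \<rho> \<kappa> z
  assume lp: "local_pair S J" and h: "comm_ring_hom h" "\<And>c. h c \<in> S"
    and y: "\<And>v. v \<in> mat_coords m \<times> UNIV \<Longrightarrow> y v \<in> S" and eq: "\<gamma> = pt h y J (mat_coords m \<times> UNIV)"
    and perm: "\<rho> permutes {0..<m}" "\<kappa> permutes {0..<m}" and z: "\<And>v. z v \<in> S"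
    and zq: "\<And>p r. p < m \<Longrightarrow> m - q \<le> p \<Longrightarrow> z (p, r, 0) - (if r = p then 1 else 0) \<in> J"
    and yz: "\<And>i j s. i < m \<Longrightarrow> j < m \<Longrightarrow> y ((i, j), s) - fps_nth (gdh m (lower_of z \<rho>) ?\<mu> (upper_of z \<kappa>) i j) s \<in> J"
  interpret local_pair S J by (rule lp)
  define e where "e = mp_eval h (\<lambda>n. z (from_nat n))"
  have e: "comm_ring_hom e" unfolding e_def by (rule mp_eval_hom[OF h(1)])
  \<comment> \<open>The prescribed constant terms hold for \<open>z\<close> only modulo
    \<open>J\<close>; \<open>z'\<close> has them exactly.\<close>
  define z' where "z' v = e (lgen m q v)" for v
  have z'_eq: "z' (p, r, s) = (if m - q \<le> p \<and> s = 0 then lconst (p, r, s) else z (p, r, s))" for p r s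
    using lconst_hom[OF e] by (simp add: z'_def lgen_def e_def mp_eval_var[OF h(1)])
  have "lconst v \<in> S" for v by (simp add: lconst_def case_prod_beta one_S zero_S)
  then have z'S: "z' v \<in> S" for v using z by (cases v) (simp add: z'_eq)
  have zz': "z (p, r, s) - z' (p, r, s) \<in> J" if "p < m" for p r s
    using zq[OF that] zero_J by (auto simp: z'_eq lconst_def)
  have cong: "y v - ldu_pt m ?\<mu> z' \<rho> \<kappa> v \<in> J" if v: "v \<in> mat_coords m \<times> UNIV" for v
  proof -
    have "y v - ldu_pt m ?\<mu> z \<rho> \<kappa> v \<in> J" using v yz by (auto simp: ldu_pt_def)
    then show ?thesis
      using cong_ldu_pt(1)[where z = z and z' = z', OF z z'S zz'] by (rule cong_trans)
  qed
  have "pt mp_const (ldu_pt m ?\<mu> (lgen m q) \<rho> \<kappa>) {0} (mat_coords m \<times> {..l}) \<subseteq> trunc (mat_coords m) (enat l) \<gamma>"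
  proof
    fix f assume f: "f \<in> pt mp_const (ldu_pt m ?\<mu> (lgen m q) \<rho> \<kappa>) {0 :: (nat, 'k) mpoly} (mat_coords m \<times> {..l})"
    then have fc: "f \<in> carrier (mp_ring (mat_coords m \<times> {..l}))"
      and "mp_eval mp_const (ldu_pt m ?\<mu> (lgen m q) \<rho> \<kappa>) f = (0 :: (nat, 'k) mpoly)" by (simp_all add: pt_def)
    then have "e (mp_eval mp_const (ldu_pt m ?\<mu> (lgen m q) \<rho> \<kappa>) f) = 0"
      by (simp add: e_def mp_eval_0[OF h(1)])
    moreover have "e \<circ> mp_const = h" by (simp add: fun_eq_iff e_def mp_eval_const[OF h(1)])
    moreover have "e \<circ> ldu_pt m ?\<mu> (lgen m q) \<rho> \<kappa> = ldu_pt m ?\<mu> z' \<rho> \<kappa>"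
      by (simp add: fun_eq_iff ldu_pt_hom[OF e] z'_def[abs_def])
    ultimately have 0: "mp_eval h (ldu_pt m ?\<mu> z' \<rho> \<kappa>) f = 0"
      by (simp add: hom_mp_eval[OF e])
    have "mp_eval h y f - mp_eval h (ldu_pt m ?\<mu> z' \<rho> \<kappa>) f \<in> J"
    proof (rule cong_mp_eval)
      fix v assume "v \<in> mp_vars f"
      then have v: "v \<in> mat_coords m \<times> UNIV" using fc by (auto simp: carrier_mp_ring)
      show "y v \<in> S" "y v - ldu_pt m ?\<mu> z' \<rho> \<kappa> v \<in> J" by (rule y[OF v], rule cong[OF v])
      show "ldu_pt m ?\<mu> z' \<rho> \<kappa> v \<in> S" by (rule cong_ldu_pt(2)[where z' = z', OF z'S z'S]) (simp add: zero_J)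
    qed (rule h)
    then have "mp_eval h y f \<in> J" by (simp add: 0)
    then show "f \<in> trunc (mat_coords m) (enat l) \<gamma>"
      using fc unfolding eq trunc_pt by (simp add: pt_def)
  qed
  then show ?thesis using perm by blast
qed

section \<open>The lower bound for the dimension\<close>

lemma zero_prime: "subring_prime UNIV {0 :: 'a::idom}"
  by standard auto

lemma mp_var_neq_0: "mp_var v \<noteq> (0 :: ('v, 'k::comm_ring_1) mpoly)"
  using mp_vars_var[of v, where 'k = 'k] by (metis insert_not_empty mp_vars_const mp_const_def single_zero)

text \<open>The matrix entry and power of t at which a parameter shows: column \<open>p\<close> for
  \<open>x_p\<close>, the diagonal for \<open>u_p\<close>, row \<open>p\<close> for
  \<open>y_p\<close>.\<close>

definition lpos :: "(nat \<Rightarrow> enat) \<Rightarrow> nat \<times> nat \<times> nat \<Rightarrow> (nat \<times> nat) \<times> nat" where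
  "lpos \<mu> = (\<lambda>(p, r, s). ((if r < p then (r, p) else if r = p then (p, p) else (p, r - Suc p)), s + the_enat (\<mu> p)))"

text \<open>If the pivots after \<open>p\<close>, and the scalar \<open>u\<^sub>p\<close> unless \<open>r = p\<close>, are still trivial, then the
  parameter \<open>z (p, r, s)\<close> is visible as an entry of the matrix.\<close>

lemma ldu_pt_lpos:
  assumes v: "(p, r, s) \<in> lvars m k \<mu> q l" and fin: "\<mu> p \<noteq> \<infinity>"
    and later: "\<And>p' r s. p < p' \<Longrightarrow> z (p', r, s) = lconst (p', r, s)"
    and unit: "r \<noteq> p \<Longrightarrow> \<forall>s. z (p, p, s) = lconst (p, p, s)"
  shows "ldu_pt m \<mu> z id id (lpos \<mu> (p, r, s)) = (z (p, r, s) :: 'b::comm_ring_1)"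
proof -
  obtain n where n: "\<mu> p = enat n" using fin by auto
  have r: "r \<le> 2 * p" and pm: "p < m" using v by (auto simp: lvars_def)
  \<comment> \<open>A later pivot with trivial parameters touches only its own diagonal
    entry.\<close>
  have zero: "ldu_term \<mu> z p' a b = 0" if "p < p'" "a \<le> p" for p' a b
  proof -
    have "zser z p' a = 0" using that later by (simp add: fps_eq_iff lconst_def)
    then show ?thesis using that by (simp add: ldu_term_def xser_def)
  qed
  have ldu: "ldu m \<mu> z a b = ldu_term \<mu> z p a b" if "max a b = p" for a b
  proof -
    have "ldu m \<mu> z a b = (\<Sum>p'\<in>{p}. ldu_term \<mu> z p' a b)"
      unfolding ldu_def that by (rule sum.mono_neutral_right) (use pm that zero in \<open>auto\<close>)
    then show ?thesis by simp
  qed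
  have u: "zser z p p = 1" if "r \<noteq> p" using unit[OF that] by (simp add: fps_eq_iff lconst_def)
  have entry: "ldu_pt m \<mu> z id id ((a, b), s + n) = fps_nth (zser z p p * xser z p a * yser z p b) s"
    if "max a b = p" for a b
  proof -
    have "a < m" "b < m" using that pm by auto
    then have "ldu_pt m \<mu> z id id ((a, b), s + n) = fps_nth (ldu m \<mu> z a b) (s + n)"
      by (simp add: ldu_pt_def gdh_lower_upper)
    also have "\<dots> = fps_nth (tpow (enat n) * (zser z p p * xser z p a * yser z p b)) (s + n)"
      by (simp add: ldu[OF that] ldu_term_def n mult.assoc)
    finally show ?thesis by (simp add: tpow_mult_nth)
  qed
  consider "r < p" | "r = p" | "p < r" by linarith
  then show ?thesis
  proof cases
    case 1
    then show ?thesis using entry[of r p] u by (simp add: lpos_def n xser_def yser_def)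
  next
    case 2
    then show ?thesis using entry[of p p] by (simp add: lpos_def n xser_def yser_def)
  next
    case 3
    then have "max p (r - Suc p) = p" using r by simp
    then show ?thesis using entry[of p "r - Suc p"] u 3 r by (simp add: lpos_def n xser_def yser_def)
  qed
qed

lemma lpos_mem:
  assumes "v \<in> lvars m k \<mu> q l"
  shows "lpos \<mu> v \<in> mat_coords m \<times> {..l}"
  using assms by (auto simp: lvars_def lpos_def)

text \<open>Free the parameters one by one, inner pivots first and in each pivot the scalar last.\<close>

lemma lvars_order:
  "\<exists>vs. distinct vs \<and> set vs = lvars m k \<mu> q l \<and>
    (\<forall>i j p r s p' r' s'. i \<le> j \<longrightarrow> j < length vs \<longrightarrow> vs ! i = (p', r', s') \<longrightarrow> vs ! j = (p, r, s) \<longrightarrow>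
      p' \<le> p \<and> (p' = p \<longrightarrow> r' = p \<longrightarrow> r = p))"
proof -
  \<comment> \<open>Doubling \<open>p\<close> leaves room for the flag that places the scalar after
    the other parameters of its pivot.\<close>
  define key where "key = (\<lambda>(p, r, s :: nat). 2 * p + (if r = p then 1 else 0) :: nat)"
  obtain xs where xs: "set xs = lvars m k \<mu> q l" "distinct xs"
    using finite_distinct_list[OF finite_lvars] by blast
  let ?vs = "sort_key key xs"
  show ?thesis
  proof (intro exI[of _ ?vs] conjI allI impI)
    show "distinct ?vs" "set ?vs = lvars m k \<mu> q l" using xs by simp_all
    fix i j p r s p' r' s'
    assume ij: "i \<le> j" "j < length ?vs" and v: "?vs ! i = (p', r', s')" "?vs ! j = (p, r, s)"
    have "map key ?vs ! i \<le> map key ?vs ! j"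
      by (rule sorted_nth_mono[OF sorted_sort_key]) (use ij in simp_all)
    then have "key (p', r', s') \<le> key (p, r, s)" using ij v by (simp del: length_sort)
    then show "p' \<le> p" "p' = p \<Longrightarrow> r' = p \<Longrightarrow> r = p" by (auto simp: key_def split: if_splits)
  qed
qed

text \<open>The prime \<open>P i\<close> has the first \<open>i\<close> parameters free and the
  others trivial. Freeing one more gives a strictly smaller prime, since a matrix coefficient
  changes from a constant to a variable.\<close>

lemma krull_dim_ge_ldu:
  fixes T :: "'k::field mat_jet set"
  assumes ok: "lam_ok m k \<mu>" and T: "T \<subseteq> Spec (mp_ring (mat_coords m \<times> {..l}))"
    and pts: "\<And>z :: nat \<times> nat \<times> nat \<Rightarrow> (nat, 'k) mpoly. (\<And>p. p < m \<Longrightarrow> z (p, p, 0) \<noteq> 0) \<Longrightarrow>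
      (\<And>p r. m - q \<le> p \<Longrightarrow> z (p, r, 0) = lconst (p, r, 0)) \<Longrightarrow>
      pt mp_const (ldu_pt m \<mu> z id id) {0} (mat_coords m \<times> {..l}) \<in> T"
  shows "ereal (real (card (lvars m k \<mu> q l))) \<le>
    krull_dim (subtopology (zariski (mp_ring (mat_coords m \<times> {..l}))) T)"
proof -
  obtain vs where vs: "distinct vs" "set vs = lvars m k \<mu> q l"
    and ord: "\<forall>i j p r s p' r' s'. i \<le> j \<longrightarrow> j < length vs \<longrightarrow> vs ! i = (p', r', s') \<longrightarrow> vs ! j = (p, r, s) \<longrightarrow>
      p' \<le> p \<and> (p' = p \<longrightarrow> r' = p \<longrightarrow> r = p)"
    using lvars_order[of m k \<mu> q l] by (elim exE conjE)
  note order = ord[rule_format]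
  have len: "length vs = card (lvars m k \<mu> q l)" using distinct_card[OF vs(1)] vs(2) by simp
  let ?W = "mat_coords m \<times> {..l}"
  define z where "z i v = (if v \<in> set (take i vs) then mp_var (to_nat v) else lconst v :: (nat, 'k) mpoly)" for i v
  define P where "P i = pt mp_const (ldu_pt m \<mu> (z i) id id) {0} ?W" for i
  have const: "z i v = lconst v" if "v \<notin> lvars m k \<mu> q l" for i v
    using that vs(2) set_take_subset[of i vs] by (auto simp: z_def)
  show ?thesis
    unfolding len[symmetric]
  proof (rule krull_dim_ge[OF T])
    show "P i \<in> T" if "i \<le> length vs" for i
      unfolding P_def
    proof (rule pts)
      show "z i (p, p, 0) \<noteq> 0" if "p < m" for p
        by (simp add: z_def mp_var_neq_0 lconst_def)
      show "z i (p, r, 0) = lconst (p, r, 0)" if "m - q \<le> p" for p r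
        using that by (intro const) (auto simp: lvars_def)
    qed
    fix i assume i: "i < length vs"
    obtain p r s where v: "vs ! i = (p, r, s)" by (cases "vs ! i") auto
    have vl: "(p, r, s) \<in> lvars m k \<mu> q l" using vs(2) i nth_mem[OF i] by (simp add: v)
    have fin: "\<mu> p \<noteq> \<infinity>" using vl ok by (auto simp: lvars_def lam_ok_def)
    have vi: "(p, r, s) \<notin> set (take i vs)" "(p, r, s) \<in> set (take (Suc i) vs)"
    proof -
      have "distinct (take i vs @ vs ! i # drop (Suc i) vs)"
        unfolding id_take_nth_drop[OF i, symmetric] by (rule vs(1))
      then show "(p, r, s) \<notin> set (take i vs)" by (simp add: v)
      show "(p, r, s) \<in> set (take (Suc i) vs)" using i by (simp add: take_Suc_conv_app_nth v)
    qed
    have before: "p' \<le> p \<and> (p' = p \<longrightarrow> r' = p \<longrightarrow> r = p)" if mem: "(p', r', s') \<in> set (take j vs)" "j \<le> Suc i" for p' r' s' j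
    proof -
      obtain a where "a < length (take j vs)" "take j vs ! a = (p', r', s')"
        using mem(1) by (auto simp: in_set_conv_nth)
      then have "a \<le> i" "vs ! a = (p', r', s')" using mem(2) by auto
      then show ?thesis using order[OF _ i _ v] by blast
    qed
    have val: "ldu_pt m \<mu> (z j) id id (lpos \<mu> (p, r, s)) = z j (p, r, s)" if "j \<le> Suc i" for j
    proof (rule ldu_pt_lpos[OF vl fin])
      show "z j (p', r', s') = lconst (p', r', s')" if "p < p'" for p' r' s'
        using before[OF _ \<open>j \<le> Suc i\<close>, of p' r' s'] that by (auto simp: z_def)
      show "\<forall>s. z j (p, p, s) = lconst (p, p, s)" if "r \<noteq> p"
        using before[OF _ \<open>j \<le> Suc i\<close>, of p p] that by (auto simp: z_def)
    qed
    \<comment> \<open>This substitution sets the parameter just freed back to its trivial value, so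
      the elements of \<open>P (Suc i)\<close> also lie in \<open>P i\<close>.\<close>
    define \<sigma> where "\<sigma> = mp_eval mp_const (\<lambda>n. z i (from_nat n))"
    have \<sigma>: "comm_ring_hom \<sigma>" unfolding \<sigma>_def by (rule mp_eval_hom[OF mp_const_hom])
    have \<sigma>z: "\<sigma> (z (Suc i) v) = z i v" for v
    proof (cases "v \<in> set (take (Suc i) vs)")
      case True
      then show ?thesis by (simp add: z_def[of "Suc i"] \<sigma>_def mp_eval_var[OF mp_const_hom])
    next
      case False
      then have "v \<notin> set (take i vs)" using i by (simp add: take_Suc_conv_app_nth)
      then show ?thesis using False by (simp add: z_def lconst_hom[OF \<sigma>])
    qed
    have sub: "P (Suc i) \<subseteq> P i"
    proof
      fix f assume "f \<in> P (Suc i)"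
      then have f: "f \<in> carrier (mp_ring ?W)" "mp_eval mp_const (ldu_pt m \<mu> (z (Suc i)) id id) f = 0"
        by (simp_all add: P_def pt_def)
      have "mp_eval mp_const (ldu_pt m \<mu> (z i) id id) f = \<sigma> (mp_eval mp_const (ldu_pt m \<mu> (z (Suc i)) id id) f)"
        unfolding hom_mp_eval[OF \<sigma>]
        by (simp add: o_def ldu_pt_hom[OF \<sigma>] \<sigma>z) (simp add: \<sigma>_def mp_eval_const[OF mp_const_hom])
      also have "\<dots> = 0" by (simp add: f(2) \<sigma>_def mp_eval_0[OF mp_const_hom])
      finally show "f \<in> P i" using f(1) by (simp add: P_def pt_def)
    qed
    \<comment> \<open>Separates the two primes: it evaluates to 0 while the parameter is trivial,
      and to a variable minus a constant once it is free.\<close>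
    let ?f = "mp_var (lpos \<mu> (p, r, s)) - lconst (p, r, s) :: ((nat \<times> nat) \<times> nat, 'k) mpoly"
    have ev: "mp_eval mp_const (ldu_pt m \<mu> (z j) id id) ?f = z j (p, r, s) - lconst (p, r, s)" if "j \<le> Suc i" for j
    proof -
      have hom: "comm_ring_hom (mp_eval mp_const (ldu_pt m \<mu> (z j) id id))" by (rule mp_eval_hom[OF mp_const_hom])
      then interpret e: comm_ring_hom "mp_eval mp_const (ldu_pt m \<mu> (z j) id id)" .
      show ?thesis by (simp add: e.hom_minus mp_eval_var[OF mp_const_hom] val[OF that] lconst_hom[OF hom])
    qed
    interpret M: subring_ideal "carrier (mp_ring ?W)" "{0 :: (_, 'k) mpoly}" by (rule mp_ring_subring)
    have "lconst (p, r, s) \<in> carrier (mp_ring ?W :: ((nat \<times> nat) \<times> nat, 'k) mpoly ring)"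
      by (simp add: lconst_def M.one_S M.zero_S)
    then have fc: "?f \<in> carrier (mp_ring ?W)"
      using lpos_mem[OF vl] by (intro M.diff_S) (simp_all add: carrier_mp_ring mp_vars_var)
    have "?f \<in> P i" using fc ev[of i] vi(1) by (simp add: P_def pt_def z_def)
    moreover have "?f \<notin> P (Suc i)"
    proof
      assume "?f \<in> P (Suc i)"
      then have "mp_var (to_nat (p, r, s)) = (lconst (p, r, s) :: (nat, 'k) mpoly)"
        using ev[of "Suc i"] vi(2) by (simp add: P_def pt_def z_def)
      then have "mp_vars (mp_var (to_nat (p, r, s)) :: (nat, 'k) mpoly) = {}"
        by (auto simp: lconst_def mp_vars_def)
      then show False by (simp add: mp_vars_var)
    qed
    ultimately show "P (Suc i) \<subset> P i" using sub by blast
  qed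
qed

section \<open>Orbits are cylinders\<close>

lemma jet_coeff_pminor_carrier:
  assumes "\<alpha> \<in> {0..<j} \<rightarrow> {0..<m}" "\<beta> \<in> {0..<j} \<rightarrow> {0..<m}" "s \<le> r"
  shows "jet_coeff s (pminor j \<alpha> \<beta>) \<in> carrier (jet_ring (mat_coords m) (enat r))"
proof -
  have "mp_vars (pminor j \<alpha> \<beta>) \<subseteq> mat_coords m"
    using mp_vars_pminor[OF assms(1,2)] by (simp add: lessThan_atLeast0)
  then have "mp_vars (jet_coeff s (pminor j \<alpha> \<beta>)) \<subseteq> mat_coords m \<times> {..s}" by (rule mp_vars_jet_coeff)
  also have "\<dots> \<subseteq> mat_coords m \<times> {..r}" using assms(3) by auto
  finally show ?thesis by (simp add: jet_ring_enat carrier_mp_ring)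
qed

definition minor_jets :: "nat \<Rightarrow> nat \<Rightarrow> enat \<Rightarrow> ((nat \<times> nat) \<times> nat, 'k::comm_ring_1) mpoly set" where
  "minor_jets m j e = {jet_coeff s (pminor j \<alpha> \<beta>) | s \<alpha> \<beta>.
    \<alpha> \<in> {0..<j} \<rightarrow> {0..<m} \<and> \<beta> \<in> {0..<j} \<rightarrow> {0..<m} \<and> enat s < e}"

lemma minors_ge_iff_minor_jets:
  fixes P :: "'k::comm_ring_1 mat_jet"
  shows "minors_ge P m (marc mp_var) j e \<longleftrightarrow> minor_jets m j e \<subseteq> P"
proof
  assume ge: "minors_ge P m (marc mp_var) j e"
  show "minor_jets m j e \<subseteq> P"
  proof
    fix f :: "((nat \<times> nat) \<times> nat, 'k) mpoly" assume "f \<in> minor_jets m j e"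
    then obtain s \<alpha> \<beta> where f: "f = jet_coeff s (pminor j \<alpha> \<beta>)"
      and "\<alpha> \<in> {0..<j} \<rightarrow> {0..<m}" "\<beta> \<in> {0..<j} \<rightarrow> {0..<m}" "enat s < e"
      unfolding minor_jets_def by blast
    then show "f \<in> P" unfolding f minor_marc_var[symmetric] by (intro minors_geD[OF ge])
  qed
next
  assume sub: "minor_jets m j e \<subseteq> P"
  have "jet_coeff s (pminor j \<alpha> \<beta> :: (_, 'k) mpoly) \<in> P"
    if "\<alpha> \<in> {0..<j} \<rightarrow> {0..<m}" "\<beta> \<in> {0..<j} \<rightarrow> {0..<m}" "enat s < e" for s \<alpha> \<beta>
    using that by (intro subsetD[OF sub]) (auto simp: minor_jets_def)
  then show "minors_ge P m (marc mp_var) j e"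
    by (simp add: minors_ge_def fps_below_def minor_marc_var)
qed

lemma minor_jets_carrier:
  assumes "e \<le> enat r + 1"
  shows "minor_jets m j e \<subseteq> carrier (jet_ring (mat_coords m) (enat r))"
proof
  fix f assume "f \<in> minor_jets m j e"
  then obtain s \<alpha> \<beta> where f: "f = jet_coeff s (pminor j \<alpha> \<beta>)"
    and ab: "\<alpha> \<in> {0..<j} \<rightarrow> {0..<m}" "\<beta> \<in> {0..<j} \<rightarrow> {0..<m}" and s: "enat s < e"
    unfolding minor_jets_def by blast
  have "enat s < enat r + 1" using s assms by (rule order.strict_trans2)
  then have "s \<le> r" by (simp add: one_enat_def)
  then show "f \<in> carrier (jet_ring (mat_coords m) (enat r))"
    unfolding f by (rule jet_coeff_pminor_carrier[OF ab])
qed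

lemma tail_sum_mono: "j \<le> k \<Longrightarrow> tail_sum m \<mu> j \<le> tail_sum m \<mu> k"
  unfolding tail_sum_def by (rule sum_mono2) auto

lemma D_arcs_Spec: "(\<gamma> :: 'k::field mat_jet) \<in> D_arcs m k \<Longrightarrow> \<gamma> \<in> Spec (mp_ring (mat_coords m \<times> UNIV))"
  by (simp add: D_arcs_def jets_def jet_ring_infinity)

lemma D_arcs_minors_ge: "(\<gamma> :: 'k::field mat_jet) \<in> D_arcs m k \<Longrightarrow> minors_ge \<gamma> m (marc mp_var) (Suc k) \<infinity>"
  unfolding minors_ge_iff_minor_jets
  by (auto simp: minor_jets_def D_arcs_def jets_def intro!: pminor_in_minors_ideal)

text \<open>In part (2), \<open>G\<close> consists of the equations of \<open>x\<^sub>q\<close>.\<close>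

lemma C_orbit_cylinder_at:
  fixes G :: "((nat \<times> nat) \<times> nat, 'k::field) mpoly set"
  assumes ok: "lam_ok m k (\<lambda>p. lam (Suc p))" and L: "tail_sum m (\<lambda>p. lam (Suc p)) k = enat L"
    and G: "G \<subseteq> carrier (jet_ring (mat_coords m) (enat L))"
  shows "cylinder_at (mat_coords m) (minors_ideal m (Suc k)) L {\<gamma> \<in> C_orbit m lam. G \<subseteq> \<gamma>}"
proof -
  let ?\<mu> = "\<lambda>p. lam (Suc p)" and ?V = "mat_coords m" and ?I = "minors_ideal m (Suc k) :: (_, 'k) mpoly set"
  let ?t = "\<lambda>j. tail_sum m ?\<mu> j"
  define F where "F = G \<union> (\<Union>j\<in>{..k}. minor_jets m j (?t j))"
  define E where "E j = (minor_jets m j (?t j + 1) :: ((nat \<times> nat) \<times> nat, 'k) mpoly set)" for j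
  \<comment> \<open>\<open>F\<close> collects the closed conditions, each \<open>E j\<close> gives
    an open one, and the vanishing of the \<open>(k+1)\<close>-minors is built into the jets. Level
    \<open>L\<close> suffices because the tail sums up to \<open>j = k\<close> are at most
    \<open>L\<close>.\<close>
  let ?S = "{P \<in> jets ?V ?I (enat L). F \<subseteq> P \<and> (\<forall>j\<in>{..k}. \<not> E j \<subseteq> P)}"
  have tL: "?t j \<le> enat L" if "j \<le> k" for j using tail_sum_mono[OF that, of m ?\<mu>] by (simp add: L)
  have FC: "F \<subseteq> carrier (jet_ring ?V (enat L))"
    unfolding F_def
  proof (intro Un_least UN_least G minor_jets_carrier)
    fix j assume "j \<in> {..k}"
    then show "?t j \<le> enat L + 1" using tL[of j] by (intro order_trans[OF tL]) (simp_all add: one_enat_def)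
  qed
  have EC: "E j \<subseteq> carrier (jet_ring ?V (enat L))" if "j \<in> {..k}" for j
    unfolding E_def using tL[of j] that by (intro minor_jets_carrier add_right_mono) simp
  have "constructible_in (jet_space ?V ?I (enat L)) ?S"
    by (rule constructible_closed_open[OF _ FC]) (simp_all add: minors_ideal_vars EC)
  moreover have "{\<gamma> \<in> C_orbit m lam. G \<subseteq> \<gamma>} = {\<gamma> \<in> jets ?V ?I \<infinity>. trunc ?V (enat L) \<gamma> \<in> ?S}"
  proof (intro equalityI subsetI)
    fix \<gamma> assume "\<gamma> \<in> {\<gamma> \<in> C_orbit m lam. G \<subseteq> \<gamma>}"
    then have \<gamma>: "\<gamma> \<in> C_orbit m lam" "G \<subseteq> \<gamma>" by simp_all
    have arc: "\<gamma> \<in> jets ?V ?I \<infinity>" using C_orbit_subset_D_arcs[OF ok] \<gamma>(1) by (auto simp: D_arcs_def)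
    have "inv_cond \<gamma> m k ?\<mu> (marc mp_var)" by (rule C_orbit_inv_cond[OF \<gamma>(1) ok])
    then have inv: "minor_jets m j (?t j) \<subseteq> \<gamma>" "\<not> E j \<subseteq> \<gamma>" if "j \<le> k" for j
      using that unfolding inv_cond_def minors_ge_iff_minor_jets E_def by blast+
    have "F \<subseteq> \<gamma>" unfolding F_def using \<gamma>(2) inv(1) by (intro Un_least UN_least) simp_all
    with FC have "F \<subseteq> trunc ?V (enat L) \<gamma>" by (simp add: trunc_def)
    moreover have "\<not> E j \<subseteq> trunc ?V (enat L) \<gamma>" if "j \<in> {..k}" for j
      using inv(2)[of j] that by (auto simp: trunc_def)
    moreover have "trunc ?V (enat L) \<gamma> \<in> jets ?V ?I (enat L)"
      by (rule trunc_jets[OF arc]) (rule minors_ideal_vars)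
    ultimately have "trunc ?V (enat L) \<gamma> \<in> ?S" by simp
    then show "\<gamma> \<in> {\<gamma> \<in> jets ?V ?I \<infinity>. trunc ?V (enat L) \<gamma> \<in> ?S}" using arc by simp
  next
    fix \<gamma> assume "\<gamma> \<in> {\<gamma> \<in> jets ?V ?I \<infinity>. trunc ?V (enat L) \<gamma> \<in> ?S}"
    then have arc: "\<gamma> \<in> D_arcs m k" and F: "F \<subseteq> \<gamma>"
      and nE: "\<forall>j\<in>{..k}. \<not> E j \<subseteq> \<gamma> \<inter> carrier (jet_ring ?V (enat L))"
      by (simp_all add: D_arcs_def trunc_def)
    have E: "\<not> E j \<subseteq> \<gamma>" if "j \<le> k" for j
    proof
      assume "E j \<subseteq> \<gamma>"
      with EC[of j] that have "E j \<subseteq> \<gamma> \<inter> carrier (jet_ring ?V (enat L))" by simp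
      with bspec[OF nE, of j] that show False by simp
    qed
    have "minor_jets m j (?t j) \<subseteq> \<gamma>" if "j \<le> k" for j
      using F that unfolding F_def by auto
    then have "inv_cond \<gamma> m k ?\<mu> (marc mp_var)"
      using D_arcs_minors_ge[OF arc] E by (simp add: inv_cond_def minors_ge_iff_minor_jets E_def)
    moreover have "G \<subseteq> \<gamma>" using F by (simp add: F_def)
    ultimately show "\<gamma> \<in> {\<gamma> \<in> C_orbit m lam. G \<subseteq> \<gamma>}"
      using D_arcs_Spec[OF arc] by (simp add: C_orbit_iff[OF ok])
  qed
  ultimately show ?thesis unfolding cylinder_at_def by blast
qed

section \<open>Codimension\<close>

lemma krull_dim_empty:
  fixes T :: "'a topology"
  shows "krull_dim (subtopology T {}) = -\<infinity>"
proof -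
  have "\<not> irreducible_in (subtopology T {}) Z" for Z by (auto simp: irreducible_in_def)
  then have "{ereal (real n) | n. \<exists>Z :: nat \<Rightarrow> 'a set.
     (\<forall>i\<le>n. closedin (subtopology T {}) (Z i) \<and> irreducible_in (subtopology T {}) (Z i)) \<and> (\<forall>i<n. Z i \<subset> Z (Suc i))} = {}"
    by auto
  then show ?thesis unfolding krull_dim_def by (simp only: Sup_empty bot_ereal_def)
qed

text \<open>The value is unique because two levels \<open>r\<close> and \<open>r'\<close> can be
  compared at an \<open>l\<close> that is admissible for both.\<close>

lemma codim_contact_eq:
  assumes "cylinder_at V I r C"
    and "\<And>l. l \<ge> max e r \<Longrightarrow> c = ereal (real (n * (l + 1))) -
        krull_dim (subtopology (jet_space V I (enat l)) (trunc V (enat l) ` C))"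
  shows "codim_contact V I n e C = c"
  unfolding codim_contact_def
proof (rule the_equality)
  show "\<exists>r. cylinder_at V I r C \<and> (\<forall>l\<ge>max e r. c = ereal (real (n * (l + 1))) -
        krull_dim (subtopology (jet_space V I (enat l)) (trunc V (enat l) ` C)))"
    by (intro exI[of _ r] conjI allI impI assms)
  fix d assume "\<exists>r. cylinder_at V I r C \<and> (\<forall>l\<ge>max e r. d = ereal (real (n * (l + 1))) -
        krull_dim (subtopology (jet_space V I (enat l)) (trunc V (enat l) ` C)))"
  then obtain r' where d: "\<forall>l\<ge>max e r'. d = ereal (real (n * (l + 1))) -
        krull_dim (subtopology (jet_space V I (enat l)) (trunc V (enat l) ` C))" by (elim exE conjE)
  have "d = ereal (real (n * (max e (max r r') + 1))) -
        krull_dim (subtopology (jet_space V I (enat (max e (max r r')))) (trunc V (enat (max e (max r r'))) ` C))"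
    by (rule d[rule_format]) simp
  also have "\<dots> = c" by (rule assms(2)[symmetric]) simp
  finally show "d = c" .
qed

lemma codim_contact_empty: "codim_contact V I n e {} = \<infinity>"
proof (rule codim_contact_eq)
  have "constructible_in (jet_space V I (enat 0)) {}" by (rule constructible_in.intros) simp
  then show "cylinder_at V I 0 {}" by (auto simp: cylinder_at_def)
qed (simp only: krull_dim_empty image_empty ereal_minus_minus, simp)

text \<open>The intersections with all other contact loci are empty and have codimension
  \<infinity>, so the infimum is the single remaining term.\<close>

lemma arc_codim_eq:
  assumes "C \<subseteq> jets V I \<infinity>" "\<And>\<gamma>. \<gamma> \<in> C \<Longrightarrow> arc_ord (Jac V I n) \<gamma> = enat e0"
    and "codim_contact V I n e0 C = c"
  shows "arc_codim V I n C = c"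
proof -
  have 1: "C \<inter> Cont V I (Jac V I n) e0 = C" using assms(1,2) by (auto simp: Cont_def)
  have 2: "C \<inter> Cont V I (Jac V I n) e = {}" if "e \<noteq> e0" for e using assms(2) that by (auto simp: Cont_def)
  show ?thesis unfolding arc_codim_def
  proof (rule antisym)
    show "(INF e. codim_contact V I n e (C \<inter> Cont V I (Jac V I n) e)) \<le> c"
      by (rule INF_lower2[of e0]) (simp_all add: 1 assms(3))
    show "c \<le> (INF e. codim_contact V I n e (C \<inter> Cont V I (Jac V I n) e))"
    proof (rule INF_greatest)
      fix e show "c \<le> codim_contact V I n e (C \<inter> Cont V I (Jac V I n) e)"
        by (cases "e = e0") (simp_all add: 1 2 assms(3) codim_contact_empty)
    qed
  qed
qed

lemma sum_odd_atLeastLessThan: "k \<le> m \<Longrightarrow> (\<Sum>p = m - k..<m. 2 * p + 1) = k * (2 * m - k :: nat)"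
proof -
  assume "k \<le> m"
  then obtain d where m: "m = d + k" using le_Suc_ex by (metis add.commute)
  have "(\<Sum>p = d..<d + k. 2 * p + 1) = k * (2 * d + k)" for k
    by (induction k) (auto simp: algebra_simps)
  then show ?thesis by (simp add: m)
qed

text \<open>Stated additively, since the subtractions in \<open>card_lvars\<close> are truncated.
  The truncation takes no effect: a pivot without fixed terms has exponent at most
  \<open>L \<le> l\<close>, and one of the last \<open>q\<close> has exponent 0.\<close>

lemma card_lvars_add:
  assumes ok: "lam_ok m k \<mu>" and L: "tail_sum m \<mu> k = enat L" "L \<le> l"
    and zero: "\<And>p. p < m \<Longrightarrow> m - q \<le> p \<Longrightarrow> \<mu> p = 0"
  shows "card (lvars m k \<mu> q l) + (\<Sum>p = m - k..<m. (2 * p + 1) * (the_enat (\<mu> p) + (if m - q \<le> p then 1 else 0))) =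
    k * (2 * m - k) * (l + 1)"
proof -
  have km: "k \<le> m" using ok by (simp add: lam_ok_def)
  have le: "the_enat (\<mu> p) + (if m - q \<le> p then 1 else 0) \<le> Suc l" if p: "p \<in> {m - k..<m}" for p
  proof (cases "m - q \<le> p")
    case True
    then show ?thesis using zero[of p] p by (simp add: zero_enat_def)
  next
    case False
    have "\<mu> p \<le> enat L" unfolding L(1)[symmetric] tail_sum_def using p by (intro member_le_sum) auto
    then have "the_enat (\<mu> p) \<le> L" by (cases "\<mu> p") auto
    then show ?thesis using False L(2) by simp
  qed
  have "card (lvars m k \<mu> q l) + (\<Sum>p = m - k..<m. (2 * p + 1) * (the_enat (\<mu> p) + (if m - q \<le> p then 1 else 0))) =
      (\<Sum>p = m - k..<m. (2 * p + 1) * Suc l)"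
    unfolding card_lvars sum.distrib[symmetric]
  proof (intro sum.cong refl)
    fix p assume "p \<in> {m - k..<m}"
    then have "Suc l - the_enat (\<mu> p) - (if m - q \<le> p then 1 else 0) +
        (the_enat (\<mu> p) + (if m - q \<le> p then 1 else 0)) = Suc l" using le[of p] by linarith
    then show "(2 * p + 1) * (Suc l - the_enat (\<mu> p) - (if m - q \<le> p then 1 else 0)) +
        (2 * p + 1) * (the_enat (\<mu> p) + (if m - q \<le> p then 1 else 0)) = (2 * p + 1) * Suc l"
      by (simp only: distrib_left[symmetric])
  qed
  also have "\<dots> = k * (2 * m - k) * (l + 1)"
    by (simp only: sum_distrib_right[symmetric] sum_odd_atLeastLessThan[OF km] Suc_eq_plus1)
  finally show ?thesis .
qed

text \<open>Serves both formulas: \<open>q = 0\<close> for the whole orbit, the given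
  \<open>q\<close> for its intersection with the contact locus. \<open>id\<close> supplies the
  equations behind the upper bound of the dimension, \<open>pts\<close> the points behind the lower
  one.\<close>

lemma D_codim_eq:
  fixes C :: "'k::field mat_jet set"
  assumes ok: "lam_ok m k (\<lambda>p. lam (Suc p))" and L: "tail_sum m (\<lambda>p. lam (Suc p)) k = enat L" and q: "q \<le> m"
    and zero: "\<And>p. p < m \<Longrightarrow> m - q \<le> p \<Longrightarrow> lam (Suc p) = 0"
    and C: "C \<subseteq> C_orbit m lam" "cylinder_at (mat_coords m) (minors_ideal m (Suc k)) L C"
    and id: "\<And>\<gamma> i j. \<gamma> \<in> C \<Longrightarrow> i < m \<Longrightarrow> j < m \<Longrightarrow> m - q \<le> i \<or> m - q \<le> j \<Longrightarrow>
      mp_var ((i, j), 0) - mp_const (if i = j then 1 else 0) \<in> \<gamma>"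
    and pts: "\<And>z :: nat \<times> nat \<times> nat \<Rightarrow> (nat, 'k) mpoly. (\<And>p. p < m \<Longrightarrow> z (p, p, 0) \<noteq> 0) \<Longrightarrow>
      (\<And>p r. m - q \<le> p \<Longrightarrow> z (p, r, 0) = lconst (p, r, 0)) \<Longrightarrow>
      pt mp_const (ldu_pt m (\<lambda>p. lam (Suc p)) z id id) {0} (mat_coords m \<times> UNIV) \<in> C"
  shows "D_codim m k C = ereal (real (\<Sum>p = m - k..<m. (2 * p + 1) *
      (the_enat (lam (Suc p)) + (if m - q \<le> p then 1 else 0))))" (is "_ = ereal (real ?val)")
proof -
  let ?\<mu> = "\<lambda>p. lam (Suc p)" and ?V = "mat_coords m" and ?I = "minors_ideal m (Suc k) :: (_, 'k) mpoly set"
  let ?n = "k * (2 * m - k)"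
  have CD: "C \<subseteq> jets ?V ?I \<infinity>" using subset_trans[OF C(1) C_orbit_subset_D_arcs[OF ok]] by (simp add: D_arcs_def)
  have dim: "krull_dim (subtopology (jet_space ?V ?I (enat l)) (trunc ?V (enat l) ` C)) =
      ereal (real (card (lvars m k ?\<mu> q l)))" if l: "L \<le> l" for l
  proof -
    let ?T = "trunc ?V (enat l) ` C" and ?W = "?V \<times> {..l}"
    have TJ: "?T \<subseteq> jets ?V ?I (enat l)"
      using trunc_jets[where V = ?V and I = ?I and l = l] CD minors_ideal_vars by fastforce
    then have T: "?T \<subseteq> Spec (mp_ring ?W)" by (auto simp: jets_def jet_ring_enat)
    have "subtopology (jet_space ?V ?I (enat l)) ?T = subtopology (zariski (mp_ring ?W)) ?T"
      unfolding jet_space_def jet_ring_enat subtopology_subtopology using TJ by (simp add: Int_absorb1)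
    moreover have "krull_dim (subtopology (zariski (mp_ring ?W)) ?T) \<le> ereal (real (card (lvars m k ?\<mu> q l)))"
    proof (rule krull_dim_le[OF T])
      let ?K = "\<lambda>(\<rho>, \<kappa>). pt mp_const (ldu_pt m ?\<mu> (lgen m q) \<rho> \<kappa>) {0 :: (nat, 'k) mpoly} ?W"
      let ?\<K> = "?K ` ({\<rho>. \<rho> permutes {0..<m}} \<times> {\<kappa>. \<kappa> permutes {0..<m}})"
      show "finite ?\<K>" by (intro finite_imageI finite_cartesian_product finite_permutations) simp_all
      show "K \<subseteq> carrier (mp_ring ?W)" if "K \<in> ?\<K>" for K using that by (auto simp: pt_def)
      show "\<exists>K\<in>?\<K>. K \<subseteq> P" if P: "P \<in> ?T" for P
      proof -
        obtain \<gamma> where \<gamma>: "\<gamma> \<in> C" "P = trunc ?V (enat l) \<gamma>" using P by blast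
        obtain \<rho> \<kappa> where "\<rho> permutes {0..<m}" "\<kappa> permutes {0..<m}" "?K (\<rho>, \<kappa>) \<subseteq> P"
          using C_orbit_trunc_contains[OF ok q subsetD[OF C(1) \<gamma>(1)] id[OF \<gamma>(1)], of l] unfolding \<gamma>(2) by auto
        then show ?thesis by (intro bexI[of _ "?K (\<rho>, \<kappa>)"] imageI) auto
      qed
      fix K n and P :: "nat \<Rightarrow> _"
      assume "K \<in> ?\<K>" and P: "\<And>i. i \<le> n \<Longrightarrow> P i \<in> Spec (mp_ring ?W)" "\<And>i. i < n \<Longrightarrow> P i \<subset> P (Suc i)" "K \<subseteq> P 0"
      then obtain \<rho> \<kappa> where perm: "\<rho> permutes {0..<m}" "\<kappa> permutes {0..<m}" and K: "K = ?K (\<rho>, \<kappa>)" by auto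
      have vars: "mp_vars (ldu_pt m ?\<mu> (lgen m q) \<rho> \<kappa> v :: (nat, 'k) mpoly) \<subseteq> to_nat ` lvars m k ?\<mu> q l"
        if "v \<in> ?W" for v
      proof -
        obtain i j s where v: "v = ((i, j), s)" "i < m" "j < m" "s \<le> l" using \<open>v \<in> ?W\<close> by auto
        have "\<rho> i < m" "\<kappa> j < m"
          using permutes_in_image[OF perm(1), of i] permutes_in_image[OF perm(2), of j] v by simp_all
        then show ?thesis unfolding v(1) using v(4) by (rule mp_vars_ldu_pt_lgen[OF ok])
      qed
      have "n \<le> card (to_nat ` lvars m k ?\<mu> q l)"
      proof (rule chain_length_le[where W = ?W and P = P and y = "ldu_pt m ?\<mu> (lgen m q) \<rho> \<kappa> :: _ \<Rightarrow> (nat, 'k) mpoly"])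
        show "finite (to_nat ` lvars m k ?\<mu> q l)" by (rule finite_imageI[OF finite_lvars])
        show "pt mp_const (ldu_pt m ?\<mu> (lgen m q) \<rho> \<kappa>) {0 :: (nat, 'k) mpoly} ?W \<subseteq> P 0"
          using P(3) unfolding K prod.case .
      qed (fact vars P(1) P(2))+
      then show "n \<le> card (lvars m k ?\<mu> q l)" by (simp add: card_image)
    qed
    moreover have "ereal (real (card (lvars m k ?\<mu> q l))) \<le> krull_dim (subtopology (zariski (mp_ring ?W)) ?T)"
    proof (rule krull_dim_ge_ldu[OF ok T])
      fix z :: "nat \<times> nat \<times> nat \<Rightarrow> (nat, 'k) mpoly"
      assume z: "\<And>p. p < m \<Longrightarrow> z (p, p, 0) \<noteq> 0" "\<And>p r. m - q \<le> p \<Longrightarrow> z (p, r, 0) = lconst (p, r, 0)"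
      show "pt mp_const (ldu_pt m ?\<mu> z id id) {0} ?W \<in> ?T"
        unfolding trunc_pt[symmetric] using pts[OF z] by (rule imageI)
    qed
    ultimately show ?thesis by (simp only: antisym)
  qed
  have "arc_codim ?V ?I ?n C = ereal (real ?val)"
  proof (rule arc_codim_eq[OF CD])
    show "arc_ord (Jac ?V ?I ?n) \<gamma> = enat ((m - k) ^ 2 * L)" if "\<gamma> \<in> C" for \<gamma>
      using arc_ord_Jac[OF ok L subsetD[OF C(1) that]] by simp
    show "codim_contact ?V ?I ?n ((m - k) ^ 2 * L) C = ereal (real ?val)"
    proof (rule codim_contact_eq[OF C(2)])
      fix l assume "max ((m - k) ^ 2 * L) L \<le> l"
      then have l: "L \<le> l" by simp
      have "real (?n * (l + 1)) = real (card (lvars m k ?\<mu> q l)) + real ?val"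
        unfolding of_nat_add[symmetric] by (simp only: card_lvars_add[OF ok L l zero])
      then show "ereal (real ?val) = ereal (real (?n * (l + 1))) -
          krull_dim (subtopology (jet_space ?V ?I (enat l)) (trunc ?V (enat l) ` C))"
        unfolding dim[OF l] by simp
    qed
  qed
  then show ?thesis by (simp add: D_codim_def)
qed

lemma ldu_pt_in_C_orbit_id:
  fixes z :: "nat \<times> nat \<times> nat \<Rightarrow> (nat, 'k::field) mpoly"
  assumes "\<And>p. p < m \<Longrightarrow> z (p, p, 0) \<noteq> 0"
  shows "pt mp_const (ldu_pt m (\<lambda>p. lam (Suc p)) z id id) {0} (mat_coords m \<times> UNIV) \<in> C_orbit m lam"
proof -
  interpret subring_prime UNIV "{0 :: (nat, 'k) mpoly}" by (rule zero_prime)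
  show ?thesis
    by (rule ldu_pt_in_C_orbit[of mp_const z m id id])
      (use assms in \<open>auto simp: mp_const_hom permutes_id ldu_pt_def\<close>)
qed

section \<open>The contact locus of x_q\<close>

definition x_eqs :: "nat \<Rightarrow> nat \<Rightarrow> ((nat \<times> nat) \<times> nat, 'k::field) mpoly set" where
  "x_eqs m q = {mp_var ((i, j), 0) - mp_const (x_mat m q $$ (i, j)) | i j. i < m \<and> j < m}"

lemma x_eqs_carrier: "0 \<in> A \<Longrightarrow> x_eqs m q \<subseteq> carrier (mp_ring (mat_coords m \<times> A))"
proof -
  assume "0 \<in> A"
  interpret M: subring_ideal "carrier (mp_ring (mat_coords m \<times> A))" "{0 :: (_, 'k::field) mpoly}" by (rule mp_ring_subring)
  show ?thesis unfolding x_eqs_def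
    using \<open>0 \<in> A\<close> by (auto intro!: M.diff_S simp: carrier_mp_ring mp_vars_var mp_vars_const)
qed

text \<open>Modulo the linear equations every polynomial of level 0 is congruent to its value at
  \<open>x_q\<close>, a constant, and nonzero constants are units. So containing the equations
  already determines the truncation.\<close>

lemma Cont_x_eq: "Cont_x m k q = {\<gamma> \<in> D_arcs m k. x_eqs m q \<subseteq> (\<gamma> :: 'k::field mat_jet)}"
proof -
  let ?W = "mat_coords m \<times> {..0}" and ?x = "\<lambda>(ij, s :: nat). x_mat m q $$ ij :: 'k"
  have ih: "comm_ring_hom (id :: 'k \<Rightarrow> 'k)" using comm_ring_hom_id by (simp add: id_def)
  interpret x: comm_ring_hom "mp_eval id ?x" by (rule mp_eval_hom[OF ih])
  have R0: "jet_ring (mat_coords m) 0 = (mp_ring ?W :: ((nat \<times> nat) \<times> nat, 'k) mpoly ring)"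
    unfolding zero_enat_def jet_ring_enat ..
  have "trunc (mat_coords m) 0 \<gamma> = mat_point m (x_mat m q) \<longleftrightarrow> x_eqs m q \<subseteq> \<gamma>" if \<gamma>: "\<gamma> \<in> D_arcs m k" for \<gamma> :: "'k mat_jet"
  proof
    assume eq: "trunc (mat_coords m) 0 \<gamma> = mat_point m (x_mat m q)"
    have "x_eqs m q \<subseteq> (mat_point m (x_mat m q) :: 'k mat_jet)"
    proof
      fix f :: "((nat \<times> nat) \<times> nat, 'k) mpoly" assume f: "f \<in> x_eqs m q"
      then have "mp_eval id ?x f = 0"
        by (auto simp: x_eqs_def x.hom_minus mp_eval_var[OF ih] mp_eval_const[OF ih])
      then show "f \<in> mat_point m (x_mat m q)"
        using subsetD[OF x_eqs_carrier f, of "{..0}"] by (simp add: mat_point_def R0)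
    qed
    then show "x_eqs m q \<subseteq> \<gamma>" unfolding eq[symmetric] trunc_def by blast
  next
    assume sub: "x_eqs m q \<subseteq> \<gamma>"
    interpret subring_prime "carrier (mp_ring (mat_coords m \<times> UNIV))" \<gamma>
      by (rule Spec_prime[OF D_arcs_Spec[OF \<gamma>]])
    have const: "mp_const c \<in> carrier (mp_ring (mat_coords m \<times> UNIV) :: ((nat \<times> nat) \<times> nat, 'k) mpoly ring)" for c
      by (simp add: carrier_mp_ring mp_vars_const)
    interpret c: comm_ring_hom "mp_const :: 'k \<Rightarrow> ((nat \<times> nat) \<times> nat, 'k) mpoly" by (rule mp_const_hom)
    have unit: "mp_const c \<in> \<gamma> \<longleftrightarrow> c = 0" for c
    proof
      assume "mp_const c \<in> \<gamma>"
      then have "mp_const (inverse c) * mp_const c \<in> \<gamma>" by (rule mult_J[OF const])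
      then show "c = 0" using one_notin_J by (cases "c = 0") (simp_all flip: c.hom_mult)
    qed (simp add: zero_J)
    have "f \<in> \<gamma> \<longleftrightarrow> mp_eval id ?x f = 0" if f: "f \<in> carrier (mp_ring ?W)" for f
    proof -
      have "mp_eval mp_const mp_var f - mp_eval mp_const (mp_const \<circ> ?x) f \<in> \<gamma>"
      proof (rule cong_mp_eval)
        fix v assume "v \<in> mp_vars f"
        then obtain i j where v: "v = ((i, j), 0)" "i < m" "j < m" using f by (auto simp: carrier_mp_ring)
        then have "mp_var v - (mp_const \<circ> ?x) v \<in> x_eqs m q" by (auto simp: x_eqs_def)
        with sub show "mp_var v - (mp_const \<circ> ?x) v \<in> \<gamma>" by blast
        show "mp_var v \<in> carrier (mp_ring (mat_coords m \<times> UNIV))" using v by (simp add: carrier_mp_ring mp_vars_var)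
      qed (simp_all add: const)
      moreover have "mp_eval mp_const (mp_const \<circ> ?x) f = (mp_const (mp_eval id ?x f) :: ((nat \<times> nat) \<times> nat, 'k) mpoly)"
        unfolding hom_mp_eval[OF mp_const_hom] by simp
      ultimately have "f - mp_const (mp_eval id ?x f) \<in> \<gamma>" by simp
      from cong_iff[OF this] show ?thesis by (simp only: unit)
    qed
    then show "trunc (mat_coords m) 0 \<gamma> = mat_point m (x_mat m q)"
      unfolding trunc_def mat_point_def R0 by blast
  qed
  then show ?thesis unfolding Cont_x_def by blast
qed

text \<open>At \<open>t = 0\<close> the pivots of positive exponent vanish, and each of the last
  \<open>q\<close> contributes a 1 on the diagonal.\<close>

lemma ldu_pt_in_Cont_x:
  fixes z :: "nat \<times> nat \<times> nat \<Rightarrow> (nat, 'k::field) mpoly"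
  assumes ok: "lam_ok m k (\<lambda>p. lam (Suc p))"
    and z: "\<And>p. p < m \<Longrightarrow> z (p, p, 0) \<noteq> 0" "\<And>p r. m - q \<le> p \<Longrightarrow> z (p, r, 0) = lconst (p, r, 0)"
    and lam: "\<And>p. p < m \<Longrightarrow> m - q \<le> p \<Longrightarrow> lam (Suc p) = 0" "\<And>p. p < m - q \<Longrightarrow> lam (Suc p) > 0"
  shows "pt mp_const (ldu_pt m (\<lambda>p. lam (Suc p)) z id id) {0} (mat_coords m \<times> UNIV) \<in> Cont_x m k q"
proof -
  let ?\<mu> = "\<lambda>p. lam (Suc p)"
  let ?\<gamma> = "pt mp_const (ldu_pt m ?\<mu> z id id) {0} (mat_coords m \<times> UNIV)"
  interpret e: comm_ring_hom "mp_eval mp_const (ldu_pt m ?\<mu> z id id)" by (rule mp_eval_hom[OF mp_const_hom])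
  have "?\<gamma> \<in> D_arcs m k" using C_orbit_subset_D_arcs[OF ok] ldu_pt_in_C_orbit_id[of m z lam] z(1) by blast
  moreover have "ldu_pt m ?\<mu> z id id ((i, j), 0) = mp_const (x_mat m q $$ (i, j))" if ij: "i < m" "j < m" for i j
  proof -
    have coeff: "fps_nth (ldu_term ?\<mu> z p i j) 0 = (if i = p \<and> j = p \<and> m - q \<le> p then 1 else 0)"
      if p: "p \<in> {max i j..<m}" for p
    proof (cases "m - q \<le> p")
      case True
      then show ?thesis
        using lam(1)[of p] p z(2)[of p] by (auto simp: ldu_term_def xser_def yser_def lconst_def)
    next
      case False
      then have "lam (Suc p) \<noteq> 0" using lam(2)[of p] by simp
      then show ?thesis using False by (simp add: ldu_term_def tpow_nth zero_enat_def)
    qed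
    have "ldu_pt m ?\<mu> z id id ((i, j), 0) = (\<Sum>p = max i j..<m. fps_nth (ldu_term ?\<mu> z p i j) 0)"
      using ij by (simp add: ldu_pt_def gdh_lower_upper ldu_def fps_sum_nth)
    also have "\<dots> = (\<Sum>p = max i j..<m. if p = i then (if i = j \<and> m - q \<le> i then 1 else 0) else 0)"
      by (rule sum.cong) (auto simp: coeff)
    also have "\<dots> = (if i = j \<and> m - q \<le> i then 1 else 0)" using ij by simp
    also have "\<dots> = mp_const (x_mat m q $$ (i, j))"
      using ij by (simp add: x_mat_def mp_const_def)
    finally show ?thesis .
  qed
  then have "mp_eval mp_const (ldu_pt m ?\<mu> z id id) f = 0" if "f \<in> x_eqs m q" for f
    using that by (auto simp: x_eqs_def e.hom_minus mp_eval_var[OF mp_const_hom] mp_eval_const[OF mp_const_hom])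
  then have "f \<in> ?\<gamma>" if "f \<in> x_eqs m q" for f
    using that subsetD[OF x_eqs_carrier[OF UNIV_I] that] by (simp add: pt_def)
  then have "x_eqs m q \<subseteq> ?\<gamma>" by (rule subsetI)
  ultimately show ?thesis by (simp add: Cont_x_eq)
qed

section \<open>The two codimension formulas\<close>

lemma lam_ok_of_partition:
  assumes "1 \<le> k" "k \<le> m" "extended_partition m lam"
    and "\<forall>i\<in>{1..m - k}. lam i = \<infinity>" "lam (m - k + 1) < \<infinity>"
  shows "lam_ok m k (\<lambda>p. lam (Suc p))"
  unfolding lam_ok_def antitone_def
proof (intro conjI allI impI)
  show "lam (Suc j) \<le> lam (Suc i)" if "i \<le> j" "j < m" for i j
    using assms(3) that by (auto simp: extended_partition_def)
  show "lam (Suc p) = \<infinity>" if "p < m - k" for p using assms(4) that by auto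
  show "lam (Suc p) \<noteq> \<infinity>" if "m - k \<le> p" "p < m" for p
  proof -
    have "lam (Suc p) \<le> lam (m - k + 1)"
      using assms(3) that by (auto simp: extended_partition_def)
    also have "\<dots> < \<infinity>" by (rule assms(5))
    finally show ?thesis by simp
  qed
qed (rule assms)

text \<open>The shift \<open>i = p + 1\<close> turns the weight \<open>2 i - 1\<close> into the
  number \<open>2 p + 1\<close> of series of pivot \<open>p\<close>.\<close>

lemma ereal_of_enat_sum:
  assumes ok: "lam_ok m k (\<lambda>p. lam (Suc p))"
  shows "(\<Sum>i = m - k + 1..m. of_nat (2 * i - 1) * lam i) = enat (\<Sum>p = m - k..<m. (2 * p + 1) * the_enat (lam (Suc p)))"
proof -
  have "(\<Sum>i = m - k + 1..m. of_nat (2 * i - 1) * lam i) = (\<Sum>p = m - k..<m. of_nat (2 * Suc p - 1) * lam (Suc p))"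
    using sum.shift_bounds_Suc_ivl[of "\<lambda>i. of_nat (2 * i - 1) * lam i" "m - k" m]
    by (simp add: atLeastLessThanSuc_atLeastAtMost)
  also have "\<dots> = (\<Sum>p = m - k..<m. of_nat ((2 * p + 1) * the_enat (lam (Suc p))))"
  proof (rule sum.cong)
    fix p assume "p \<in> {m - k..<m}"
    then obtain n where "lam (Suc p) = enat n" using ok by (auto simp: lam_ok_def)
    then show "of_nat (2 * Suc p - 1) * lam (Suc p) = of_nat ((2 * p + 1) * the_enat (lam (Suc p)))"
      by (simp add: of_nat_eq_enat)
  qed simp
  also have "\<dots> = enat (\<Sum>p = m - k..<m. (2 * p + 1) * the_enat (lam (Suc p)))"
    by (simp only: of_nat_sum of_nat_eq_enat[symmetric])
  finally show ?thesis .
qed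

theorem proposition5p2:
  fixes m k q :: nat and lam :: "nat \<Rightarrow> enat"
  assumes "1 \<le> k" and "k \<le> m" and "q \<le> k"
    and "extended_partition m lam"
  shows
    "((\<forall>i\<in>{1..m - k}. lam i = \<infinity>) \<and> lam (m - k + 1) < \<infinity> \<longrightarrow>
        (C_orbit m lam :: 'k::field_char_0 mat_jet set) \<subseteq> D_arcs m k \<and>
        D_cylinder m k (C_orbit m lam :: 'k mat_jet set) \<and>
        D_codim m k (C_orbit m lam :: 'k mat_jet set) =
          ereal_of_enat (\<Sum>i = m - k + 1..m. of_nat (2 * i - 1) * lam i))
     \<and>
     ((\<forall>i\<in>{1..m - k}. lam i = \<infinity>) \<and> lam (m - k + 1) < \<infinity> \<and>
      (\<forall>i\<in>{1..m - q}. lam i > 0) \<and> (\<forall>i\<in>{m - q + 1..m}. lam i = 0) \<longrightarrow>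
        C_orbit m lam \<inter> Cont_x m k q \<noteq> ({} :: 'k mat_jet set) \<and>
        D_cylinder m k (C_orbit m lam \<inter> Cont_x m k q :: 'k mat_jet set) \<and>
        D_codim m k (C_orbit m lam \<inter> Cont_x m k q :: 'k mat_jet set) =
          ereal_of_enat (of_nat (q * (2 * m - q)) +
            (\<Sum>i = m - k + 1..m. of_nat (2 * i - 1) * lam i)))"
proof (intro conjI[of "_ \<longrightarrow> _"] impI)
  let ?C = "C_orbit m lam :: 'k mat_jet set"
  assume hyp: "(\<forall>i\<in>{1..m - k}. lam i = \<infinity>) \<and> lam (m - k + 1) < \<infinity>"
  then have ok: "lam_ok m k (\<lambda>p. lam (Suc p))" using assms by (intro lam_ok_of_partition) simp_all
  obtain L where L: "tail_sum m (\<lambda>p. lam (Suc p)) k = enat L" using tail_sum_finite[OF ok order_refl] by auto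
  have cyl: "cylinder_at (mat_coords m) (minors_ideal m (Suc k)) L ?C"
    using C_orbit_cylinder_at[OF ok L, of "{}"] by simp
  \<comment> \<open>With \<open>q = 0\<close> the condition \<open>m - 0 \<le> p\<close> fails for
    all \<open>p < m\<close>, so no constant terms are fixed.\<close>
  have "D_codim m k ?C = ereal (real (\<Sum>p = m - k..<m. (2 * p + 1) *
      (the_enat (lam (Suc p)) + (if m - 0 \<le> p then 1 else 0))))"
    using ldu_pt_in_C_orbit_id[where 'k = 'k] by (intro D_codim_eq[OF ok L _ _ order_refl cyl]) simp_all
  also have "(\<Sum>p = m - k..<m. (2 * p + 1) * (the_enat (lam (Suc p)) + (if m - 0 \<le> p then 1 else 0))) =
      (\<Sum>p = m - k..<m. (2 * p + 1) * the_enat (lam (Suc p)))"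
    by (intro sum.cong) auto
  finally have "D_codim m k ?C = ereal_of_enat (\<Sum>i = m - k + 1..m. of_nat (2 * i - 1) * lam i)"
    unfolding ereal_of_enat_sum[OF ok] by simp
  then show "?C \<subseteq> D_arcs m k \<and> D_cylinder m k ?C \<and>
      D_codim m k ?C = ereal_of_enat (\<Sum>i = m - k + 1..m. of_nat (2 * i - 1) * lam i)"
    using C_orbit_subset_D_arcs[OF ok] cyl by (auto simp: D_cylinder_def cylinder_def)
next
  let ?C = "C_orbit m lam \<inter> Cont_x m k q :: 'k mat_jet set"
  assume hyp: "(\<forall>i\<in>{1..m - k}. lam i = \<infinity>) \<and> lam (m - k + 1) < \<infinity> \<and>
      (\<forall>i\<in>{1..m - q}. lam i > 0) \<and> (\<forall>i\<in>{m - q + 1..m}. lam i = 0)"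
  then have ok: "lam_ok m k (\<lambda>p. lam (Suc p))" using assms by (intro lam_ok_of_partition) simp_all
  obtain L where L: "tail_sum m (\<lambda>p. lam (Suc p)) k = enat L" using tail_sum_finite[OF ok order_refl] by auto
  have qm: "q \<le> m" using assms by simp
  have lam0: "lam (Suc p) = 0" if "p < m" "m - q \<le> p" for p using hyp that by auto
  have lam1: "lam (Suc p) > 0" if "p < m - q" for p using hyp that by auto
  have eq: "?C = {\<gamma> \<in> C_orbit m lam. x_eqs m q \<subseteq> \<gamma>}"
    using C_orbit_subset_D_arcs[OF ok] by (auto simp: Cont_x_eq)
  have cyl: "cylinder_at (mat_coords m) (minors_ideal m (Suc k)) L ?C"
    unfolding eq by (rule C_orbit_cylinder_at[OF ok L]) (simp add: jet_ring_enat x_eqs_carrier)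
  have pts: "pt mp_const (ldu_pt m (\<lambda>p. lam (Suc p)) z id id) {0} (mat_coords m \<times> UNIV) \<in> ?C"
    if "\<And>p. p < m \<Longrightarrow> z (p, p, 0) \<noteq> 0" "\<And>p r. m - q \<le> p \<Longrightarrow> z (p, r, 0) = lconst (p, r, 0)"
    for z :: "nat \<times> nat \<times> nat \<Rightarrow> (nat, 'k) mpoly"
    using ldu_pt_in_C_orbit_id[where z = z and lam = lam and m = m]
      ldu_pt_in_Cont_x[where z = z and lam = lam, OF ok that lam0 lam1] that(1) by blast
  \<comment> \<open>The trivial parameters give the diagonal arc itself.\<close>
  have ne: "?C \<noteq> {}" using pts[of lconst] by (auto simp: lconst_def)
  have id: "mp_var ((i, j), 0) - mp_const (if i = j then 1 else 0) \<in> \<gamma>"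
    if \<gamma>: "\<gamma> \<in> ?C" "i < m" "j < m" "m - q \<le> i \<or> m - q \<le> j" for \<gamma> i j
  proof -
    have "mp_var ((i, j), 0) - mp_const (x_mat m q $$ (i, j)) \<in> \<gamma>"
      using that unfolding eq by (auto simp: x_eqs_def)
    moreover have "x_mat m q $$ (i, j) = (if i = j then 1 else 0 :: 'k)"
      using that(2-4) by (auto simp: x_mat_def)
    ultimately show ?thesis by simp
  qed
  let ?s = "\<lambda>p. if m - q \<le> p then 1 else 0 :: nat"
  have "D_codim m k ?C = ereal (real (\<Sum>p = m - k..<m. (2 * p + 1) * (the_enat (lam (Suc p)) + ?s p)))"
    by (rule D_codim_eq[OF ok L qm lam0 Int_lower1 cyl id pts])
  also have "(\<Sum>p = m - k..<m. (2 * p + 1) * (the_enat (lam (Suc p)) + ?s p)) =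
      (\<Sum>p = m - k..<m. (2 * p + 1) * ?s p) + (\<Sum>p = m - k..<m. (2 * p + 1) * the_enat (lam (Suc p)))"
    by (simp only: distrib_left sum.distrib add.commute)
  \<comment> \<open>Since \<open>q \<le> k\<close>, all of the last \<open>q\<close> pivots lie in
    the summation range.\<close>
  also have "(\<Sum>p = m - k..<m. (2 * p + 1) * ?s p) = (\<Sum>p = m - q..<m. 2 * p + 1)"
    using assms(3) by (intro sum.mono_neutral_cong_right) auto
  also have "\<dots> = q * (2 * m - q)" by (rule sum_odd_atLeastLessThan[OF qm])
  finally have "D_codim m k ?C = ereal_of_enat (of_nat (q * (2 * m - q)) +
      (\<Sum>i = m - k + 1..m. of_nat (2 * i - 1) * lam i))"
    unfolding ereal_of_enat_sum[OF ok] unfolding of_nat_eq_enat plus_enat_simps by simp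
  then show "?C \<noteq> {} \<and> D_cylinder m k ?C \<and> D_codim m k ?C = ereal_of_enat (of_nat (q * (2 * m - q)) +
      (\<Sum>i = m - k + 1..m. of_nat (2 * i - 1) * lam i))"
    using ne cyl by (auto simp: D_cylinder_def cylinder_def)
qed

end
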